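(* Let $G$ be a locally compact group, let $p \in (1,\infty)$, let $f \in A_p(G)$, and let $g \in B_p(G)$. Then the pointwise product $fg$ lies in $A_p(G)$ and $$\|fg\|_{A_p(G)} \leq \|f\|_{A_p(G)}\,\|g\|_{B_p(G)}.$$
   Context: All Banach spaces are complex; $G$ carries a fixed left Haar measure; for $p\in(1,\infty)$, $p'$ is defined by $\frac1p+\frac1{p'}=1$; $\langle\cdot,\cdot\rangle$ is the bilinear pairing of a Banach space and its dual. Representations. A representation of $G$ is a pair $(\pi,E)$ where $E$ is a Banach space and $\pi$ is a group homomorphism from $G$ into the invertible (surjective linear) isometries on $E$, continuous for the given topology on $G$ and the strong operator topology on $\mathcal{B}(E)$. It induces a contractive algebra homomorphism $\pi: L_1(G)\to\mathcal{B}(E)$, $\pi(f)=\int_G f(x)\pi(x)\,dx$ (strong operator convergence). Representations $(\pi,E)$, $(\rho,F)$ are equivalent if there is an invertible isometry $V:E\to F$ with $V\pi(x)V^{-1}=\rho(x)$ for all $x\in G$; equivalent representations are not distinguished. $QSL_p$-spaces. An $L_p$-space is a space $L_p(X)$ for some measure space $X$. A $QSL_p$-space is a Banach space isometrically isomorphic to a quotient of a (closed) subspace of an $L_p$-space. $\mathrm{Rep}_p(G)$ is the collection of (equivalence classes of) representations of $G$ on $QSL_p$-spaces. $(\pi,E)$ is cyclic if there is $\xi\in E$ with $\pi(L_1(G))\xi$ dense in $E$; $\mathrm{Cyc}_p(G)$ is the set of cyclic $(\pi,E)\in\mathrm{Rep}_p(G)$. $B_p(G)$. $B_p(G)$ is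 the set of all functions $f:G\to\mathbb{C}$ of the form $f(x)=\langle\pi(x)\xi,\phi\rangle$ $(x\in G)$ with $(\pi,E)\in\mathrm{Rep}_{p'}(G)$, $\xi\in E$, $\phi\in E^*$; it is a linear space of bounded continuous functions. For $f\in B_p(G)$, $\|f\|_{B_p(G)}$ is the infimum of all sums $\sum_{n=1}^\infty\|\xi_n\|\|\phi_n\|<\infty$ such that for each $n$ there is $(\pi_n,E_n)\in\mathrm{Cyc}_{p'}(G)$ with $\xi_n\in E_n$, $\phi_n\in E_n^*$, and $f(x)=\sum_{n=1}^\infty\langle\pi_n(x)\xi_n,\phi_n\rangle$ for all $x\in G$. $A_p(G)$. $(\lambda_{p'},L_{p'}(G))$ is the left regular representation, $\lambda_{p'}(x)\xi(y)=\xi(x^{-1}y)$. $A_p(G)$ is the set of $f:G\to\mathbb{C}$ of the form $f(x)=\sum_{n=1}^\infty\langle\lambda_{p'}(x)\xi_n,\phi_n\rangle$ $(x\in G)$ with $\xi_n\in L_{p'}(G)$, $\phi_n\in L_p(G)=L_{p'}(G)^*$ and $\sum_n\|\xi_n\|\|\phi_n\|<\infty$; $\|f\|_{A_p(G)}$ is the infimum of $\sum_n\|\xi_n\|\|\phi_n\|$ over all such expressions. *)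

theory Defs
  imports "HOL-Analysis.Analysis" "HOL-Algebra.Algebraic_Closure_Type"
begin

section \<open>Complex Banach spaces\<close>

text \<open>
  The spaces on which representations act have to be quantified over inside formulas, so a normed
  space is a structure on a carrier set rather than an instance of a type class. The vector space
  part is a module over the field \<^term>\<open>ring_of_type_algebra :: complex ring\<close>. The fields
  \<^term>\<open>monoid.mult\<close> and \<^term>\<open>monoid.one\<close>, which the module record inherits from the
  ring record, are never used.
\<close>

record 'e cnspace = "(complex, 'e) module" +
  nrm :: "'e \<Rightarrow> real"

locale complex_normed_space =
  module "ring_of_type_algebra :: complex ring" E for E :: "'e cnspace" (structure) +
  assumes nrm_nonneg: "x \<in> carrier E \<Longrightarrow> 0 \<le> nrm E x"
    and nrm_eq_zero_iff: "x \<in> carrier E \<Longrightarrow> nrm E x = 0 \<longleftrightarrow> x = \<zero>"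
    and nrm_smult: "x \<in> carrier E \<Longrightarrow> nrm E (c \<odot> x) = cmod c * nrm E x"
    and nrm_triangle: "x \<in> carrier E \<Longrightarrow> y \<in> carrier E \<Longrightarrow> nrm E (x \<oplus> y) \<le> nrm E x + nrm E y"

text \<open>
  The locale \<^locale>\<open>Metric_space\<close> wants a distance that is nonnegative and symmetric on the whole
  type, hence the value 0 off the carrier.
\<close>

definition ndist :: "'e cnspace \<Rightarrow> 'e \<Rightarrow> 'e \<Rightarrow> real" where
  "ndist E x y =
     (if x \<in> carrier E \<and> y \<in> carrier E then nrm E (x \<ominus>\<^bsub>E\<^esub> y) else 0)"

definition ntopology :: "'e cnspace \<Rightarrow> 'e topology" where
  "ntopology E = Metric_space.mtopology (carrier E) (ndist E)"

locale complex_banach_space = complex_normed_space +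
  assumes complete: "Metric_space.mcomplete (carrier E) (ndist E)"

definition closed_subspace :: "'e set \<Rightarrow> 'e cnspace \<Rightarrow> bool" where
  "closed_subspace S E \<longleftrightarrow>
     submodule S (ring_of_type_algebra :: complex ring) E \<and> closedin (ntopology E) S"

text \<open>
  In the scalar multiplication, adding \<open>N\<close> only matters for the scalar 0, where it turns
  \<open>{0}\<close> into the coset \<open>N\<close>.
\<close>

definition quotient_space :: "'e cnspace \<Rightarrow> 'e set \<Rightarrow> 'e set cnspace" where
  "quotient_space E N =
     \<lparr>carrier = a_rcosets\<^bsub>E\<^esub> N, monoid.mult = undefined, one = undefined,
      ring.zero = N, add = (\<lambda>A B. A <+>\<^bsub>E\<^esub> B),
      smult = (\<lambda>c A. N <+>\<^bsub>E\<^esub> ((\<lambda>x. c \<odot>\<^bsub>E\<^esub> x) ` A)),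
      nrm = (\<lambda>A. Inf (nrm E ` A))\<rparr>"

definition invertible_isometry :: "('e \<Rightarrow> 'f) \<Rightarrow> 'e cnspace \<Rightarrow> 'f cnspace \<Rightarrow> bool" where
  "invertible_isometry V E F \<longleftrightarrow>
     bij_betw V (carrier E) (carrier F) \<and>
     (\<forall>x\<in>carrier E. \<forall>y\<in>carrier E. V (x \<oplus>\<^bsub>E\<^esub> y) = V x \<oplus>\<^bsub>F\<^esub> V y) \<and>
     (\<forall>c. \<forall>x\<in>carrier E. V (c \<odot>\<^bsub>E\<^esub> x) = c \<odot>\<^bsub>F\<^esub> V x) \<and>
     (\<forall>x\<in>carrier E. nrm F (V x) = nrm E x)"

text \<open>
  Elements of the dual space, as functions on the whole type of which only the values on the
  carrier matter. The bilinear pairing of \<open>x\<close> and \<open>\<phi>\<close> is \<open>\<phi> x\<close>.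
\<close>

definition dual :: "'e cnspace \<Rightarrow> ('e \<Rightarrow> complex) set" where
  "dual E = {\<phi>.
     (\<forall>x\<in>carrier E. \<forall>y\<in>carrier E. \<phi> (x \<oplus>\<^bsub>E\<^esub> y) = \<phi> x + \<phi> y) \<and>
     (\<forall>c. \<forall>x\<in>carrier E. \<phi> (c \<odot>\<^bsub>E\<^esub> x) = c * \<phi> x) \<and>
     (\<exists>C. \<forall>x\<in>carrier E. cmod (\<phi> x) \<le> C * nrm E x)}"

definition dual_norm :: "'e cnspace \<Rightarrow> ('e \<Rightarrow> complex) \<Rightarrow> real" where
  "dual_norm E \<phi> = Sup {cmod (\<phi> x) | x. x \<in> carrier E \<and> nrm E x \<le> 1}"

section \<open>Bochner integral with values in a Banach space\<close>

text \<open>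
  The library's \<^const>\<open>has_bochner_integral\<close>, for functions with values in a structure instead of
  a (second countable) type.
\<close>

definition simple_integrable_in :: "'e cnspace \<Rightarrow> 'a measure \<Rightarrow> ('a \<Rightarrow> 'e) \<Rightarrow> bool" where
  "simple_integrable_in E M s \<longleftrightarrow>
     simple_function M s \<and> s \<in> space M \<rightarrow> carrier E \<and>
     emeasure M {x \<in> space M. s x \<noteq> \<zero>\<^bsub>E\<^esub>} \<noteq> \<infinity>"

definition simple_integral_in :: "'e cnspace \<Rightarrow> 'a measure \<Rightarrow> ('a \<Rightarrow> 'e) \<Rightarrow> 'e" where
  "simple_integral_in E M s =
     (\<Oplus>\<^bsub>E\<^esub>v \<in> s ` space M. complex_of_real (measure M {x \<in> space M. s x = v}) \<odot>\<^bsub>E\<^esub> v)"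

definition has_integral_in :: "'e cnspace \<Rightarrow> 'a measure \<Rightarrow> ('a \<Rightarrow> 'e) \<Rightarrow> 'e \<Rightarrow> bool" where
  "has_integral_in E M F v \<longleftrightarrow>
     F \<in> space M \<rightarrow> carrier E \<and>
     (\<forall>U. openin (ntopology E) U \<longrightarrow> {x \<in> space M. F x \<in> U} \<in> sets M) \<and>
     (\<exists>s. (\<forall>i::nat. simple_integrable_in E M (s i)) \<and>
          (\<lambda>i. \<integral>\<^sup>+x. ennreal (nrm E (F x \<ominus>\<^bsub>E\<^esub> s i x)) \<partial>M) \<longlonglongrightarrow> 0 \<and>
          limitin (ntopology E) (\<lambda>i. simple_integral_in E M (s i)) v sequentially)"

section \<open>Lp-spaces and QSLp-spaces\<close>

definition conj_exp :: "real \<Rightarrow> real" where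
  "conj_exp p = p / (p - 1)"

lemma conj_exp_sum: "1 < p \<Longrightarrow> 1 / p + 1 / conj_exp p = 1"
  by (simp add: conj_exp_def add_divide_distrib [symmetric])

text \<open>The \<open>p\<close>-integrable functions, with the \<open>L\<^sub>p\<close>-seminorm.\<close>

definition Lp_functions :: "real \<Rightarrow> 'm measure \<Rightarrow> ('m \<Rightarrow> complex) cnspace" where
  "Lp_functions p M =
     \<lparr>carrier = {f \<in> borel_measurable M. integrable M (\<lambda>x. cmod (f x) powr p)},
      monoid.mult = undefined, one = undefined,
      ring.zero = (\<lambda>x. 0), add = (\<lambda>f g x. f x + g x), smult = (\<lambda>c f x. c * f x),
      nrm = (\<lambda>f. (\<integral>x. cmod (f x) powr p \<partial>M) powr (1 / p))\<rparr>"

definition Lp_space :: "real \<Rightarrow> 'm measure \<Rightarrow> ('m \<Rightarrow> complex) set cnspace" where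
  "Lp_space p M =
     quotient_space (Lp_functions p M)
       {f \<in> carrier (Lp_functions p M). AE x in M. f x = 0}"

text \<open>The type argument is the type of the points of the underlying measure space.\<close>

definition QSL_space :: "'m itself \<Rightarrow> real \<Rightarrow> 'e cnspace \<Rightarrow> bool" where
  "QSL_space (_ :: 'm itself) p E \<longleftrightarrow>
     complex_banach_space E \<and>
     (\<exists>(M :: 'm measure) S N V.
        closed_subspace S (Lp_space p M) \<and>
        closed_subspace N ((Lp_space p M)\<lparr>carrier := S\<rparr>) \<and>
        invertible_isometry V E (quotient_space ((Lp_space p M)\<lparr>carrier := S\<rparr>) N))"

section \<open>Haar measure and representations\<close>

text \<open>
  Topological groups are written additively, as in the library class
  \<^class>\<open>topological_group_add\<close>, which does not assume commutativity. Haar measure is a Radon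
  measure: finite on compact sets, outer regular on Borel sets, inner regular on open sets.
\<close>

definition left_haar_measure :: "'g::topological_group_add measure \<Rightarrow> bool" where
  "left_haar_measure \<mu> \<longleftrightarrow>
     sets \<mu> = sets borel \<and>
     (\<forall>K. compact K \<longrightarrow> emeasure \<mu> K < \<infinity>) \<and>
     (\<forall>A\<in>sets borel. emeasure \<mu> A = (INF U\<in>{U. open U \<and> A \<subseteq> U}. emeasure \<mu> U)) \<and>
     (\<forall>U. open U \<longrightarrow> emeasure \<mu> U = (SUP K\<in>{K. compact K \<and> K \<subseteq> U}. emeasure \<mu> K)) \<and>
     (\<forall>x. \<forall>A\<in>sets borel. emeasure \<mu> ((\<lambda>y. x + y) ` A) = emeasure \<mu> A) \<and>
     emeasure \<mu> UNIV \<noteq> 0"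

definition representation ::
  "'e cnspace \<Rightarrow> ('g::topological_group_add \<Rightarrow> 'e \<Rightarrow> 'e) \<Rightarrow> bool" where
  "representation E \<pi> \<longleftrightarrow>
     complex_banach_space E \<and>
     (\<forall>x. invertible_isometry (\<pi> x) E E) \<and>
     (\<forall>x y. \<forall>\<xi>\<in>carrier E. \<pi> (x + y) \<xi> = \<pi> x (\<pi> y \<xi>)) \<and>
     (\<forall>\<xi>\<in>carrier E. continuous_map euclidean (ntopology E) (\<lambda>x. \<pi> x \<xi>))"

definition Rep ::
  "'m itself \<Rightarrow> real \<Rightarrow> 'e cnspace \<Rightarrow> ('g::topological_group_add \<Rightarrow> 'e \<Rightarrow> 'e) \<Rightarrow> bool" where
  "Rep T p E \<pi> \<longleftrightarrow> representation E \<pi> \<and> QSL_space T p E"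

text \<open>
  The orbit of \<open>\<xi>\<close> under the operators \<open>\<pi>(f) = \<integral> f(x) \<pi>(x) dx\<close> for \<open>f\<close> in \<open>L\<^sub>1(G)\<close>.
\<close>

definition L1_orbit ::
  "'g::topological_group_add measure \<Rightarrow> 'e cnspace \<Rightarrow> ('g \<Rightarrow> 'e \<Rightarrow> 'e) \<Rightarrow> 'e \<Rightarrow> 'e set" where
  "L1_orbit \<mu> E \<pi> \<xi> =
     {v. \<exists>f. integrable \<mu> (f :: 'g \<Rightarrow> complex) \<and>
             has_integral_in E \<mu> (\<lambda>x. f x \<odot>\<^bsub>E\<^esub> \<pi> x \<xi>) v}"

definition Cyc ::
  "'m itself \<Rightarrow> 'g::topological_group_add measure \<Rightarrow> real \<Rightarrow> 'e cnspace \<Rightarrow>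
   ('g \<Rightarrow> 'e \<Rightarrow> 'e) \<Rightarrow> bool" where
  "Cyc T \<mu> p E \<pi> \<longleftrightarrow>
     Rep T p E \<pi> \<and>
     (\<exists>\<xi>\<in>carrier E. ntopology E closure_of L1_orbit \<mu> E \<pi> \<xi> = carrier E)"

section \<open>The p-analogue of the Fourier--Stieltjes algebra\<close>

text \<open>
  HOL cannot quantify over all Banach spaces and all measure spaces inside a formula. The type
  arguments stand for the types from which the points of the Banach spaces (\<open>'e\<close>) and of the
  measure spaces (\<open>'m\<close>) are drawn. A statement proved for arbitrary \<open>'e\<close> and \<open>'m\<close> covers all
  representations: any sequence of representations on QSLp-spaces has an isometric copy on
  carrier sets inside one sufficiently large type, coming from measures on one such type.
\<close>

definition Bp ::
  "'e itself \<Rightarrow> 'm itself \<Rightarrow> real \<Rightarrow> ('g::topological_group_add \<Rightarrow> complex) set" where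
  "Bp (_ :: 'e itself) T p =
     {f. \<exists>(E :: 'e cnspace) \<pi> \<xi> \<phi>.
           Rep T (conj_exp p) E \<pi> \<and> \<xi> \<in> carrier E \<and> \<phi> \<in> dual E \<and>
           (\<forall>x. f x = \<phi> (\<pi> x \<xi>))}"

definition Bp_norm ::
  "'e itself \<Rightarrow> 'm itself \<Rightarrow> 'g::topological_group_add measure \<Rightarrow> real \<Rightarrow>
   ('g \<Rightarrow> complex) \<Rightarrow> real" where
  "Bp_norm (_ :: 'e itself) T \<mu> p f =
     Inf {(\<Sum>n. nrm (E n) (\<xi> n) * dual_norm (E n) (\<phi> n)) |
            (E :: nat \<Rightarrow> 'e cnspace) \<pi> \<xi> \<phi>.
            (\<forall>n. Cyc T \<mu> (conj_exp p) (E n) (\<pi> n) \<and> \<xi> n \<in> carrier (E n) \<and> \<phi> n \<in> dual (E n)) \<and>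
            summable (\<lambda>n. nrm (E n) (\<xi> n) * dual_norm (E n) (\<phi> n)) \<and>
            (\<forall>x. (\<lambda>n. \<phi> n (\<pi> n x (\<xi> n))) sums f x)}"

section \<open>The Figa-Talamanca--Herz algebra\<close>

definition left_regular :: "'g::group_add \<Rightarrow> ('g \<Rightarrow> complex) \<Rightarrow> 'g \<Rightarrow> complex" where
  "left_regular x \<xi> = (\<lambda>y. \<xi> (- x + y))"

text \<open>
  Elements of \<open>L\<^sub>p(G)\<close> and of its dual are given by representing functions here; norms and
  pairings do not depend on the choice of the representatives.
\<close>

definition Ap_expansion ::
  "'g::topological_group_add measure \<Rightarrow> real \<Rightarrow> ('g \<Rightarrow> complex) \<Rightarrow>
   (nat \<Rightarrow> 'g \<Rightarrow> complex) \<Rightarrow> (nat \<Rightarrow> 'g \<Rightarrow> complex) \<Rightarrow> bool" where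
  "Ap_expansion \<mu> p f \<xi> \<phi> \<longleftrightarrow>
     (\<forall>n. \<xi> n \<in> carrier (Lp_functions (conj_exp p) \<mu>)) \<and>
     (\<forall>n. \<phi> n \<in> carrier (Lp_functions p \<mu>)) \<and>
     summable (\<lambda>n. nrm (Lp_functions (conj_exp p) \<mu>) (\<xi> n) * nrm (Lp_functions p \<mu>) (\<phi> n)) \<and>
     (\<forall>x. (\<lambda>n. \<integral>y. left_regular x (\<xi> n) y * \<phi> n y \<partial>\<mu>) sums f x)"

definition Ap :: "'g::topological_group_add measure \<Rightarrow> real \<Rightarrow> ('g \<Rightarrow> complex) set" where
  "Ap \<mu> p = {f. \<exists>\<xi> \<phi>. Ap_expansion \<mu> p f \<xi> \<phi>}"

definition Ap_norm ::
  "'g::topological_group_add measure \<Rightarrow> real \<Rightarrow> ('g \<Rightarrow> complex) \<Rightarrow> real" where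
  "Ap_norm \<mu> p f =
     Inf {(\<Sum>n. nrm (Lp_functions (conj_exp p) \<mu>) (\<xi> n) * nrm (Lp_functions p \<mu>) (\<phi> n)) |
            \<xi> \<phi>. Ap_expansion \<mu> p f \<xi> \<phi>}"

end

theory Submission
  imports Defs
begin

text \<open>
  Write \<open>q\<close> for the conjugate exponent of \<open>p\<close>. By bilinearity everything reduces to one coefficient
  \<open>x \<mapsto> \<integral> \<eta>(-x + y) \<psi>(y) dy\<close> of the left regular representation on \<open>L\<^sub>q(G)\<close> and one coefficient
  \<open>x \<mapsto> \<phi>(\<pi>(x) \<xi>)\<close> of a representation on a \<open>QSL\<^sub>q\<close>-space \<open>E\<close>; their product must have norm at
  most \<open>\<parallel>\<eta>\<parallel> \<parallel>\<psi>\<parallel> \<parallel>\<xi>\<parallel> \<parallel>\<phi>\<parallel>\<close>.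

  The reason is Fell's absorption principle: tensoring \<open>\<pi>\<close> with the left regular representation gives
  a representation that is equivalent to a multiple of the regular one. Concretely,
  \<open>\<phi>(\<pi>(x) \<xi>)\<close> equals \<open>\<phi> \<circ> \<pi>(y)\<close> applied to \<open>\<pi>(-(-x + y)) \<xi>\<close>, so the product is the vector-valued coefficient
  \<open>\<integral> \<langle>\<Xi>(-x + y), \<Phi>(y)\<rangle> dy\<close> with \<open>\<Xi>(z) = \<eta>(z) \<pi>(-z) \<xi>\<close> in \<open>L\<^sub>q(G, E)\<close> and
  \<open>\<Phi>(y) = \<psi>(y) (\<phi> \<circ> \<pi>(y))\<close> in \<open>L\<^sub>p(G, E\<^sup>*)\<close>, and the group acts on it by translation alone.

  It remains to bound such coefficients by the product of the two norms. If \<open>\<Xi>\<close> and \<open>\<Phi>\<close> are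
  scalar functions times functions with finitely many values, then only finitely many vectors and functionals of \<open>E\<close> are involved, and up to small errors these live
  in a finite-dimensional \<open>l\<^sub>q\<close> and its dual (\<open>finite_representability\<close>). There the coefficient is a
  finite sum of scalar coefficients, and Hoelder's inequality gives the bound
  (\<open>vector_coefficient_bounded\<close>). In general \<open>\<Xi>\<close> and \<open>\<Phi>\<close> are limits of such functions, and a
  telescoping series finishes the argument (\<open>product_coefficient_bounded\<close>).

  Both uses of the class of \<open>QSL\<^sub>q\<close>-spaces rest on the uniform smoothness of \<open>L\<^sub>q\<close>. A functional of
  norm one that nearly attains its norm at a unit vector is nearly the derivative of the norm there
  (\<open>nearly_represented\<close>). Hence functionals on a subspace of \<open>L\<^sub>q\<close> are nearly given by
  functions in \<open>L\<^sub>p\<close> of no larger norm, which replaces the Hahn--Banach theorem and the duality of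
  \<open>L\<^sub>q\<close> and \<open>L\<^sub>p\<close> and works for measures that are not sigma-finite. Hence also the
  dual orbit \<open>y \<mapsto> \<phi> \<circ> \<pi>(y)\<close> is norm continuous (\<open>dual_orbit_continuous\<close>), so that it can be
  approximated by finite-valued functions.

  The norm on \<open>B\<^sub>p(G)\<close> is an infimum over expansions into coefficients of cyclic representations. That such an
  expansion exists at all is \<open>cyclic_subrepresentation\<close>: the closed linear span of an orbit is
  a \<open>QSL\<^sub>q\<close>-space again, and integrating \<open>\<pi>(x) \<xi>\<close> against normalised indicators of small open sets
  shows that \<open>\<xi>\<close> is cyclic in it.
\<close>

section \<open>Functions with integrable powers\<close>

lemma conj_exp_gt_1: "1 < p \<Longrightarrow> 1 < conj_exp p"
  by (simp add: conj_exp_def field_simps)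

lemma conj_exp_sum': "1 < p \<Longrightarrow> 1 / conj_exp p + 1 / p = 1"
  using conj_exp_sum[of p] by simp

lemma conj_exp_involutive: "1 < p \<Longrightarrow> conj_exp (conj_exp p) = p"
  by (simp add: conj_exp_def field_simps)

abbreviation Lp :: "real \<Rightarrow> 'm measure \<Rightarrow> ('m \<Rightarrow> complex) set" where
  "Lp p M \<equiv> carrier (Lp_functions p M)"

abbreviation Lnorm :: "real \<Rightarrow> 'm measure \<Rightarrow> ('m \<Rightarrow> complex) \<Rightarrow> real" where
  "Lnorm p M \<equiv> nrm (Lp_functions p M)"

lemma Lp_iff:
  "f \<in> Lp p M \<longleftrightarrow> f \<in> borel_measurable M \<and> integrable M (\<lambda>x. cmod (f x) powr p)"
  by (simp add: Lp_functions_def)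

lemma Lnorm_def: "Lnorm p M f = (\<integral>x. cmod (f x) powr p \<partial>M) powr (1 / p)"
  by (simp add: Lp_functions_def)

lemma Lnorm_nonneg [simp]: "0 \<le> Lnorm p M f"
  by (simp add: Lnorm_def)

lemma Lnorm_powr: "0 < p \<Longrightarrow> Lnorm p M f powr p = (\<integral>x. cmod (f x) powr p \<partial>M)"
  by (simp add: Lnorm_def powr_powr integral_nonneg_AE)

lemma Lp_measurable: "f \<in> Lp p M \<Longrightarrow> f \<in> borel_measurable M"
  by (simp add: Lp_iff)

lemma Lp_integrable: "f \<in> Lp p M \<Longrightarrow> integrable M (\<lambda>x. cmod (f x) powr p)"
  by (simp add: Lp_iff)

lemma Lp_dominated:
  assumes "0 < p" "f \<in> Lp p M" "g \<in> borel_measurable M" "0 \<le> c"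
    and "\<And>x. cmod (g x) \<le> c * cmod (f x)"
  shows "g \<in> Lp p M"
proof -
  have "integrable M (\<lambda>x. cmod (g x) powr p)"
  proof (rule Bochner_Integration.integrable_bound)
    show "integrable M (\<lambda>x. c powr p * cmod (f x) powr p)"
      using assms by (simp add: Lp_iff)
    show "(\<lambda>x. cmod (g x) powr p) \<in> borel_measurable M"
      using assms(3) by measurable
    have "cmod (g x) powr p \<le> c powr p * cmod (f x) powr p" for x
    proof -
      have "cmod (g x) powr p \<le> (c * cmod (f x)) powr p"
        using assms by (intro powr_mono2) auto
      then show ?thesis using assms(4) by (simp add: powr_mult)
    qed
    then show "AE x in M. norm (cmod (g x) powr p) \<le> norm (c powr p * cmod (f x) powr p)"
      by simp
  qed
  then show ?thesis using assms by (simp add: Lp_iff)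
qed

lemma Lnorm_mono:
  assumes "0 < p" "f \<in> Lp p M" "g \<in> borel_measurable M"
    and "\<And>x. cmod (g x) \<le> cmod (f x)"
  shows "Lnorm p M g \<le> Lnorm p M f"
proof -
  have "g \<in> Lp p M"
    using Lp_dominated[OF assms(1-3), of 1] assms(4) by simp
  then have "(\<integral>x. cmod (g x) powr p \<partial>M) \<le> (\<integral>x. cmod (f x) powr p \<partial>M)"
    using assms by (intro integral_mono) (auto simp: Lp_iff powr_mono2)
  then show ?thesis unfolding Lnorm_def
    using assms(1) by (intro powr_mono2) (auto simp: integral_nonneg_AE)
qed

lemma Lp_scale:
  assumes "0 < p" "f \<in> Lp p M" shows "(\<lambda>x. c * f x) \<in> Lp p M"
  using assms by (intro Lp_dominated[OF assms, of _ "cmod c"]) (auto simp: Lp_iff norm_mult)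

lemma Lnorm_scale:
  assumes "0 < p" shows "Lnorm p M (\<lambda>x. c * f x) = cmod c * Lnorm p M f"
  using assms by (simp add: Lnorm_def norm_mult powr_mult powr_powr)

lemma Lp_zero: "0 < p \<Longrightarrow> (\<lambda>x. 0) \<in> Lp p M"
  by (simp add: Lp_iff)

lemma Lnorm_zero: "0 < p \<Longrightarrow> Lnorm p M (\<lambda>x. 0) = 0"
  by (simp add: Lnorm_def)

lemma powr_add_le:
  fixes a b :: real
  assumes "0 < p" "0 \<le> a" "0 \<le> b"
  shows "(a + b) powr p \<le> 2 powr p * (a powr p + b powr p)"
proof -
  have "(a + b) powr p \<le> (2 * max a b) powr p"
    using assms by (intro powr_mono2) auto
  also have "\<dots> = 2 powr p * max a b powr p" using assms by (simp add: powr_mult)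
  also have "\<dots> \<le> 2 powr p * (a powr p + b powr p)"
    by (intro mult_left_mono) (auto simp: max_def)
  finally show ?thesis .
qed

lemma Lp_add:
  assumes p: "0 < p" and f: "f \<in> Lp p M" and g: "g \<in> Lp p M"
  shows "(\<lambda>x. f x + g x) \<in> Lp p M"
proof -
  have m: "(\<lambda>x. f x + g x) \<in> borel_measurable M" using f g by (auto simp: Lp_iff)
  have "integrable M (\<lambda>x. cmod (f x + g x) powr p)"
  proof (rule Bochner_Integration.integrable_bound)
    show "integrable M (\<lambda>x. 2 powr p * (cmod (f x) powr p + cmod (g x) powr p))"
      using f g by (simp add: Lp_iff)
    show "(\<lambda>x. cmod (f x + g x) powr p) \<in> borel_measurable M" using m by measurable
    have "cmod (f x + g x) powr p \<le> 2 powr p * (cmod (f x) powr p + cmod (g x) powr p)" for x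
      using powr_add_le[OF p, of "cmod (f x)" "cmod (g x)"] p
        powr_mono2[of p "cmod (f x + g x)" "cmod (f x) + cmod (g x)"] norm_triangle_ineq[of "f x" "g x"]
      by simp
    then show "AE x in M. norm (cmod (f x + g x) powr p)
        \<le> norm (2 powr p * (cmod (f x) powr p + cmod (g x) powr p))" by simp
  qed
  with m show ?thesis by (simp add: Lp_iff)
qed

lemma Lp_diff:
  assumes p: "0 < p" and f: "f \<in> Lp p M" and g: "g \<in> Lp p M"
  shows "(\<lambda>x. f x - g x) \<in> Lp p M"
  using Lp_add[OF p f Lp_scale[OF p g, of "-1"]] by simp

lemma Lnorm_eq_0_iff:
  assumes "0 < p" "f \<in> Lp p M"
  shows "Lnorm p M f = 0 \<longleftrightarrow> (AE x in M. f x = 0)"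
proof -
  have "Lnorm p M f = 0 \<longleftrightarrow> (\<integral>x. cmod (f x) powr p \<partial>M) = 0"
    by (simp add: Lnorm_def)
  also have "\<dots> \<longleftrightarrow> (AE x in M. cmod (f x) powr p = 0)"
    using assms by (intro integral_nonneg_eq_0_iff_AE) (auto simp: Lp_iff)
  finally show ?thesis by simp
qed

lemma Lnorm_cong_AE:
  assumes "f \<in> borel_measurable M" "g \<in> borel_measurable M" "AE x in M. f x = g x"
  shows "Lnorm p M f = Lnorm p M g"
proof -
  have "(\<integral>x. cmod (f x) powr p \<partial>M) = (\<integral>x. cmod (g x) powr p \<partial>M)"
    using assms by (intro integral_cong_AE) auto
  then show ?thesis by (simp add: Lnorm_def)
qed

lemma Lp_mult_integrable:
  assumes pq: "1 < p" "1 < q" "1 / p + 1 / q = 1" and f: "f \<in> Lp p M" and g: "g \<in> Lp q M"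
  shows "integrable M (\<lambda>x. f x * g x)"
proof (rule Bochner_Integration.integrable_bound)
  show "integrable M (\<lambda>x. cmod (f x) powr p / p + cmod (g x) powr q / q)"
    using f g by (simp add: Lp_iff)
  show "(\<lambda>x. f x * g x) \<in> borel_measurable M" using f g by (auto simp: Lp_iff)
  show "AE x in M. norm (f x * g x) \<le> norm (cmod (f x) powr p / p + cmod (g x) powr q / q)"
    using Youngs_inequality[OF pq] pq by (auto simp: norm_mult)
qed

text \<open>Young's inequality, integrated after normalising both factors. If a norm vanishes there is nothing
  to normalise, but then the integrand is null.\<close>

lemma Hoelder_integral:
  assumes pq: "1 < p" "1 < q" "1 / p + 1 / q = 1" and f: "f \<in> Lp p M" and g: "g \<in> Lp q M"
  shows "(\<integral>x. cmod (f x * g x) \<partial>M) \<le> Lnorm p M f * Lnorm q M g"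
proof -
  let ?a = "Lnorm p M f" and ?b = "Lnorm q M g"
  show ?thesis
  proof (cases "?a = 0 \<or> ?b = 0")
    case True
    then have "AE x in M. f x * g x = 0"
      using Lnorm_eq_0_iff[OF _ f] Lnorm_eq_0_iff[OF _ g] pq by auto
    then have "(\<integral>x. cmod (f x * g x) \<partial>M) = 0" by (intro integral_eq_zero_AE) auto
    with True show ?thesis by auto
  next
    case False
    then have ab: "0 < ?a" "0 < ?b" using Lnorm_nonneg by (smt (verit))+
    have pw: "cmod (f x * g x) / (?a * ?b)
        \<le> (cmod (f x) powr p / ?a powr p) / p + (cmod (g x) powr q / ?b powr q) / q" for x
      using Youngs_inequality[OF pq, of "cmod (f x) / ?a" "cmod (g x) / ?b"] ab
      by (simp add: norm_mult powr_divide)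
    have "(\<integral>x. cmod (f x * g x) / (?a * ?b) \<partial>M)
        \<le> (\<integral>x. (cmod (f x) powr p / ?a powr p) / p + (cmod (g x) powr q / ?b powr q) / q \<partial>M)"
      using pw Lp_mult_integrable[OF pq f g] f g
      by (intro integral_mono) (auto simp: Lp_iff)
    also have "\<dots> = (\<integral>x. cmod (f x) powr p \<partial>M) / ?a powr p / p
        + (\<integral>x. cmod (g x) powr q \<partial>M) / ?b powr q / q"
      using f g by (simp add: Lp_iff)
    also have "\<dots> = 1" using ab pq by (simp add: Lnorm_powr[symmetric])
    finally show ?thesis using ab by (simp add: field_simps)
  qed
qed

lemma Hoelder_integral_norm:
  assumes pq: "1 < p" "1 < q" "1 / p + 1 / q = 1" and f: "f \<in> Lp p M" and g: "g \<in> Lp q M"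
  shows "cmod (\<integral>x. f x * g x \<partial>M) \<le> Lnorm p M f * Lnorm q M g"
  using Hoelder_integral[OF assms] integral_norm_bound[of M "\<lambda>x. f x * g x"] by linarith

text \<open>The case of counting measure.\<close>

lemma Hoelder_sum:
  fixes a b :: "'i \<Rightarrow> real"
  assumes pq: "1 < p" "1 < q" "1 / p + 1 / q = 1" and J: "finite J"
    and "\<And>j. j \<in> J \<Longrightarrow> 0 \<le> a j" "\<And>j. j \<in> J \<Longrightarrow> 0 \<le> b j"
  shows "(\<Sum>j\<in>J. a j * b j) \<le> (\<Sum>j\<in>J. a j powr p) powr (1 / p) * (\<Sum>j\<in>J. b j powr q) powr (1 / q)"
proof -
  have L: "(\<lambda>j. complex_of_real (c j)) \<in> Lp r (count_space J)" for c :: "'i \<Rightarrow> real" and r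
    using J by (simp add: Lp_iff integrable_count_space)
  have N: "Lnorm r (count_space J) (\<lambda>j. complex_of_real (c j)) = (\<Sum>j\<in>J. c j powr r) powr (1 / r)"
    if "\<And>j. j \<in> J \<Longrightarrow> 0 \<le> c j" for c :: "'i \<Rightarrow> real" and r
    using J that by (simp add: Lnorm_def lebesgue_integral_count_space_finite)
  have "(\<Sum>j\<in>J. a j * b j) = (\<integral>j. cmod (complex_of_real (a j) * complex_of_real (b j)) \<partial>count_space J)"
    using J assms by (simp add: lebesgue_integral_count_space_finite norm_mult)
  also have "\<dots> \<le> Lnorm p (count_space J) (\<lambda>j. complex_of_real (a j))
      * Lnorm q (count_space J) (\<lambda>j. complex_of_real (b j))"
    by (rule Hoelder_integral[OF pq L L])
  finally show ?thesis using N assms by simp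
qed

lemma powr_convex_nonneg:
  fixes a b t :: real
  assumes p: "1 \<le> p" and t: "0 \<le> t" "t \<le> 1" and ab: "0 \<le> a" "0 \<le> b"
  shows "((1 - t) * a + t * b) powr p \<le> (1 - t) * a powr p + t * b powr p"
proof -
  have le: "s powr p \<le> s" if "0 \<le> s" "s \<le> 1" for s :: real
    using powr_mono'[of 1 p s] that p by (cases "s = 0") auto
  consider "0 < a" "0 < b" | "a = 0" | "b = 0" using ab by linarith
  then show ?thesis
  proof cases
    case 1
    then show ?thesis using convex_onD[OF powr_convex[OF p] t, of a b] by simp
  next
    case 2
    then show ?thesis using le[of t] t ab by (simp add: powr_mult mult_right_mono)
  next
    case 3
    then show ?thesis using le[of "1 - t"] t ab by (simp add: powr_mult mult_right_mono)
  qed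
qed

text \<open>Minkowski's inequality, from convexity of the \<open>p\<close>-th power applied to the
  convex combination of the two normalised functions.\<close>

lemma Minkowski_integral:
  assumes p: "1 \<le> p" and f: "f \<in> Lp p M" and g: "g \<in> Lp p M"
  shows "Lnorm p M (\<lambda>x. f x + g x) \<le> Lnorm p M f + Lnorm p M g"
proof -
  let ?a = "Lnorm p M f" and ?b = "Lnorm p M g"
  have p0: "0 < p" using p by simp
  have m: "f \<in> borel_measurable M" "g \<in> borel_measurable M" using f g by (auto simp: Lp_iff)
  show ?thesis
  proof (cases "?a = 0 \<or> ?b = 0")
    case True
    then show ?thesis
    proof
      assume *: "?a = 0"
      then have "AE x in M. f x + g x = g x" using Lnorm_eq_0_iff[OF p0 f] by auto
      then have "Lnorm p M (\<lambda>x. f x + g x) = ?b" using m by (intro Lnorm_cong_AE) auto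
      with * show ?thesis by simp
    next
      assume *: "?b = 0"
      then have "AE x in M. f x + g x = f x" using Lnorm_eq_0_iff[OF p0 g] by auto
      then have "Lnorm p M (\<lambda>x. f x + g x) = ?a" using m by (intro Lnorm_cong_AE) auto
      with * show ?thesis by simp
    qed
  next
    case False
    then have ab: "0 < ?a" "0 < ?b" using Lnorm_nonneg by (smt (verit))+
    let ?s = "?a + ?b"
    have pw: "cmod (f x + g x) powr p
        \<le> ?s powr p * ((?a / ?s) * (cmod (f x) powr p / ?a powr p) + (?b / ?s) * (cmod (g x) powr p / ?b powr p))" for x
    proof -
      have eq: "1 - ?b / ?s = ?a / ?s" using ab by (simp add: field_simps)
      have "cmod (f x + g x) powr p \<le> (cmod (f x) + cmod (g x)) powr p"
        using p by (intro powr_mono2 norm_triangle_ineq) auto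
      also have "\<dots> = (?s * ((?a / ?s) * (cmod (f x) / ?a) + (?b / ?s) * (cmod (g x) / ?b))) powr p"
      proof -
        have "?s \<noteq> 0" using ab by linarith
        then show ?thesis using ab by (simp add: distrib_left)
      qed
      also have "\<dots> = ?s powr p * ((?a / ?s) * (cmod (f x) / ?a) + (?b / ?s) * (cmod (g x) / ?b)) powr p"
        by (rule powr_mult)
      also have "\<dots> \<le> ?s powr p * ((?a / ?s) * (cmod (f x) / ?a) powr p + (?b / ?s) * (cmod (g x) / ?b) powr p)"
        using ab powr_convex_nonneg[OF p, of "?b / ?s" "cmod (f x) / ?a" "cmod (g x) / ?b"]
        unfolding eq by (intro mult_left_mono) auto
      finally show ?thesis using ab by (simp add: powr_divide)
    qed
    have "(\<integral>x. cmod (f x + g x) powr p \<partial>M) \<le>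
       (\<integral>x. ?s powr p * ((?a / ?s) * (cmod (f x) powr p / ?a powr p) + (?b / ?s) * (cmod (g x) powr p / ?b powr p)) \<partial>M)"
      using pw f g Lp_add[OF p0 f g] by (intro integral_mono) (auto simp: Lp_iff)
    also have "\<dots> = ?s powr p * ((?a / ?s) * ((\<integral>x. cmod (f x) powr p \<partial>M) / ?a powr p)
        + (?b / ?s) * ((\<integral>x. cmod (g x) powr p \<partial>M) / ?b powr p))"
      using f g by (simp add: Lp_iff)
    also have "\<dots> = ?s powr p"
      using ab p0 by (simp add: Lnorm_powr[symmetric] add_divide_distrib[symmetric])
    finally have "Lnorm p M (\<lambda>x. f x + g x) powr p \<le> ?s powr p"
      using p0 by (simp add: Lnorm_powr)
    then show ?thesis using ab p0
      by (meson Lnorm_nonneg add_nonneg_nonneg not_le powr_less_mono2)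
  qed
qed

text \<open>The standard approximating sequence of simple functions is dominated by twice the function, so
  dominated convergence applies to the norms and, later, to the pairings.\<close>

lemma Lp_simple_approximation:
  assumes p: "0 < p" and f: "f \<in> Lp p M"
  obtains s where "\<And>i::nat. simple_function M (s i)" "\<And>i. s i \<in> Lp p M"
    "\<And>i x. x \<in> space M \<Longrightarrow> cmod (s i x) \<le> 2 * cmod (f x)"
    "\<And>x. x \<in> space M \<Longrightarrow> (\<lambda>i. s i x) \<longlonglongrightarrow> f x"
    "(\<lambda>i. Lnorm p M (s i)) \<longlonglongrightarrow> Lnorm p M f"
proof -
  have "f \<in> borel_measurable M" using f by (simp add: Lp_iff)
  from borel_measurable_implies_sequence_metric[OF this, of 0]
  obtain s where "\<forall>i::nat. simple_function M (s i)"
    "\<forall>x\<in>space M. (\<lambda>i. s i x) \<longlonglongrightarrow> f x"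
    "\<forall>i. \<forall>x\<in>space M. dist (s i x) 0 \<le> 2 * dist (f x) 0"
    by blast
  then have s: "\<And>i::nat. simple_function M (s i)"
    "\<And>x. x \<in> space M \<Longrightarrow> (\<lambda>i. s i x) \<longlonglongrightarrow> f x"
    "\<And>i x. x \<in> space M \<Longrightarrow> cmod (s i x) \<le> 2 * cmod (f x)"
    by (auto simp: dist_norm)
  have m: "s i \<in> borel_measurable M" for i
    using s(1) by (rule borel_measurable_simple_function)
  have dom: "cmod (s i x) powr p \<le> 2 powr p * cmod (f x) powr p" if "x \<in> space M" for i x
  proof -
    have "cmod (s i x) powr p \<le> (2 * cmod (f x)) powr p"
      using s(3)[OF that] p by (intro powr_mono2) auto
    then show ?thesis by (simp add: powr_mult)
  qed
  have L: "s i \<in> Lp p M" for i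
  proof -
    have "integrable M (\<lambda>x. cmod (s i x) powr p)"
    proof (rule Bochner_Integration.integrable_bound)
      show "integrable M (\<lambda>x. 2 powr p * cmod (f x) powr p)"
        using f by (simp add: Lp_iff)
      show "(\<lambda>x. cmod (s i x) powr p) \<in> borel_measurable M" using m[of i] by measurable
    qed (use dom in auto)
    with m show ?thesis by (simp add: Lp_iff)
  qed
  have "(\<lambda>i. \<integral>x. cmod (s i x) powr p \<partial>M) \<longlonglongrightarrow> (\<integral>x. cmod (f x) powr p \<partial>M)"
  proof (rule integral_dominated_convergence[where w = "\<lambda>x. 2 powr p * cmod (f x) powr p"])
    show "(\<lambda>x. cmod (s i x) powr p) \<in> borel_measurable M" for i using m[of i] by measurable
    show "(\<lambda>x. cmod (f x) powr p) \<in> borel_measurable M" using f by (auto simp: Lp_iff)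
    show "integrable M (\<lambda>x. 2 powr p * cmod (f x) powr p)" using f by (simp add: Lp_iff)
    show "AE x in M. (\<lambda>i. cmod (s i x) powr p) \<longlonglongrightarrow> cmod (f x) powr p"
      using s(2) p by (intro AE_I2 tendsto_powr' tendsto_norm tendsto_const) auto
    show "AE x in M. norm (cmod (s i x) powr p) \<le> 2 powr p * cmod (f x) powr p" for i
      using dom by auto
  qed
  then have "(\<lambda>i. Lnorm p M (s i)) \<longlonglongrightarrow> Lnorm p M f"
    unfolding Lnorm_def using p
    by (intro tendsto_powr' tendsto_const) (auto simp: integral_nonneg_AE)
  with s L show ?thesis by (intro that[of s]) auto
qed

section \<open>Translations and coefficients\<close>

lemma haar_sets: "left_haar_measure \<mu> \<Longrightarrow> sets \<mu> = sets borel"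
  by (simp add: left_haar_measure_def)

lemma haar_space: "left_haar_measure \<mu> \<Longrightarrow> space \<mu> = UNIV"
  using sets_eq_imp_space_eq[of \<mu> borel] by (simp add: haar_sets)

lemma continuous_translation:
  "continuous_on UNIV (\<lambda>y::'g::topological_group_add. a + y)"
  by (intro continuous_intros)

lemma haar_translation_measurable:
  assumes "left_haar_measure (\<mu> :: 'g::topological_group_add measure)"
  shows "(\<lambda>y. a + y) \<in> \<mu> \<rightarrow>\<^sub>M \<mu>"
proof -
  have "(\<lambda>y::'g. a + y) \<in> borel \<rightarrow>\<^sub>M borel"
    by (intro borel_measurable_continuous_onI continuous_translation)
  then show ?thesis using haar_sets[OF assms] measurable_cong_sets by blast
qed

lemma haar_distr_translation:
  assumes h: "left_haar_measure (\<mu> :: 'g::topological_group_add measure)"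
  shows "distr \<mu> \<mu> (\<lambda>y. a + y) = \<mu>"
proof (rule measure_eqI)
  fix A assume "A \<in> sets (distr \<mu> \<mu> (\<lambda>y. a + y))"
  then have A: "A \<in> sets borel" using haar_sets[OF h] by simp
  have eq: "(\<lambda>y. a + y) -` A = (\<lambda>y. - a + y) ` A"
  proof (intro Set.set_eqI iffI)
    fix y assume "y \<in> (\<lambda>y. a + y) -` A"
    then show "y \<in> (\<lambda>y. - a + y) ` A" by (intro image_eqI[of _ _ "a + y"]) auto
  qed auto
  have "emeasure (distr \<mu> \<mu> (\<lambda>y. a + y)) A = emeasure \<mu> ((\<lambda>y. a + y) -` A)"
    using A haar_sets[OF h] haar_space[OF h]
    by (subst emeasure_distr[OF haar_translation_measurable[OF h]]) auto
  also have "\<dots> = emeasure \<mu> A" using h A unfolding left_haar_measure_def eq by blast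
  finally show "emeasure (distr \<mu> \<mu> (\<lambda>y. a + y)) A = emeasure \<mu> A" .
qed simp

lemma haar_integral_translation:
  fixes f :: "'g::topological_group_add \<Rightarrow> 'b::{banach, second_countable_topology}"
  assumes h: "left_haar_measure \<mu>" and "f \<in> borel_measurable \<mu>"
  shows "(\<integral>y. f (a + y) \<partial>\<mu>) = (\<integral>y. f y \<partial>\<mu>)"
  using integral_distr[OF haar_translation_measurable[OF h] assms(2), of a]
  by (simp add: haar_distr_translation[OF h])

lemma haar_integrable_translation:
  fixes f :: "'g::topological_group_add \<Rightarrow> 'b::{banach, second_countable_topology}"
  assumes h: "left_haar_measure \<mu>" and "integrable \<mu> f"
  shows "integrable \<mu> (\<lambda>y. f (a + y))"
  using integrable_distr_eq[OF haar_translation_measurable[OF h], of f a] assms(2)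
  by (simp add: haar_distr_translation[OF h])

lemma haar_AE_translation:
  assumes h: "left_haar_measure (\<mu> :: 'g::topological_group_add measure)" and "AE y in \<mu>. P y"
  shows "AE y in \<mu>. P (a + y)"
proof -
  have "AE y in distr \<mu> \<mu> (\<lambda>y. a + y). P y"
    unfolding haar_distr_translation[OF h] by (rule assms(2))
  from AE_distrD[OF haar_translation_measurable[OF h] this] show ?thesis .
qed

lemma left_regular_Lp:
  assumes h: "left_haar_measure \<mu>" and f: "f \<in> Lp p \<mu>"
  shows "left_regular x f \<in> Lp p \<mu>" "Lnorm p \<mu> (left_regular x f) = Lnorm p \<mu> f"
proof -
  have m: "left_regular x f \<in> borel_measurable \<mu>"
    unfolding left_regular_def
    using measurable_compose[OF haar_translation_measurable[OF h]] f by (auto simp: Lp_iff)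
  then show "left_regular x f \<in> Lp p \<mu>"
    using haar_integrable_translation[OF h Lp_integrable[OF f], of "- x"]
    by (auto simp: Lp_iff left_regular_def)
  have "(\<lambda>y. cmod (f y) powr p) \<in> borel_measurable \<mu>" using f by (auto simp: Lp_iff)
  from haar_integral_translation[OF h this, of "- x"]
  show "Lnorm p \<mu> (left_regular x f) = Lnorm p \<mu> f"
    by (simp add: Lnorm_def left_regular_def)
qed

definition coefficient ::
  "'g::topological_group_add measure \<Rightarrow> ('g \<Rightarrow> complex) \<Rightarrow> ('g \<Rightarrow> complex) \<Rightarrow> 'g \<Rightarrow> complex" where
  "coefficient \<mu> \<eta> \<psi> x = (\<integral>y. left_regular x \<eta> y * \<psi> y \<partial>\<mu>)"

lemma coefficient_integrable:
  assumes h: "left_haar_measure \<mu>" and p: "1 < p"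
    and "\<eta> \<in> Lp (conj_exp p) \<mu>" "\<psi> \<in> Lp p \<mu>"
  shows "integrable \<mu> (\<lambda>y. left_regular x \<eta> y * \<psi> y)"
  by (rule Lp_mult_integrable[OF conj_exp_gt_1[OF p] p conj_exp_sum'[OF p]
        left_regular_Lp(1)[OF h assms(3)] assms(4)])

lemma coefficient_bound:
  assumes h: "left_haar_measure \<mu>" and p: "1 < p"
    and "\<eta> \<in> Lp (conj_exp p) \<mu>" "\<psi> \<in> Lp p \<mu>"
  shows "cmod (coefficient \<mu> \<eta> \<psi> x) \<le> Lnorm (conj_exp p) \<mu> \<eta> * Lnorm p \<mu> \<psi>"
  unfolding coefficient_def
  using Hoelder_integral_norm[OF conj_exp_gt_1[OF p] p conj_exp_sum'[OF p]
        left_regular_Lp(1)[OF h assms(3)] assms(4), of x]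
  by (simp add: left_regular_Lp(2)[OF h assms(3)])

section \<open>Series in the Figa-Talamanca--Herz algebra\<close>

text \<open>A double series dominated by \<open>N\<close> converges absolutely, so it may be summed along the
  enumeration of pairs.\<close>

lemma sums_prod_decode:
  fixes a :: "nat \<Rightarrow> nat \<Rightarrow> 'b::banach"
  assumes N: "\<And>n. summable (N n)" "\<And>n. suminf (N n) \<le> d n" and d: "summable d"
    and le: "\<And>n m. norm (a n m) \<le> N n m"
  shows "(\<lambda>k. case prod_decode k of (n, m) \<Rightarrow> a n m) sums (\<Sum>n. \<Sum>m. a n m)"
proof -
  have N0: "0 \<le> N n m" for n m using le[of n m] norm_ge_zero order_trans by blast
  have sN: "N n summable_on UNIV" for n
    using N(1) N0 by (rule summable_nonneg_imp_summable_on)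
  have iN: "infsum (N n) UNIV = suminf (N n)" for n
    by (rule infsumI[OF sums_nonneg_imp_has_sum[OF summable_sums[OF N(1)] N0]])
  have S0: "0 \<le> suminf (N n)" for n by (rule suminf_nonneg[OF N(1) N0])
  have "summable (\<lambda>n. suminf (N n))"
    by (rule summable_comparison_test'[OF d, of 0]) (use N(2) S0 in auto)
  then have "(\<lambda>n. infsum (N n) UNIV) summable_on UNIV"
    unfolding iN using S0 by (rule summable_nonneg_imp_summable_on)
  then have "(\<lambda>x. norm ((\<lambda>(n, m). N n m) x)) summable_on (UNIV \<times> UNIV)"
    by (intro iffD2[OF Infinite_Sum.abs_summable_on_Sigma_iff]) (use sN N0 S0 in \<open>simp add: iN\<close>)
  then have "(\<lambda>x. norm ((\<lambda>(n, m). a n m) x)) summable_on (UNIV \<times> UNIV)"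
  proof (rule Infinite_Sum.abs_summable_on_comparison_test)
    fix x :: "nat \<times> nat"
    show "norm ((\<lambda>(n, m). a n m) x) \<le> norm ((\<lambda>(n, m). N n m) x)"
      using le N0 by (cases x) simp
  qed
  then have s: "(\<lambda>(n, m). a n m) summable_on (UNIV \<times> UNIV)"
    using Infinite_Sum.abs_summable_summable[where f = "\<lambda>(n, m). a n m"] by blast
  have sa: "summable (\<lambda>m. norm (a n m))" for n
    by (rule summable_comparison_test'[OF N(1)[of n], of 0]) (use le in auto)
  have ia: "infsum (a n) UNIV = suminf (a n)" for n
    by (rule infsumI[OF norm_summable_imp_has_sum[OF sa summable_sums[OF summable_norm_cancel[OF sa]]]])
  have nd: "norm (suminf (a n)) \<le> d n" for n
  proof -
    have "norm (suminf (a n)) \<le> (\<Sum>m. norm (a n m))" by (rule summable_norm[OF sa])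
    also have "\<dots> \<le> suminf (N n)" by (rule suminf_le[OF le sa N(1)])
    finally show ?thesis using N(2) order_trans by blast
  qed
  have sd: "summable (\<lambda>n. norm (suminf (a n)))"
    by (rule summable_comparison_test'[OF d, of 0]) (use nd in auto)
  have "infsum (\<lambda>n. suminf (a n)) UNIV = (\<Sum>n. suminf (a n))"
    by (rule infsumI[OF norm_summable_imp_has_sum[OF sd summable_sums[OF summable_norm_cancel[OF sd]]]])
  then have "((\<lambda>(n, m). a n m) has_sum (\<Sum>n. suminf (a n))) (UNIV \<times> UNIV)"
    using infsum_Sigma'_banach[OF s] s by (simp add: ia has_sum_iff)
  then have "((\<lambda>k. case prod_decode k of (n, m) \<Rightarrow> a n m) has_sum (\<Sum>n. suminf (a n))) UNIV"
    using has_sum_reindex_bij_betw[OF bij_prod_decode, of "\<lambda>(n, m). a n m"] by simp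
  then show ?thesis by (rule has_sum_imp_sums)
qed

text \<open>Membership and a norm bound in one predicate. An infimum need not be attained, hence the
  quantification over the larger bounds \<open>c'\<close>.\<close>

definition Ap_bounded ::
  "'g::topological_group_add measure \<Rightarrow> real \<Rightarrow> ('g \<Rightarrow> complex) \<Rightarrow> real \<Rightarrow> bool" where
  "Ap_bounded \<mu> p f c \<longleftrightarrow> (\<forall>c'>c. \<exists>\<xi> \<phi>. Ap_expansion \<mu> p f \<xi> \<phi> \<and>
     (\<Sum>n. Lnorm (conj_exp p) \<mu> (\<xi> n) * Lnorm p \<mu> (\<phi> n)) \<le> c')"

lemma Ap_expansion_sum_nonneg:
  "Ap_expansion \<mu> p f \<xi> \<phi> \<Longrightarrow> 0 \<le> (\<Sum>n. Lnorm (conj_exp p) \<mu> (\<xi> n) * Lnorm p \<mu> (\<phi> n))"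
  unfolding Ap_expansion_def by (intro suminf_nonneg) auto

lemma Ap_bounded_mono: "Ap_bounded \<mu> p f c \<Longrightarrow> c \<le> d \<Longrightarrow> Ap_bounded \<mu> p f d"
  unfolding Ap_bounded_def by auto

lemma Ap_bounded_limit:
  assumes "\<And>c'. c < c' \<Longrightarrow> Ap_bounded \<mu> p f c'"
  shows "Ap_bounded \<mu> p f c"
  unfolding Ap_bounded_def
proof (intro allI impI)
  fix d assume "c < d"
  then obtain c' where "c < c'" "c' < d" using dense by blast
  then show "\<exists>\<xi> \<phi>. Ap_expansion \<mu> p f \<xi> \<phi> \<and>
      (\<Sum>n. Lnorm (conj_exp p) \<mu> (\<xi> n) * Lnorm p \<mu> (\<phi> n)) \<le> d"
    using assms[of c'] by (simp add: Ap_bounded_def)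
qed

lemma Ap_bounded_norm_le:
  assumes "Ap_bounded \<mu> p f c"
  shows "f \<in> Ap \<mu> p \<and> Ap_norm \<mu> p f \<le> c"
proof
  have "c < c + 1" by simp
  then obtain \<xi> \<phi> where "Ap_expansion \<mu> p f \<xi> \<phi>"
    using assms unfolding Ap_bounded_def by blast
  then show "f \<in> Ap \<mu> p" unfolding Ap_def by blast
  show "Ap_norm \<mu> p f \<le> c"
  proof (rule dense_ge)
    fix c' assume "c < c'"
    then obtain \<xi> \<phi> where e: "Ap_expansion \<mu> p f \<xi> \<phi>"
      "(\<Sum>n. Lnorm (conj_exp p) \<mu> (\<xi> n) * Lnorm p \<mu> (\<phi> n)) \<le> c'"
      using assms unfolding Ap_bounded_def by blast
    have "Ap_norm \<mu> p f \<le> (\<Sum>n. Lnorm (conj_exp p) \<mu> (\<xi> n) * Lnorm p \<mu> (\<phi> n))"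
      unfolding Ap_norm_def
    proof (rule cInf_lower)
      show "bdd_below {\<Sum>n. Lnorm (conj_exp p) \<mu> (\<xi> n) * Lnorm p \<mu> (\<phi> n) |\<xi> \<phi>.
          Ap_expansion \<mu> p f \<xi> \<phi>}"
        by (rule bdd_belowI[of _ 0]) (use Ap_expansion_sum_nonneg in blast)
    qed (use e in blast)
    with e show "Ap_norm \<mu> p f \<le> c'" by linarith
  qed
qed

lemma Ap_bounded_coefficient:
  assumes p: "1 < p" and L: "\<eta> \<in> Lp (conj_exp p) \<mu>" "\<psi> \<in> Lp p \<mu>"
  shows "Ap_bounded \<mu> p (coefficient \<mu> \<eta> \<psi>) (Lnorm (conj_exp p) \<mu> \<eta> * Lnorm p \<mu> \<psi>)"
  unfolding Ap_bounded_def
proof (intro allI impI exI conjI)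
  let ?q = "conj_exp p"
  have q: "1 < ?q" by (rule conj_exp_gt_1[OF p])
  let ?\<xi> = "\<lambda>n::nat. if n = 0 then \<eta> else (\<lambda>x. 0)" and ?\<phi> = "\<lambda>n::nat. if n = 0 then \<psi> else (\<lambda>x. 0)"
  have s: "(\<lambda>n. Lnorm ?q \<mu> (?\<xi> n) * Lnorm p \<mu> (?\<phi> n)) sums (Lnorm ?q \<mu> \<eta> * Lnorm p \<mu> \<psi>)"
    using sums_finite[of "{0}" "\<lambda>n. Lnorm ?q \<mu> (?\<xi> n) * Lnorm p \<mu> (?\<phi> n)"] p
    by (simp add: Lnorm_zero)
  have "(\<lambda>n. \<integral>y. left_regular x (?\<xi> n) y * ?\<phi> n y \<partial>\<mu>) sums coefficient \<mu> \<eta> \<psi> x" for x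
    using sums_finite[of "{0}" "\<lambda>n. \<integral>y. left_regular x (?\<xi> n) y * ?\<phi> n y \<partial>\<mu>"]
    by (simp add: coefficient_def)
  then show "Ap_expansion \<mu> p (coefficient \<mu> \<eta> \<psi>) ?\<xi> ?\<phi>"
    using L s p q by (auto simp: Ap_expansion_def Lp_zero sums_iff)
  fix c assume "Lnorm ?q \<mu> \<eta> * Lnorm p \<mu> \<psi> < c"
  then show "(\<Sum>n. Lnorm ?q \<mu> (?\<xi> n) * Lnorm p \<mu> (?\<phi> n)) \<le> c"
    using s by (simp add: sums_iff)
qed

text \<open>Norm-convergent series converge in the algebra: choose for the \<open>n\<close>-th term an expansion
  whose norm sum exceeds the bound by at most \<open>\<epsilon> 2\<^sup>-\<^sup>n\<close>, and enumerate the double series.\<close>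

lemma Ap_bounded_suminf:
  assumes h: "left_haar_measure \<mu>" and p: "1 < p"
    and b: "\<And>n::nat. Ap_bounded \<mu> p (f n) (c n)" and c: "summable c"
    and f: "\<And>x. (\<lambda>n. f n x) sums F x"
  shows "Ap_bounded \<mu> p F (suminf c)"
  unfolding Ap_bounded_def
proof (intro allI impI)
  fix c' assume c': "suminf c < c'"
  let ?q = "conj_exp p"
  define e where "e = c' - suminf c"
  have e: "0 < e" using c' by (simp add: e_def)
  define S where "S \<xi> \<phi> = (\<Sum>n. Lnorm ?q \<mu> (\<xi> n) * Lnorm p \<mu> (\<phi> n))" for \<xi> \<phi>
  have "\<exists>\<xi> \<phi>. Ap_expansion \<mu> p (f n) \<xi> \<phi> \<and> S \<xi> \<phi> \<le> c n + e * (1/2) ^ Suc n" for n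
    using b[of n] e unfolding Ap_bounded_def S_def by simp
  then obtain U W where XY: "\<And>n. Ap_expansion \<mu> p (f n) (U n) (W n)"
    "\<And>n. S (U n) (W n) \<le> c n + e * (1/2) ^ Suc n"
    by metis
  define N where "N n m = Lnorm ?q \<mu> (U n m) * Lnorm p \<mu> (W n m)" for n m
  define d where "d n = c n + e * (1/2) ^ Suc n" for n
  have geo: "(\<lambda>n. e * (1/2) ^ Suc n) sums e"
    using sums_mult[OF power_half_series, of e] by simp
  have d: "d sums c'"
    unfolding d_def using sums_add[OF summable_sums[OF c] geo] by (simp add: e_def)
  have L: "U n m \<in> Lp ?q \<mu>" "W n m \<in> Lp p \<mu>" for n m
    using XY(1)[of n] by (auto simp: Ap_expansion_def)
  have N: "summable (N n)" "suminf (N n) \<le> d n" for n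
    using XY[of n] by (auto simp: Ap_expansion_def N_def[abs_def] d_def S_def)
  have N0: "0 \<le> N n m" for n m by (simp add: N_def)
  have s1: "(\<lambda>k. case prod_decode k of (n, m) \<Rightarrow> N n m) sums (\<Sum>n. \<Sum>m. N n m)"
    by (rule sums_prod_decode[OF N sums_summable[OF d]]) (simp add: N0)
  have "(\<Sum>n. \<Sum>m. N n m) \<le> suminf d"
  proof (rule suminf_le)
    show "summable (\<lambda>n. suminf (N n))"
      by (rule summable_comparison_test'[OF sums_summable[OF d], of 0])
         (use N suminf_nonneg[OF N(1) N0] in auto)
  qed (use N d in \<open>auto simp: sums_iff\<close>)
  then have le: "(\<Sum>n. \<Sum>m. N n m) \<le> c'" using d by (simp add: sums_iff)
  have s2: "(\<lambda>k. case prod_decode k of (n, m) \<Rightarrow> coefficient \<mu> (U n m) (W n m) x) sums F x" for x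
  proof -
    have "(\<lambda>k. case prod_decode k of (n, m) \<Rightarrow> coefficient \<mu> (U n m) (W n m) x)
       sums (\<Sum>n. \<Sum>m. coefficient \<mu> (U n m) (W n m) x)"
      by (rule sums_prod_decode[OF N sums_summable[OF d]])
         (simp add: N_def coefficient_bound[OF h p L])
    moreover have "(\<Sum>m. coefficient \<mu> (U n m) (W n m) x) = f n x" for n
      using XY(1)[of n] by (auto simp: Ap_expansion_def coefficient_def sums_iff)
    ultimately show ?thesis using f[of x] by (simp add: sums_iff)
  qed
  let ?U = "\<lambda>k. case prod_decode k of (n, m) \<Rightarrow> U n m" and ?W = "\<lambda>k. case prod_decode k of (n, m) \<Rightarrow> W n m"
  have eq: "Lnorm ?q \<mu> (?U k) * Lnorm p \<mu> (?W k) = (case prod_decode k of (n, m) \<Rightarrow> N n m)" for k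
    by (simp add: N_def split: prod.split)
  have eq2: "(\<integral>y. left_regular x (?U k) y * ?W k y \<partial>\<mu>)
     = (case prod_decode k of (n, m) \<Rightarrow> coefficient \<mu> (U n m) (W n m) x)" for k x
    by (simp add: coefficient_def split: prod.split)
  have "Ap_expansion \<mu> p F ?U ?W"
    unfolding Ap_expansion_def eq eq2
    using L s1 s2 by (auto simp: sums_iff split: prod.split)
  moreover have "S ?U ?W \<le> c'"
    unfolding S_def eq using s1 le by (simp add: sums_iff)
  ultimately show "\<exists>\<xi> \<phi>. Ap_expansion \<mu> p F \<xi> \<phi> \<and>
      (\<Sum>n. Lnorm ?q \<mu> (\<xi> n) * Lnorm p \<mu> (\<phi> n)) \<le> c'"
    unfolding S_def by blast
qed

lemma Ap_bounded_zero:
  assumes p: "1 < p" shows "Ap_bounded \<mu> p (\<lambda>x. 0) 0"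
  using Ap_bounded_coefficient[OF p Lp_zero Lp_zero, of \<mu>] p conj_exp_gt_1[OF p]
  by (simp add: Lnorm_zero coefficient_def[abs_def] left_regular_def)

lemma Ap_bounded_add:
  assumes h: "left_haar_measure \<mu>" and p: "1 < p"
    and "Ap_bounded \<mu> p f c" "Ap_bounded \<mu> p g d"
  shows "Ap_bounded \<mu> p (\<lambda>x. f x + g x) (c + d)"
proof -
  let ?f = "\<lambda>n::nat. if n = 0 then f else if n = 1 then g else (\<lambda>x. 0)"
  let ?c = "\<lambda>n::nat. if n = 0 then c else if n = 1 then d else 0"
  have c: "?c sums (c + d)" using sums_finite[of "{0, 1}" ?c] by simp
  have "(\<lambda>n. ?f n x) sums (f x + g x)" for x
    using sums_finite[of "{0, 1}" "\<lambda>n. ?f n x"] by simp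
  moreover have "Ap_bounded \<mu> p (?f n) (?c n)" for n
    using assms(3,4) Ap_bounded_zero[OF p, of \<mu>] by simp
  ultimately have "Ap_bounded \<mu> p (\<lambda>x. f x + g x) (suminf ?c)"
    using c by (intro Ap_bounded_suminf[OF h p, where f = ?f]) (auto simp: sums_iff)
  then show ?thesis using c by (simp add: sums_iff)
qed

lemma Ap_bounded_sum:
  assumes h: "left_haar_measure \<mu>" and p: "1 < p" and "finite I"
    and "\<And>i. i \<in> I \<Longrightarrow> Ap_bounded \<mu> p (f i) (c i)"
  shows "Ap_bounded \<mu> p (\<lambda>x. \<Sum>i\<in>I. f i x) (\<Sum>i\<in>I. c i)"
  using assms(3,4)
  by (induction I rule: finite_induct) (auto simp: Ap_bounded_zero[OF p] Ap_bounded_add[OF h p])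

section \<open>Normed spaces, subspaces and quotients\<close>

abbreviation scalars :: "complex ring" where
  "scalars \<equiv> ring_of_type_algebra"

lemma scalars_simps [simp]:
  "carrier scalars = UNIV" "add scalars = (+)" "monoid.mult scalars = (*)"
  "one scalars = 1" "ring.zero scalars = 0"
  by (simp_all add: ring_of_type_algebra_def)

context complex_normed_space
begin

lemma abelian_group_E: "abelian_group E" by (rule M.abelian_group_axioms)

lemma smult_in [simp, intro]: "x \<in> carrier E \<Longrightarrow> c \<odot> x \<in> carrier E"
  using smult_closed by simp

lemma smult_add_left: "x \<in> carrier E \<Longrightarrow> (a + b) \<odot> x = a \<odot> x \<oplus> b \<odot> x"
  using smult_l_distr[of a b x] by simp

lemma smult_add_right: "x \<in> carrier E \<Longrightarrow> y \<in> carrier E \<Longrightarrow> c \<odot> (x \<oplus> y) = c \<odot> x \<oplus> c \<odot> y"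
  using smult_r_distr[of c x y] by simp

lemma smult_mult: "x \<in> carrier E \<Longrightarrow> (a * b) \<odot> x = a \<odot> (b \<odot> x)"
  using smult_assoc1[of a b x] by simp

lemma smult_1 [simp]: "x \<in> carrier E \<Longrightarrow> 1 \<odot> x = x"
  using smult_one[of x] by simp

lemma smult_0 [simp]: "x \<in> carrier E \<Longrightarrow> 0 \<odot> x = \<zero>"
  using smult_l_null[of x] by simp

lemma smult_zero_right [simp]: "c \<odot> \<zero> = \<zero>"
  using smult_r_null[of c] by simp

lemma smult_minus_1: assumes "x \<in> carrier E" shows "(-1) \<odot> x = \<ominus> x"
proof -
  have "(-1) \<odot> x \<oplus> x = ((-1) + 1) \<odot> x"
    using assms by (simp only: smult_add_left smult_1)
  then have "(-1) \<odot> x \<oplus> x = \<zero>" using assms by simp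
  then show ?thesis using assms by (metis M.minus_equality smult_in)
qed

lemma nrm_zero [simp]: "nrm E \<zero> = 0"
  using nrm_eq_zero_iff[of \<zero>] by simp

lemma nrm_minus: "x \<in> carrier E \<Longrightarrow> nrm E (\<ominus> x) = nrm E x"
  using nrm_smult[of x "-1"] by (simp add: smult_minus_1)

lemma diff_in [simp, intro]: "x \<in> carrier E \<Longrightarrow> y \<in> carrier E \<Longrightarrow> x \<ominus> y \<in> carrier E"
  by (simp add: a_minus_def)

lemma diff_self [simp]: "x \<in> carrier E \<Longrightarrow> x \<ominus> x = \<zero>"
  by (simp add: a_minus_def M.r_neg)

lemma diff_swap: "x \<in> carrier E \<Longrightarrow> y \<in> carrier E \<Longrightarrow> \<ominus> (x \<ominus> y) = y \<ominus> x"
  by (simp add: a_minus_def M.minus_add M.a_comm)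

lemma nrm_diff_commute:
  "x \<in> carrier E \<Longrightarrow> y \<in> carrier E \<Longrightarrow> nrm E (x \<ominus> y) = nrm E (y \<ominus> x)"
  by (metis diff_in diff_swap nrm_minus)

lemma diff_add_diff:
  "x \<in> carrier E \<Longrightarrow> y \<in> carrier E \<Longrightarrow> z \<in> carrier E \<Longrightarrow> (x \<ominus> y) \<oplus> (y \<ominus> z) = x \<ominus> z"
  by (simp add: a_minus_def M.a_assoc M.r_neg1)

lemma nrm_diff_triangle:
  assumes "x \<in> carrier E" "y \<in> carrier E" "z \<in> carrier E"
  shows "nrm E (x \<ominus> z) \<le> nrm E (x \<ominus> y) + nrm E (y \<ominus> z)"
  using nrm_triangle[of "x \<ominus> y" "y \<ominus> z"] assms by (simp add: diff_add_diff)

lemma diff_add_cancel: "x \<in> carrier E \<Longrightarrow> y \<in> carrier E \<Longrightarrow> (x \<ominus> y) \<oplus> y = x"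
  by (simp add: a_minus_def M.a_assoc M.l_neg)

lemma diff_eq_zero: "x \<in> carrier E \<Longrightarrow> y \<in> carrier E \<Longrightarrow> x \<ominus> y = \<zero> \<longleftrightarrow> x = y"
  by (metis M.l_zero diff_add_cancel diff_self)

lemma diff_zero: "x \<in> carrier E \<Longrightarrow> x \<ominus> \<zero> = x"
  by (simp add: a_minus_def)

lemma add_diff_add:
  assumes "x \<in> carrier E" "y \<in> carrier E" "u \<in> carrier E" "v \<in> carrier E"
  shows "(x \<oplus> y) \<ominus> (u \<oplus> v) = (x \<ominus> u) \<oplus> (y \<ominus> v)"
  using assms by (simp add: a_minus_def M.minus_add M.a_ac)

lemma smult_diff:
  assumes "x \<in> carrier E" "y \<in> carrier E"
  shows "c \<odot> (x \<ominus> y) = c \<odot> x \<ominus> c \<odot> y"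
  using assms by (simp add: a_minus_def smult_add_right smult_minus_1[symmetric] smult_mult[symmetric])

sublocale N: Metric_space "carrier E" "ndist E"
proof
  show "0 \<le> ndist E x y" for x y by (simp add: ndist_def nrm_nonneg)
  show "ndist E x y = ndist E y x" for x y by (auto simp: ndist_def nrm_diff_commute)
  show "ndist E x y = 0 \<longleftrightarrow> x = y" if "x \<in> carrier E" "y \<in> carrier E" for x y
    using that by (simp add: ndist_def nrm_eq_zero_iff diff_eq_zero)
  show "ndist E x z \<le> ndist E x y + ndist E y z"
    if "x \<in> carrier E" "y \<in> carrier E" "z \<in> carrier E" for x y z
    using that by (simp add: ndist_def nrm_diff_triangle)
qed

lemma openin_ntopology:
  "openin (ntopology E) U \<longleftrightarrow> U \<subseteq> carrier E \<and>
     (\<forall>x\<in>U. \<exists>r>0. \<forall>y\<in>carrier E. nrm E (x \<ominus> y) < r \<longrightarrow> y \<in> U)"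
proof -
  have "N.mball x r \<subseteq> U \<longleftrightarrow> (\<forall>y\<in>carrier E. nrm E (x \<ominus> y) < r \<longrightarrow> y \<in> U)"
    if "x \<in> carrier E" for x r
    using that by (auto simp: N.mball_def ndist_def)
  then show ?thesis unfolding ntopology_def N.openin_mtopology by blast
qed

lemma topspace_ntopology [simp]: "topspace (ntopology E) = carrier E"
  by (simp add: ntopology_def)

lemma closedin_ntopology:
  "closedin (ntopology E) C \<longleftrightarrow> C \<subseteq> carrier E \<and>
     (\<forall>x\<in>carrier E - C. \<exists>r>0. \<forall>y\<in>carrier E. nrm E (x \<ominus> y) < r \<longrightarrow> y \<notin> C)"
  unfolding closedin_def openin_ntopology topspace_ntopology
  by (intro conj_cong refl) (auto simp: Ball_def)

lemma submodule_mem: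
  assumes "submodule S scalars E"
  shows "S \<subseteq> carrier E" "\<zero> \<in> S" "\<And>x y. x \<in> S \<Longrightarrow> y \<in> S \<Longrightarrow> x \<oplus> y \<in> S"
    "\<And>c x. x \<in> S \<Longrightarrow> c \<odot> x \<in> S" "\<And>x. x \<in> S \<Longrightarrow> \<ominus> x \<in> S"
    "\<And>x y. x \<in> S \<Longrightarrow> y \<in> S \<Longrightarrow> x \<ominus> y \<in> S"
proof -
  note * = submoduleE[OF assms]
  show "S \<subseteq> carrier E" by (rule *(1))
  show z: "\<zero> \<in> S" using subgroup.one_closed[OF submodule.axioms(1)[OF assms]] by simp
  show "x \<oplus> y \<in> S" if "x \<in> S" "y \<in> S" for x y using *(5) that by blast
  show "c \<odot> x \<in> S" if "x \<in> S" for c x using *(4) that by simp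
  show "\<ominus> x \<in> S" if "x \<in> S" for x using *(3) that by simp
  show "x \<ominus> y \<in> S" if "x \<in> S" "y \<in> S" for x y using *(3,5) that by (simp add: a_minus_def)
qed

lemma submodule_by_closure:
  assumes "S \<subseteq> carrier E" "\<zero> \<in> S" "\<And>x y. x \<in> S \<Longrightarrow> y \<in> S \<Longrightarrow> x \<oplus> y \<in> S"
    "\<And>c x. x \<in> S \<Longrightarrow> c \<odot> x \<in> S"
  shows "submodule S scalars E"
proof (rule submoduleI)
  show "\<ominus> a \<in> S" if "a \<in> S" for a
    using assms(1) assms(4)[OF that, of "-1"] that by (simp add: smult_minus_1 subset_iff)
qed (use assms in auto)

lemma subspace_minus:
  assumes S: "submodule S scalars E" and xy: "x \<in> S" "y \<in> S"
  shows "x \<ominus>\<^bsub>E\<lparr>carrier := S\<rparr>\<^esub> y = x \<ominus> y"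
proof -
  have "\<ominus>\<^bsub>E\<lparr>carrier := S\<rparr>\<^esub> y = \<ominus> y"
    using group.m_inv_consistent[OF M.a_group submodule.axioms(1)[OF S], of y] xy
    by (simp add: a_inv_def)
  then show ?thesis by (simp add: a_minus_def)
qed

lemma subspace_normed:
  assumes S: "submodule S scalars E"
  shows "complex_normed_space (E\<lparr>carrier := S\<rparr>)"
proof -
  have "module scalars (E\<lparr>carrier := S\<rparr>)"
    by (rule submodule.submodule_is_module[OF S module_axioms])
  then show ?thesis
    using submodule_mem(1)[OF S]
    by (auto intro!: complex_normed_space.intro complex_normed_space_axioms.intro
        simp: nrm_nonneg nrm_eq_zero_iff nrm_smult nrm_triangle subset_iff)
qed

lemma subspace_ndist:
  assumes S: "submodule S scalars E" and "x \<in> S" "y \<in> S"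
  shows "ndist (E\<lparr>carrier := S\<rparr>) x y = ndist E x y"
  using assms submodule_mem(1)[OF S] by (auto simp: ndist_def subspace_minus)

end

text \<open>A Cauchy sequence in the subspace converges in \<open>E\<close>, and its limit stays in the closed subspace.\<close>

lemma banach_closed_subspace:
  assumes B: "complex_banach_space E" and S: "closed_subspace S E"
  shows "complex_banach_space (E\<lparr>carrier := S\<rparr>)"
proof -
  interpret complex_banach_space E by (rule B)
  have sub: "submodule S scalars E" using S by (simp add: closed_subspace_def)
  interpret F: complex_normed_space "E\<lparr>carrier := S\<rparr>" by (rule subspace_normed[OF sub])
  note mem = submodule_mem[OF sub]
  have "F.N.mcomplete"
    unfolding F.N.mcomplete_def
  proof (intro allI impI)
    fix \<sigma> :: "nat \<Rightarrow> 'a" assume C: "F.N.MCauchy \<sigma>"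
    have r: "range \<sigma> \<subseteq> S" using C unfolding F.N.MCauchy_def by simp
    have "N.MCauchy \<sigma>"
      using C r mem(1) unfolding F.N.MCauchy_def N.MCauchy_def
      by (auto simp: subspace_ndist[OF sub] range_subsetD)
    then obtain x where x: "limitin N.mtopology \<sigma> x sequentially"
      using complete N.mcomplete_def by blast
    have xE: "x \<in> carrier E" using x N.limitin_mspace by blast
    have xS: "x \<in> S"
    proof (rule ccontr)
      assume "x \<notin> S"
      with S xE obtain e where e: "0 < e" "\<And>y. y \<in> carrier E \<Longrightarrow> nrm E (x \<ominus>\<^bsub>E\<^esub> y) < e \<Longrightarrow> y \<notin> S"
        unfolding closed_subspace_def closedin_ntopology by blast
      then have "\<forall>\<^sub>F n in sequentially. \<sigma> n \<in> carrier E \<and> ndist E (\<sigma> n) x < e"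
        using x unfolding N.limitin_metric by blast
      then obtain n where "\<sigma> n \<in> carrier E" "ndist E (\<sigma> n) x < e"
        using eventually_sequentially by auto
      then have "\<sigma> n \<notin> S" using xE e(2)[of "\<sigma> n"] by (simp add: ndist_def nrm_diff_commute)
      with r show False by auto
    qed
    have "limitin F.N.mtopology \<sigma> x sequentially"
      using x xS r unfolding N.limitin_metric F.N.limitin_metric
      by (fastforce simp: subspace_ndist[OF sub] range_subsetD elim: eventually_mono)
    then show "\<exists>x. limitin F.N.mtopology \<sigma> x sequentially" by blast
  qed
  then show ?thesis
    by (simp add: complex_banach_space_def complex_banach_space_axioms_def F.complex_normed_space_axioms)
qed

text \<open>Cosets are added and scaled through representatives, and the quotient norm, being an infimum,
  is nearly attained by a representative.\<close>

lemma (in complex_normed_space)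
  assumes N: "submodule N scalars E"
  shows quotient_carrier: "carrier (quotient_space E N) = (\<lambda>x. N +> x) ` carrier E"
    and quotient_add: "\<And>x y. x \<in> carrier E \<Longrightarrow> y \<in> carrier E \<Longrightarrow>
      (N +> x) \<oplus>\<^bsub>quotient_space E N\<^esub> (N +> y) = N +> (x \<oplus> y)"
    and quotient_smult: "\<And>c x. x \<in> carrier E \<Longrightarrow>
      c \<odot>\<^bsub>quotient_space E N\<^esub> (N +> x) = N +> (c \<odot> x)"
    and quotient_nrm_le: "\<And>x. x \<in> carrier E \<Longrightarrow> nrm (quotient_space E N) (N +> x) \<le> nrm E x"
    and quotient_lift: "\<And>x e. x \<in> carrier E \<Longrightarrow> 0 < e \<Longrightarrow>
      \<exists>y\<in>carrier E. N +> y = N +> x \<and> nrm E y < nrm (quotient_space E N) (N +> x) + e"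
proof -
  note mem = submodule_mem[OF N]
  have sg: "additive_subgroup N E"
    using submodule.axioms(1)[OF N] by (simp add: additive_subgroup_def)
  interpret A: abelian_subgroup N E by (rule abelian_subgroupI3[OF sg abelian_group_E])
  show c: "carrier (quotient_space E N) = (\<lambda>x. N +> x) ` carrier E"
    by (auto simp: quotient_space_def A_RCOSETS_def')
  show "(N +> x) \<oplus>\<^bsub>quotient_space E N\<^esub> (N +> y) = N +> (x \<oplus> y)"
    if "x \<in> carrier E" "y \<in> carrier E" for x y
    using A.a_rcos_sum[OF that] by (simp add: quotient_space_def)
  show "c \<odot>\<^bsub>quotient_space E N\<^esub> (N +> x) = N +> (c \<odot> x)" if x: "x \<in> carrier E" for c x
  proof -
    have "set_add E N ((\<lambda>y. c \<odot> y) ` (N +> x)) = N +> (c \<odot> x)"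
    proof (intro Set.set_eqI iffI)
      fix z assume "z \<in> set_add E N ((\<lambda>y. c \<odot> y) ` (N +> x))"
      then obtain n m where nm: "n \<in> N" "m \<in> N" "z = n \<oplus> c \<odot> (m \<oplus> x)"
        by (auto simp: set_add_def' a_r_coset_def')
      then have "z = (n \<oplus> c \<odot> m) \<oplus> c \<odot> x"
        using mem(1) x by (simp add: smult_add_right M.a_assoc subset_iff)
      then show "z \<in> N +> (c \<odot> x)" using mem nm by (auto simp: a_r_coset_def')
    next
      fix z assume "z \<in> N +> (c \<odot> x)"
      then obtain n where n: "n \<in> N" "z = n \<oplus> c \<odot> x" by (auto simp: a_r_coset_def')
      have "x \<in> N +> x" using mem(2) x by (auto simp: a_r_coset_def' intro!: bexI[of _ "\<zero>"])
      then show "z \<in> set_add E N ((\<lambda>y. c \<odot> y) ` (N +> x))" using n by (auto simp: set_add_def')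
    qed
    then show ?thesis by (simp add: quotient_space_def)
  qed
  have sub: "N +> x \<subseteq> carrier E" if "x \<in> carrier E" for x
    using that mem(1) by (auto simp: a_r_coset_def')
  have bdd: "bdd_below (nrm E ` (N +> x))" if "x \<in> carrier E" for x
    using sub[OF that] by (intro bdd_belowI2[of _ 0]) (auto simp: nrm_nonneg)
  have self: "x \<in> N +> x" if "x \<in> carrier E" for x
    using mem(2) that by (auto simp: a_r_coset_def' intro!: bexI[of _ "\<zero>"])
  show "nrm (quotient_space E N) (N +> x) \<le> nrm E x" if "x \<in> carrier E" for x
    using cInf_lower[OF imageI[OF self[OF that]] bdd[OF that]] by (simp add: quotient_space_def)
  show "\<exists>y\<in>carrier E. N +> y = N +> x \<and> nrm E y < nrm (quotient_space E N) (N +> x) + e"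
    if x: "x \<in> carrier E" and e: "0 < e" for x e
  proof -
    have "nrm E ` (N +> x) \<noteq> {}" using self[OF x] by blast
    from cInf_lessD[OF this, of "Inf (nrm E ` (N +> x)) + e"]
    obtain y where y: "y \<in> N +> x" "nrm E y < Inf (nrm E ` (N +> x)) + e"
      using e by auto
    have "N +> x = N +> y" by (rule M.a_repr_independence[OF y(1) x submodule.axioms(1)[OF N]])
    then show ?thesis using y sub[OF x] by (auto simp: quotient_space_def)
  qed
qed

section \<open>The normed space of classes of p-integrable functions\<close>

text \<open>The elements of \<^const>\<open>Lp_space\<close>, described by almost everywhere equality instead of as cosets.\<close>

definition Lp_class :: "real \<Rightarrow> 'm measure \<Rightarrow> ('m \<Rightarrow> complex) \<Rightarrow> ('m \<Rightarrow> complex) set" where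
  "Lp_class p M f = {g \<in> Lp p M. AE x in M. g x = f x}"

lemma Lp_class_self: "f \<in> Lp p M \<Longrightarrow> f \<in> Lp_class p M f"
  by (simp add: Lp_class_def)

lemma Lp_class_eq_coset:
  assumes p: "0 < p" and f: "f \<in> Lp p M"
  shows "{f \<in> Lp p M. AE x in M. f x = 0} +>\<^bsub>Lp_functions p M\<^esub> f = Lp_class p M f"
proof (intro Set.set_eqI iffI)
  fix g assume "g \<in> {f \<in> Lp p M. AE x in M. f x = 0} +>\<^bsub>Lp_functions p M\<^esub> f"
  then obtain h where h: "h \<in> Lp p M" "AE x in M. h x = 0" "g = (\<lambda>x. h x + f x)"
    by (auto simp: a_r_coset_def' Lp_functions_def)
  have "AE x in M. g x = f x" using h by auto
  then show "g \<in> Lp_class p M f" using Lp_add[OF p h(1) f] h by (simp add: Lp_class_def)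
next
  fix g assume g: "g \<in> Lp_class p M f"
  have "(\<lambda>x. g x - f x) \<in> Lp p M" using g Lp_diff[OF p _ f] by (simp add: Lp_class_def)
  moreover have "AE x in M. g x - f x = 0" using g by (simp add: Lp_class_def)
  ultimately show "g \<in> {f \<in> Lp p M. AE x in M. f x = 0} +>\<^bsub>Lp_functions p M\<^esub> f"
    by (auto simp: a_r_coset_def' Lp_functions_def intro!: exI[of _ "\<lambda>x. g x - f x"])
qed

lemma Lp_class_null: "{f \<in> Lp p M. AE x in M. f x = 0} = Lp_class p M (\<lambda>x. 0)"
  by (simp add: Lp_class_def)

lemma Lp_space_carrier:
  assumes "0 < p" shows "carrier (Lp_space p M) = Lp_class p M ` Lp p M"
  using Lp_class_eq_coset[OF assms]
  by (auto simp: Lp_space_def quotient_space_def A_RCOSETS_def')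

lemma Lp_space_zero: "\<zero>\<^bsub>Lp_space p M\<^esub> = Lp_class p M (\<lambda>x. 0)"
  by (simp add: Lp_space_def quotient_space_def Lp_class_null)

lemma Lp_set_addI:
  "a \<in> A \<Longrightarrow> b \<in> B \<Longrightarrow> (\<lambda>x. a x + b x) \<in> A <+>\<^bsub>Lp_functions p M\<^esub> B"
  by (auto simp: set_add_def' Lp_functions_def)

lemma Lp_class_set_add:
  assumes p: "0 < p" and f: "f \<in> Lp p M" and g: "g \<in> Lp p M"
  shows "Lp_class p M f <+>\<^bsub>Lp_functions p M\<^esub> Lp_class p M g = Lp_class p M (\<lambda>x. f x + g x)"
proof (intro Set.set_eqI iffI)
  fix h assume "h \<in> Lp_class p M f <+>\<^bsub>Lp_functions p M\<^esub> Lp_class p M g"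
  then obtain a b where ab: "a \<in> Lp_class p M f" "b \<in> Lp_class p M g" "h = (\<lambda>x. a x + b x)"
    by (auto simp: set_add_def' Lp_functions_def)
  then show "h \<in> Lp_class p M (\<lambda>x. f x + g x)"
    using Lp_add[OF p, of a M b] by (auto simp: Lp_class_def)
next
  fix h assume h: "h \<in> Lp_class p M (\<lambda>x. f x + g x)"
  have "(\<lambda>x. h x - g x) \<in> Lp_class p M f"
    using h Lp_diff[OF p _ g] by (auto simp: Lp_class_def algebra_simps)
  from Lp_set_addI[OF this Lp_class_self[OF g], of p M]
  show "h \<in> Lp_class p M f <+>\<^bsub>Lp_functions p M\<^esub> Lp_class p M g" by simp
qed

lemma Lp_space_add:
  assumes "0 < p" "f \<in> Lp p M" "g \<in> Lp p M"
  shows "Lp_class p M f \<oplus>\<^bsub>Lp_space p M\<^esub> Lp_class p M g = Lp_class p M (\<lambda>x. f x + g x)"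
  using Lp_class_set_add[OF assms] by (simp add: Lp_space_def quotient_space_def)

lemma Lp_space_smult:
  assumes p: "0 < p" and f: "f \<in> Lp p M"
  shows "c \<odot>\<^bsub>Lp_space p M\<^esub> Lp_class p M f = Lp_class p M (\<lambda>x. c * f x)"
proof -
  have "Lp_class p M (\<lambda>x. 0) <+>\<^bsub>Lp_functions p M\<^esub> ((\<lambda>f x. c * f x) ` Lp_class p M f)
      = Lp_class p M (\<lambda>x. c * f x)"
  proof (intro Set.set_eqI iffI)
    fix h assume "h \<in> Lp_class p M (\<lambda>x. 0) <+>\<^bsub>Lp_functions p M\<^esub> ((\<lambda>f x. c * f x) ` Lp_class p M f)"
    then obtain a b where ab: "a \<in> Lp_class p M (\<lambda>x. 0)" "b \<in> Lp_class p M f"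
      "h = (\<lambda>x. a x + c * b x)"
      by (auto simp: set_add_def' Lp_functions_def)
    then have ab': "a \<in> Lp p M" "AE x in M. a x = 0" "b \<in> Lp p M" "AE x in M. b x = f x"
      by (auto simp: Lp_class_def)
    have "AE x in M. h x = c * f x" using ab'(2,4) ab(3) by auto
    moreover have "h \<in> Lp p M" using Lp_add[OF p ab'(1) Lp_scale[OF p ab'(3)]] ab(3) by simp
    ultimately show "h \<in> Lp_class p M (\<lambda>x. c * f x)" by (simp add: Lp_class_def)
  next
    fix h assume h: "h \<in> Lp_class p M (\<lambda>x. c * f x)"
    have "(\<lambda>x. h x - c * f x) \<in> Lp_class p M (\<lambda>x. 0)"
      using h Lp_diff[OF p _ Lp_scale[OF p f]] by (auto simp: Lp_class_def)
    from Lp_set_addI[OF this imageI[OF Lp_class_self[OF f], of "\<lambda>f x. c * f x"], of p M]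
    show "h \<in> Lp_class p M (\<lambda>x. 0) <+>\<^bsub>Lp_functions p M\<^esub> ((\<lambda>f x. c * f x) ` Lp_class p M f)"
      by simp
  qed
  then show ?thesis
    by (simp add: Lp_space_def quotient_space_def Lp_class_null) (simp add: Lp_functions_def)
qed

lemma Lp_space_nrm:
  assumes f: "f \<in> Lp p M"
  shows "nrm (Lp_space p M) (Lp_class p M f) = Lnorm p M f"
proof -
  have eq: "Lnorm p M g = Lnorm p M f" if "g \<in> Lp_class p M f" for g
    using that f by (intro Lnorm_cong_AE) (auto simp: Lp_class_def Lp_iff)
  have "Lnorm p M ` Lp_class p M f = (\<lambda>_. Lnorm p M f) ` Lp_class p M f"
    by (rule image_cong[OF refl eq])
  also have "\<dots> = {Lnorm p M f}" using Lp_class_self[OF f] by blast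
  finally show ?thesis by (simp add: Lp_space_def quotient_space_def)
qed

lemma Lp_space_normed:
  assumes p: "1 \<le> p"
  shows "complex_normed_space (Lp_space p M)"
proof -
  have p0: "0 < p" using p by simp
  note simps = Lp_space_carrier[OF p0] Lp_space_zero Lp_space_add[OF p0] Lp_space_smult[OF p0]
    Lp_add[OF p0] Lp_scale[OF p0] Lp_zero[OF p0] Lp_space_nrm
  have "abelian_group (Lp_space p M)"
  proof (rule abelian_groupI)
    fix A assume "A \<in> carrier (Lp_space p M)"
    then obtain f where f: "f \<in> Lp p M" "A = Lp_class p M f" by (auto simp: simps)
    then have "(\<lambda>x. - f x) \<in> Lp p M" using Lp_scale[OF p0 f(1), of "-1"] by simp
    then show "\<exists>B\<in>carrier (Lp_space p M). B \<oplus>\<^bsub>Lp_space p M\<^esub> A = \<zero>\<^bsub>Lp_space p M\<^esub>"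
      using f by (intro bexI[of _ "Lp_class p M (\<lambda>x. - f x)"]) (auto simp: simps)
  qed (auto simp: simps algebra_simps)
  then have "module scalars (Lp_space p M)"
    by (intro moduleI cring_from_type_algebra) (auto simp: simps algebra_simps)
  then show ?thesis
  proof (rule complex_normed_space.intro, unfold_locales)
    fix A assume "A \<in> carrier (Lp_space p M)"
    then obtain f where f: "f \<in> Lp p M" "A = Lp_class p M f" by (auto simp: simps)
    show "0 \<le> nrm (Lp_space p M) A" using f by (simp add: simps)
    show "nrm (Lp_space p M) (c \<odot>\<^bsub>Lp_space p M\<^esub> A) = cmod c * nrm (Lp_space p M) A" for c
      using f by (simp add: simps Lnorm_scale[OF p0])
    have "Lp_class p M f = Lp_class p M (\<lambda>x. 0) \<longleftrightarrow> (AE x in M. f x = 0)"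
    proof
      assume "Lp_class p M f = Lp_class p M (\<lambda>x. 0)"
      then show "AE x in M. f x = 0" using Lp_class_self[OF f(1)] by (simp add: Lp_class_def)
    qed (auto simp: Lp_class_def)
    then show "nrm (Lp_space p M) A = 0 \<longleftrightarrow> A = \<zero>\<^bsub>Lp_space p M\<^esub>"
      using f by (simp add: simps Lnorm_eq_0_iff[OF p0])
    fix B assume "B \<in> carrier (Lp_space p M)"
    then obtain g where g: "g \<in> Lp p M" "B = Lp_class p M g" by (auto simp: simps)
    show "nrm (Lp_space p M) (A \<oplus>\<^bsub>Lp_space p M\<^esub> B) \<le> nrm (Lp_space p M) A + nrm (Lp_space p M) B"
      using f g by (simp add: simps Minkowski_integral[OF p])
  qed
qed

section \<open>Functionals\<close>

context complex_normed_space
begin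

lemma dualI:
  assumes "\<And>x y. x \<in> carrier E \<Longrightarrow> y \<in> carrier E \<Longrightarrow> \<phi> (x \<oplus> y) = \<phi> x + \<phi> y"
    and "\<And>c x. x \<in> carrier E \<Longrightarrow> \<phi> (c \<odot> x) = c * \<phi> x"
    and "\<And>x. x \<in> carrier E \<Longrightarrow> cmod (\<phi> x) \<le> b * nrm E x"
  shows "\<phi> \<in> dual E"
  using assms unfolding dual_def by blast

lemma dual_add: "\<phi> \<in> dual E \<Longrightarrow> x \<in> carrier E \<Longrightarrow> y \<in> carrier E \<Longrightarrow> \<phi> (x \<oplus> y) = \<phi> x + \<phi> y"
  by (simp add: dual_def)

lemma dual_smult: "\<phi> \<in> dual E \<Longrightarrow> x \<in> carrier E \<Longrightarrow> \<phi> (c \<odot> x) = c * \<phi> x"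
  by (simp add: dual_def)

lemma dual_zero: "\<phi> \<in> dual E \<Longrightarrow> \<phi> \<zero> = 0"
  using dual_smult[of \<phi> "\<zero>" 0] by simp

lemma dual_diff:
  assumes "\<phi> \<in> dual E" "x \<in> carrier E" "y \<in> carrier E"
  shows "\<phi> (x \<ominus> y) = \<phi> x - \<phi> y"
  using dual_add[OF assms(1), of "x \<ominus> y" y] assms by (simp add: diff_add_cancel)

lemma dual_norm_bdd:
  assumes "\<phi> \<in> dual E"
  shows "bdd_above {cmod (\<phi> x) |x. x \<in> carrier E \<and> nrm E x \<le> 1}"
proof -
  obtain C where C: "\<And>x. x \<in> carrier E \<Longrightarrow> cmod (\<phi> x) \<le> C * nrm E x"
    using assms unfolding dual_def by blast
  have "cmod (\<phi> x) \<le> max C 0" if "x \<in> carrier E" "nrm E x \<le> 1" for x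
  proof -
    have "C * nrm E x \<le> max C 0 * 1"
      using that nrm_nonneg by (intro mult_mono) auto
    with C[OF that(1)] show ?thesis by simp
  qed
  then show ?thesis by (intro bdd_aboveI[of _ "max C 0"]) auto
qed

lemma dual_norm_upper:
  assumes "\<phi> \<in> dual E" "x \<in> carrier E" "nrm E x \<le> 1"
  shows "cmod (\<phi> x) \<le> dual_norm E \<phi>"
  unfolding dual_norm_def by (rule cSup_upper[OF _ dual_norm_bdd]) (use assms in auto)

lemma dual_norm_nonneg: "\<phi> \<in> dual E \<Longrightarrow> 0 \<le> dual_norm E \<phi>"
  using dual_norm_upper[of \<phi> "\<zero>"] by (simp add: dual_zero)

lemma dual_norm_bound:
  assumes "\<phi> \<in> dual E" "x \<in> carrier E"
  shows "cmod (\<phi> x) \<le> dual_norm E \<phi> * nrm E x"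
proof (cases "nrm E x = 0")
  case True
  then show ?thesis using assms nrm_eq_zero_iff by (simp add: dual_zero)
next
  case False
  then have n: "0 < nrm E x" using nrm_nonneg[OF assms(2)] by simp
  let ?y = "complex_of_real (1 / nrm E x) \<odot> x"
  have "nrm E ?y \<le> 1" using n assms by (simp add: nrm_smult norm_divide)
  from dual_norm_upper[OF assms(1) _ this] assms n show ?thesis
    by (simp add: dual_smult norm_mult norm_divide field_simps)
qed

lemma dual_norm_attained_nearly:
  assumes "\<phi> \<in> dual E" "c < dual_norm E \<phi>"
  obtains x where "x \<in> carrier E" "nrm E x \<le> 1" "c < cmod (\<phi> x)"
proof -
  have "{cmod (\<phi> x) |x. x \<in> carrier E \<and> nrm E x \<le> 1} \<noteq> {}"
    by (auto intro!: exI[of _ "\<zero>"])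
  from less_cSupD[OF this assms(2)[unfolded dual_norm_def]] that show thesis by blast
qed

lemma dual_norm_least:
  assumes "\<And>x. x \<in> carrier E \<Longrightarrow> cmod (\<phi> x) \<le> b * nrm E x" "0 \<le> b"
  shows "dual_norm E \<phi> \<le> b"
  unfolding dual_norm_def
proof (rule cSup_least)
  show "{cmod (\<phi> x) |x. x \<in> carrier E \<and> nrm E x \<le> 1} \<noteq> {}"
    by (auto intro!: exI[of _ "\<zero>"])
  fix r assume "r \<in> {cmod (\<phi> x) |x. x \<in> carrier E \<and> nrm E x \<le> 1}"
  then obtain x where x: "x \<in> carrier E" "nrm E x \<le> 1" "r = cmod (\<phi> x)" by blast
  have "b * nrm E x \<le> b * 1" using x assms(2) by (intro mult_left_mono) auto
  with assms(1)[OF x(1)] x show "r \<le> b" by simp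
qed

lemma dual_intro_diff:
  assumes "\<phi> \<in> dual E" "\<psi> \<in> dual E"
  shows "(\<lambda>x. \<phi> x - \<psi> x) \<in> dual E"
proof -
  have b: "cmod (\<phi> x - \<psi> x) \<le> (dual_norm E \<phi> + dual_norm E \<psi>) * nrm E x" if "x \<in> carrier E" for x
    using dual_norm_bound[OF assms(1) that] dual_norm_bound[OF assms(2) that]
      norm_triangle_ineq4[of "\<phi> x" "\<psi> x"] by (simp add: distrib_right)
  show ?thesis
    by (rule dualI[OF _ _ b]) (use assms in \<open>auto simp: dual_add dual_smult algebra_simps\<close>)
qed

lemma dual_intro_scale:
  assumes "\<phi> \<in> dual E"
  shows "(\<lambda>x. c * \<phi> x) \<in> dual E"
proof -
  have b: "cmod (c * \<phi> x) \<le> (cmod c * dual_norm E \<phi>) * nrm E x" if "x \<in> carrier E" for x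
    using dual_norm_bound[OF assms(1) that] by (simp add: norm_mult mult.assoc mult_left_mono)
  show ?thesis
    by (rule dualI[OF _ _ b]) (use assms in \<open>auto simp: dual_add dual_smult algebra_simps\<close>)
qed

end

section \<open>Presentations of QSLp-spaces\<close>

text \<open>A QSLp-space is the image of a linear space \<open>L\<close> of \<open>q\<close>-integrable functions under a linear
  map \<open>Q\<close> that is a metric quotient map for the \<open>L\<^sub>q\<close>-seminorm. Working with functions instead of
  classes of cosets of classes keeps the analysis pointwise.\<close>

locale QSL_presentation = complex_normed_space E for E :: "'e cnspace" (structure) +
  fixes q :: real and M :: "'m measure" and L :: "('m \<Rightarrow> complex) set"
    and Q :: "('m \<Rightarrow> complex) \<Rightarrow> 'e"
  assumes exponent: "1 < q"
    and L_subset: "L \<subseteq> Lp q M"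
    and L_add: "f \<in> L \<Longrightarrow> g \<in> L \<Longrightarrow> (\<lambda>x. f x + g x) \<in> L"
    and L_scale: "f \<in> L \<Longrightarrow> (\<lambda>x. c * f x) \<in> L"
    and Q_in: "f \<in> L \<Longrightarrow> Q f \<in> carrier E"
    and Q_add: "f \<in> L \<Longrightarrow> g \<in> L \<Longrightarrow> Q (\<lambda>x. f x + g x) = Q f \<oplus> Q g"
    and Q_scale: "f \<in> L \<Longrightarrow> Q (\<lambda>x. c * f x) = c \<odot> Q f"
    and Q_nrm: "f \<in> L \<Longrightarrow> nrm E (Q f) \<le> Lnorm q M f"
    and Q_lift: "e \<in> carrier E \<Longrightarrow> 0 < \<epsilon> \<Longrightarrow> \<exists>f\<in>L. Q f = e \<and> Lnorm q M f \<le> nrm E e + \<epsilon>"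

text \<open>\<open>Q f\<close> is the vector that the given isometry sends to the coset of the class of \<open>f\<close>.\<close>

lemma QSL_space_presentation:
  assumes QSL: "QSL_space TYPE('m) q E" and q: "1 < q"
  obtains M :: "'m measure" and L Q where "QSL_presentation E q M L Q"
proof -
  obtain M :: "'m measure" and S N V where B: "complex_banach_space E"
    and S: "closed_subspace S (Lp_space q M)"
    and N: "closed_subspace N ((Lp_space q M)\<lparr>carrier := S\<rparr>)"
    and V: "invertible_isometry V E (quotient_space ((Lp_space q M)\<lparr>carrier := S\<rparr>) N)"
    using QSL unfolding QSL_space_def by blast
  interpret complex_banach_space E by (rule B)
  have q0: "0 < q" using q by simp
  let ?K = "(Lp_space q M)\<lparr>carrier := S\<rparr>"
  let ?R = "quotient_space ?K N"
  interpret LL: complex_normed_space "Lp_space q M" using q by (intro Lp_space_normed) simp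
  have Ssub: "submodule S scalars (Lp_space q M)" using S by (simp add: closed_subspace_def)
  note Smem = LL.submodule_mem[OF Ssub]
  interpret K: complex_normed_space ?K by (rule LL.subspace_normed[OF Ssub])
  have Nsub: "submodule N scalars ?K" using N by (simp add: closed_subspace_def)
  note R_car = K.quotient_carrier[OF Nsub] and R_add = K.quotient_add[OF Nsub]
    and R_smult = K.quotient_smult[OF Nsub] and R_nrm = K.quotient_nrm_le[OF Nsub]
    and R_lift = K.quotient_lift[OF Nsub]
  let ?coset = "\<lambda>A. N +>\<^bsub>?K\<^esub> A"
  have Vb: "bij_betw V (carrier E) (?coset ` S)"
    and Va: "\<And>x y. x \<in> carrier E \<Longrightarrow> y \<in> carrier E \<Longrightarrow> V (x \<oplus>\<^bsub>E\<^esub> y) = V x \<oplus>\<^bsub>?R\<^esub> V y"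
    and Vs: "\<And>c x. x \<in> carrier E \<Longrightarrow> V (c \<odot>\<^bsub>E\<^esub> x) = c \<odot>\<^bsub>?R\<^esub> V x"
    and Vn: "\<And>x. x \<in> carrier E \<Longrightarrow> nrm ?R (V x) = nrm E x"
    using V unfolding invertible_isometry_def R_car by auto
  define L where "L = {f \<in> Lp q M. Lp_class q M f \<in> S}"
  define Q where "Q f = inv_into (carrier E) V (?coset (Lp_class q M f))" for f
  have Q_in: "Q f \<in> carrier E" and VQ: "V (Q f) = ?coset (Lp_class q M f)" if "f \<in> L" for f
  proof -
    have "?coset (Lp_class q M f) \<in> V ` carrier E"
      using that bij_betw_imp_surj_on[OF Vb] by (auto simp: L_def)
    then show "Q f \<in> carrier E" "V (Q f) = ?coset (Lp_class q M f)"
      unfolding Q_def by (rule inv_into_into, rule f_inv_into_f)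
  qed
  have Q_eqI: "Q f = e" if "f \<in> L" "e \<in> carrier E" "V e = ?coset (Lp_class q M f)" for f e
    using that VQ[OF that(1)] Q_in[OF that(1)] bij_betw_imp_inj_on[OF Vb] by (metis inj_onD)
  have add: "(\<lambda>x. f x + g x) \<in> L" "Q (\<lambda>x. f x + g x) = Q f \<oplus>\<^bsub>E\<^esub> Q g"
    if f: "f \<in> L" and g: "g \<in> L" for f g
  proof -
    have fg: "f \<in> Lp q M" "Lp_class q M f \<in> S" "g \<in> Lp q M" "Lp_class q M g \<in> S"
      using f g by (auto simp: L_def)
    have eq: "Lp_class q M (\<lambda>x. f x + g x) = Lp_class q M f \<oplus>\<^bsub>Lp_space q M\<^esub> Lp_class q M g"
      using Lp_space_add[OF q0 fg(1,3)] by simp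
    then show in_L: "(\<lambda>x. f x + g x) \<in> L"
      using Smem(3) fg Lp_add[OF q0 fg(1,3)] by (simp add: L_def)
    show "Q (\<lambda>x. f x + g x) = Q f \<oplus>\<^bsub>E\<^esub> Q g"
      using Q_in[OF f] Q_in[OF g] R_add[of "Lp_class q M f" "Lp_class q M g"] fg
      by (intro Q_eqI[OF in_L]) (auto simp: Va VQ f g eq)
  qed
  have scale: "(\<lambda>x. c * f x) \<in> L" "Q (\<lambda>x. c * f x) = c \<odot>\<^bsub>E\<^esub> Q f"
    if f: "f \<in> L" for f c
  proof -
    have fg: "f \<in> Lp q M" "Lp_class q M f \<in> S" using f by (auto simp: L_def)
    have eq: "Lp_class q M (\<lambda>x. c * f x) = c \<odot>\<^bsub>Lp_space q M\<^esub> Lp_class q M f"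
      using Lp_space_smult[OF q0 fg(1)] by simp
    then show in_L: "(\<lambda>x. c * f x) \<in> L"
      using Smem(4) fg Lp_scale[OF q0 fg(1)] by (simp add: L_def)
    show "Q (\<lambda>x. c * f x) = c \<odot>\<^bsub>E\<^esub> Q f"
      using Q_in[OF f] R_smult[of "Lp_class q M f" c] fg
      by (intro Q_eqI[OF in_L]) (auto simp: Vs VQ f eq)
  qed
  have "QSL_presentation E q M L Q"
  proof (unfold_locales)
    show "L \<subseteq> Lp q M" by (auto simp: L_def)
    show "nrm E (Q f) \<le> Lnorm q M f" if f: "f \<in> L" for f
    proof -
      have fg: "f \<in> Lp q M" "Lp_class q M f \<in> S" using f by (auto simp: L_def)
      have "nrm E (Q f) = nrm ?R (?coset (Lp_class q M f))"
        using Vn[OF Q_in[OF f]] VQ[OF f] by simp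
      also have "\<dots> \<le> nrm (Lp_space q M) (Lp_class q M f)"
        using R_nrm[of "Lp_class q M f"] fg by simp
      finally show ?thesis using fg by (simp add: Lp_space_nrm)
    qed
    show "\<exists>f\<in>L. Q f = e \<and> Lnorm q M f \<le> nrm E e + \<epsilon>" if e: "e \<in> carrier E" and "0 < \<epsilon>" for e \<epsilon>
    proof -
      obtain A where A: "A \<in> S" "V e = ?coset A"
        using bij_betw_imp_surj_on[OF Vb] e by blast
      obtain B where B: "B \<in> S" "?coset B = ?coset A" "nrm (Lp_space q M) B < nrm ?R (?coset A) + \<epsilon>"
        using R_lift[of A \<epsilon>] A \<open>0 < \<epsilon>\<close> by auto
      obtain f where f: "f \<in> Lp q M" "B = Lp_class q M f"
        using B(1) Smem(1) by (auto simp: Lp_space_carrier[OF q0])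
      have fL: "f \<in> L" using f B by (simp add: L_def)
      have "Q f = e" using Q_eqI[OF fL e] A B f by simp
      moreover have "Lnorm q M f \<le> nrm E e + \<epsilon>"
        using B(3) f Vn[OF e] A(2) by (simp add: Lp_space_nrm)
      ultimately show ?thesis using fL by blast
    qed
  qed (use q add scale Q_in in auto)
  then show thesis by (rule that)
qed

section \<open>Uniform smoothness of Lq\<close>

text \<open>The derivative of \<open>z \<mapsto> \<bar>z\<bar>\<^sup>q\<close> at \<open>z\<close> in direction \<open>b\<close> is \<open>q Re (duality_map q z * b)\<close>.\<close>

definition duality_map :: "real \<Rightarrow> complex \<Rightarrow> complex" where
  "duality_map q z = complex_of_real (cmod z powr (q - 2)) * cnj z"

lemma duality_map_self: "duality_map q z * z = complex_of_real (cmod z powr q)"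
proof (cases "z = 0")
  case False
  have "duality_map q z * z = complex_of_real (cmod z powr (q - 2)) * (z * cnj z)"
    by (simp add: duality_map_def ac_simps)
  also have "\<dots> = complex_of_real (cmod z powr (q - 2) * cmod z powr 2)"
    by (simp add: complex_norm_square[symmetric])
  also have "cmod z powr (q - 2) * cmod z powr 2 = cmod z powr q"
    by (simp add: powr_add[symmetric] del: powr_numeral)
  finally show ?thesis .
qed (simp add: duality_map_def)

lemma duality_map_norm: "cmod (duality_map q z) = cmod z powr (q - 1)"
proof (cases "z = 0")
  case False
  have "cmod z powr (q - 2) * cmod z = cmod z powr (q - 1)"
    using powr_mult_base[of "cmod z" "q - 2"] by (simp add: mult.commute)
  then show ?thesis by (simp add: duality_map_def norm_mult)
qed (simp add: duality_map_def)

lemma duality_map_continuous: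
  assumes q: "1 < q" shows "continuous_on UNIV (duality_map q)"
proof -
  have "isCont (duality_map q) z" for z
  proof (cases "z = 0")
    case True
    have "(\<lambda>w. cmod w powr (q - 1)) \<midarrow>0\<rightarrow> cmod 0 powr (q - 1)"
      using q by (intro tendsto_powr' tendsto_norm tendsto_ident_at tendsto_const) auto
    then have "(\<lambda>w. norm (duality_map q w)) \<midarrow>0\<rightarrow> 0" using q by (simp add: duality_map_norm)
    then have "duality_map q \<midarrow>0\<rightarrow> 0" by (rule tendsto_norm_zero_cancel)
    then show ?thesis using True by (simp add: isCont_def) (simp add: duality_map_def)
  next
    case False
    then show ?thesis unfolding duality_map_def by (intro continuous_intros) auto
  qed
  then show ?thesis by (simp add: continuous_at_imp_continuous_on)
qed

lemma duality_map_scale: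
  assumes "0 < r"
  shows "duality_map q (complex_of_real r * z) = complex_of_real (r powr (q - 1)) * duality_map q z"
proof -
  have "r powr (q - 2) * r = r powr (q - 1)"
    using powr_mult_base[of r "q - 2"] assms by (simp add: mult.commute)
  then have "complex_of_real (r powr (q - 2)) * complex_of_real r = complex_of_real (r powr (q - 1))"
    by (simp flip: of_real_mult)
  then show ?thesis
    using assms by (simp add: duality_map_def norm_mult powr_mult ac_simps)
qed

text \<open>The tangent inequality for \<open>z \<mapsto> \<bar>z\<bar>\<^sup>q\<close> is Young's inequality.\<close>

lemma powr_tangent:
  assumes q: "1 < q"
  shows "cmod z powr q + q * Re (duality_map q z * (a - z)) \<le> cmod a powr q"
proof -
  let ?p = "q / (q - 1)"
  have pq: "1 < ?p" "1 / q + 1 / ?p = 1" using q by (auto simp: field_simps)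
  have "Re (duality_map q z * a) \<le> cmod a * cmod z powr (q - 1)"
    using complex_Re_le_cmod[of "duality_map q z * a"] by (simp add: norm_mult duality_map_norm mult.commute)
  also have "\<dots> \<le> cmod a powr q / q + (cmod z powr (q - 1)) powr ?p / ?p"
    using q by (intro Youngs_inequality pq) auto
  also have "(cmod z powr (q - 1)) powr ?p = cmod z powr q" using q by (simp add: powr_powr)
  finally have "q * Re (duality_map q z * a) \<le> q * (cmod a powr q / q + cmod z powr q / ?p)"
    using q by (intro mult_left_mono) auto
  also have "\<dots> = cmod a powr q + (q - 1) * cmod z powr q" using q by (simp add: field_simps)
  finally have "q * Re (duality_map q z * a) \<le> cmod a powr q + (q - 1) * cmod z powr q" .
  moreover have "Re (duality_map q z * (a - z)) = Re (duality_map q z * a) - cmod z powr q"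
    by (simp only: right_diff_distrib duality_map_self minus_complex.simps Re_complex_of_real)
  ultimately show ?thesis
    by (simp only: right_diff_distrib left_diff_distrib mult_1)
qed

text \<open>The tangent inequality at the perturbed point bounds the increment by the derivative there, and
  the derivative is uniformly continuous on bounded sets. Homogeneity extends the estimate from the unit disc to all arguments.\<close>

lemma powr_uniformly_smooth:
  assumes q: "1 < q" and e: "0 < \<epsilon>"
  obtains t where "0 < t"
    "\<And>a b. cmod (a + complex_of_real t * b) powr q
       \<le> cmod a powr q + q * t * Re (duality_map q a * b) + \<epsilon> * t * (cmod a powr q + cmod b powr q)"
proof -
  have "uniformly_continuous_on (cball 0 2) (duality_map q)"
    by (rule compact_uniformly_continuous[OF continuous_on_subset[OF duality_map_continuous[OF q]]]) auto
  moreover have "0 < \<epsilon> / q" using q e by simp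
  ultimately obtain d where d: "0 < d"
    "\<And>z w. z \<in> cball 0 2 \<Longrightarrow> w \<in> cball 0 2 \<Longrightarrow> dist w z < d \<Longrightarrow> dist (duality_map q w) (duality_map q z) < \<epsilon> / q"
    unfolding uniformly_continuous_on_def by blast
  define t where "t = min 1 (d / 2)"
  have t: "0 < t" "t \<le> 1" "t < d" using d by (auto simp: t_def)
  have unit: "cmod (a + complex_of_real t * b) powr q \<le> cmod a powr q + q * t * Re (duality_map q a * b) + \<epsilon> * t"
    if ab: "cmod a \<le> 1" "cmod b \<le> 1" for a b
  proof -
    define z where "z = a + complex_of_real t * b"
    have tb: "cmod (complex_of_real t * b) \<le> t" using t ab by (simp add: norm_mult mult_left_le)
    have z2: "cmod z \<le> 2" using norm_triangle_ineq[of a "complex_of_real t * b"] tb t ab by (simp add: z_def)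
    have "dist z a < d" using tb t by (simp add: z_def dist_norm)
    then have "dist (duality_map q z) (duality_map q a) < \<epsilon> / q"
      using z2 ab by (intro d(2)) auto
    then have dJ: "cmod (duality_map q z - duality_map q a) \<le> \<epsilon> / q" by (simp add: dist_norm)
    have "Re ((duality_map q z - duality_map q a) * b) \<le> \<epsilon> / q * 1"
      using complex_Re_le_cmod[of "(duality_map q z - duality_map q a) * b"]
        mult_mono[OF dJ ab(2)] e q by (simp add: norm_mult)
    then have J: "Re (duality_map q z * b) \<le> Re (duality_map q a * b) + \<epsilon> / q"
      by (simp add: left_diff_distrib)
    have "a - z = complex_of_real (- t) * b" by (simp add: z_def)
    then have "duality_map q z * (a - z) = complex_of_real (- t) * (duality_map q z * b)"
      by (simp only: mult.left_commute)
    then have *: "Re (duality_map q z * (a - z)) = - t * Re (duality_map q z * b)"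
      by simp
    have "cmod z powr q \<le> cmod a powr q + q * t * Re (duality_map q z * b)"
      using powr_tangent[OF q, of z a] unfolding * by (simp only: mult_minus_left mult_minus_right mult.assoc)
    also have "\<dots> \<le> cmod a powr q + q * t * (Re (duality_map q a * b) + \<epsilon> / q)"
      using J q t by (intro add_left_mono mult_left_mono) auto
    finally show ?thesis using q by (simp add: z_def algebra_simps)
  qed
  show thesis
  proof (rule that[OF t(1)])
    fix a b
    define r where "r = max (cmod a) (cmod b)"
    show "cmod (a + complex_of_real t * b) powr q
       \<le> cmod a powr q + q * t * Re (duality_map q a * b) + \<epsilon> * t * (cmod a powr q + cmod b powr q)"
    proof (cases "r = 0")
      case True
      then have "a = 0" "b = 0" by (auto simp: r_def max_def split: if_splits)
      then show ?thesis using q by simp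
    next
      case False
      then have r: "0 < r" by (auto simp: r_def max_def split: if_splits)
      let ?R = "complex_of_real r"
      define a' b' where "a' = a / ?R" and "b' = b / ?R"
      have ab: "a = ?R * a'" "b = ?R * b'" using r by (auto simp: a'_def b'_def)
      have le: "cmod a' \<le> 1" "cmod b' \<le> 1" using r by (auto simp: a'_def b'_def norm_divide r_def field_simps)
      have rq: "r powr (q - 1) * r = r powr q"
        using r powr_add[of r "q - 1" 1] by simp
      have J: "Re (duality_map q a * b) = r powr q * Re (duality_map q a' * b')"
      proof -
        have "duality_map q a * b = complex_of_real (r powr (q - 1) * r) * (duality_map q a' * b')"
          unfolding ab duality_map_scale[OF r] by simp
        then show ?thesis unfolding rq by simp
      qed
      have "a + complex_of_real t * b = ?R * (a' + complex_of_real t * b')"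
        unfolding ab by (simp add: algebra_simps)
      then have "cmod (a + complex_of_real t * b) powr q = r powr q * cmod (a' + complex_of_real t * b') powr q"
        using r by (simp add: norm_mult powr_mult)
      also have "\<dots> \<le> r powr q * (cmod a' powr q + q * t * Re (duality_map q a' * b') + \<epsilon> * t)"
        using unit[OF le] by (intro mult_left_mono) auto
      also have "\<dots> = cmod a powr q + q * t * Re (duality_map q a * b) + \<epsilon> * t * r powr q"
      proof -
        have "cmod a powr q = r powr q * cmod a' powr q"
          unfolding ab(1) using r by (simp add: norm_mult powr_mult)
        then show ?thesis unfolding J by (simp add: algebra_simps)
      qed
      also have "r powr q \<le> cmod a powr q + cmod b powr q"
        by (auto simp: r_def max_def)
      finally show ?thesis using e t by (simp add: mult_left_mono)
    qed
  qed
qed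

lemma duality_map_Lp:
  assumes q: "1 < q" "1 < p" "1 / q + 1 / p = 1" and f: "f \<in> Lp q M"
  shows "(\<lambda>x. duality_map q (f x)) \<in> Lp p M"
    and "(\<integral>x. cmod (duality_map q (f x)) powr p \<partial>M) = (\<integral>x. cmod (f x) powr q \<partial>M)"
proof -
  have "duality_map q \<in> borel_measurable borel"
    by (rule borel_measurable_continuous_onI[OF duality_map_continuous[OF q(1)]])
  then have m: "(\<lambda>x. duality_map q (f x)) \<in> borel_measurable M"
    using Lp_measurable[OF f] by (rule measurable_compose_rev)
  have "(q - 1) * p = q" using q by (simp add: field_simps)
  then have eq: "cmod (duality_map q (f x)) powr p = cmod (f x) powr q" for x
    by (simp add: duality_map_norm powr_powr)
  show "(\<lambda>x. duality_map q (f x)) \<in> Lp p M"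
    "(\<integral>x. cmod (duality_map q (f x)) powr p \<partial>M) = (\<integral>x. cmod (f x) powr q \<partial>M)"
    using m f by (simp_all add: Lp_iff eq)
qed

text \<open>Integrating the scalar estimate bounds the \<open>q\<close>-th power of the norm; Young's inequality
  \<open>n \<le> n\<^sup>q / q + 1 / p\<close> then linearises the \<open>q\<close>-th root at 1.\<close>

lemma Lnorm_uniformly_smooth:
  assumes q: "1 < q" and e: "0 < \<epsilon>"
  obtains t where "0 < t"
    "\<And>(M :: 'm measure) f g. f \<in> Lp q M \<Longrightarrow> g \<in> Lp q M \<Longrightarrow> Lnorm q M f = 1 \<Longrightarrow> Lnorm q M g = 1 \<Longrightarrow>
       Lnorm q M (\<lambda>x. f x + complex_of_real t * g x)
         \<le> 1 + t * (Re (\<integral>x. duality_map q (f x) * g x \<partial>M) + \<epsilon>)"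
proof -
  define p where "p = conj_exp q"
  have p: "1 < p" "1 / q + 1 / p = 1" "1 / p + 1 / q = 1"
    using q conj_exp_gt_1 conj_exp_sum conj_exp_sum' unfolding p_def by auto
  have "0 < q * \<epsilon> / 2" using q e by simp
  from powr_uniformly_smooth[OF q this] obtain t where t: "0 < t"
    "\<And>a b. cmod (a + complex_of_real t * b) powr q
       \<le> cmod a powr q + q * t * Re (duality_map q a * b) + q * \<epsilon> / 2 * t * (cmod a powr q + cmod b powr q)"
    by blast
  show thesis
  proof (rule that[OF t(1)])
    fix M :: "'m measure" and f g
    assume f: "f \<in> Lp q M" "Lnorm q M f = 1" and g: "g \<in> Lp q M" "Lnorm q M g = 1"
    have q0: "0 < q" using q by simp
    have i1: "(\<integral>x. cmod (f x) powr q \<partial>M) = 1" "(\<integral>x. cmod (g x) powr q \<partial>M) = 1"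
      using Lnorm_powr[OF q0, of M f] Lnorm_powr[OF q0, of M g] f g by auto
    let ?h = "\<lambda>x. f x + complex_of_real t * g x"
    have h: "?h \<in> Lp q M" by (intro Lp_add Lp_scale f g q0)
    have Ji: "integrable M (\<lambda>x. duality_map q (f x) * g x)"
      by (rule Lp_mult_integrable[OF p(1) q p(3) duality_map_Lp(1)[OF q p(1,2) f(1)] g(1)])
    define R where "R = Re (\<integral>x. duality_map q (f x) * g x \<partial>M)"
    have Ri: "integrable M (\<lambda>x. Re (duality_map q (f x) * g x))" by (rule integrable_Re[OF Ji])
    have R: "(\<integral>x. Re (duality_map q (f x) * g x) \<partial>M) = R" unfolding R_def by (rule integral_Re[OF Ji])
    have "(\<integral>x. cmod (?h x) powr q \<partial>M) \<le> (\<integral>x. cmod (f x) powr q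
        + q * t * Re (duality_map q (f x) * g x) + q * \<epsilon> / 2 * t * (cmod (f x) powr q + cmod (g x) powr q) \<partial>M)"
      using Lp_integrable[OF h] Lp_integrable[OF f(1)] Lp_integrable[OF g(1)] Ri
      by (intro integral_mono t(2) Bochner_Integration.integrable_add integrable_mult_right) auto
    also have "\<dots> = 1 + q * t * R + q * \<epsilon> / 2 * t * (1 + 1)"
      using Lp_integrable[OF f(1)] Lp_integrable[OF g(1)] Ri
      by (simp only: Bochner_Integration.integral_add Bochner_Integration.integrable_add
          integrable_mult_right integral_mult_right_zero R i1)
    finally have le: "(\<integral>x. cmod (?h x) powr q \<partial>M) \<le> 1 + q * t * (R + \<epsilon>)" by (simp add: algebra_simps)
    define n where "n = Lnorm q M ?h"
    have n0: "0 \<le> n" by (simp add: n_def)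
    have "n * 1 \<le> n powr q / q + 1 powr p / p"
      using Youngs_inequality[OF q p(1,2) n0, of 1] by simp
    also have "n powr q = (\<integral>x. cmod (?h x) powr q \<partial>M)" unfolding n_def by (rule Lnorm_powr[OF q0])
    finally have "n \<le> (\<integral>x. cmod (?h x) powr q \<partial>M) / q + (1 - 1 / q)" using p(2) by simp
    also have "\<dots> \<le> (1 + q * t * (R + \<epsilon>)) / q + (1 - 1 / q)"
      using le q by (intro add_right_mono divide_right_mono) auto
    also have "\<dots> = 1 + t * (R + \<epsilon>)" using q by (simp add: field_simps)
    finally show "Lnorm q M ?h \<le> 1 + t * (Re (\<integral>x. duality_map q (f x) * g x \<partial>M) + \<epsilon>)"
      by (simp add: n_def R_def)
  qed
qed

lemma ex_unit_multiplier: "\<exists>w. cmod w = 1 \<and> w * z = complex_of_real (cmod z)"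
proof (cases "z = 0")
  case False
  have "cmod (cnj z / complex_of_real (cmod z)) = 1" using False by (simp add: norm_divide)
  moreover have "cnj z / complex_of_real (cmod z) * z = complex_of_real (cmod z)"
    using False by (simp add: field_simps complex_norm_square[symmetric] power2_eq_square)
  ultimately show ?thesis by blast
qed (auto intro: exI[of _ 1])

context QSL_presentation
begin

text \<open>A functional that nearly attains its norm at \<open>Q f\<close>, with \<open>f\<close> of norm one, is nearly
  represented by the duality map of \<open>f\<close>: the tangent to the unit sphere at \<open>f\<close> is the only
  candidate, and uniform smoothness makes this quantitative and independent of the functional.\<close>

lemma nearly_represented:
  assumes e: "0 < \<epsilon>"
  obtains \<delta> where "0 < \<delta>"
    "\<And>\<phi> f g. \<phi> \<in> dual E \<Longrightarrow> dual_norm E \<phi> \<le> 1 \<Longrightarrow> f \<in> L \<Longrightarrow> Lnorm q M f = 1 \<Longrightarrow> 1 - \<delta> \<le> Re (\<phi> (Q f)) \<Longrightarrow>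
       g \<in> L \<Longrightarrow> cmod (\<phi> (Q g) - (\<integral>x. duality_map q (f x) * g x \<partial>M)) \<le> \<epsilon> * Lnorm q M g"
proof -
  have q: "1 < q" by (rule exponent)
  have q0: "0 < q" using q by simp
  have "0 < \<epsilon> / 2" using e by simp
  from Lnorm_uniformly_smooth[OF q this, where 'm = 'm]
  obtain t where t: "0 < t" "\<And>(M :: 'm measure) f g. f \<in> Lp q M \<Longrightarrow> g \<in> Lp q M \<Longrightarrow>
      Lnorm q M f = 1 \<Longrightarrow> Lnorm q M g = 1 \<Longrightarrow> Lnorm q M (\<lambda>x. f x + complex_of_real t * g x)
         \<le> 1 + t * (Re (\<integral>x. duality_map q (f x) * g x \<partial>M) + \<epsilon> / 2)" by blast
  define p where "p = conj_exp q"
  have p: "1 < p" "1 / q + 1 / p = 1" "1 / p + 1 / q = 1"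
    using q conj_exp_gt_1 conj_exp_sum conj_exp_sum' unfolding p_def by auto
  show thesis
  proof (rule that[of "t * \<epsilon> / 2"])
    show "0 < t * \<epsilon> / 2" using t e by simp
    fix \<phi> f g
    assume \<phi>: "\<phi> \<in> dual E" "dual_norm E \<phi> \<le> 1" and f: "f \<in> L" "Lnorm q M f = 1"
      and near: "1 - t * \<epsilon> / 2 \<le> Re (\<phi> (Q f))" and g: "g \<in> L"
    have fL: "f \<in> Lp q M" and gL: "g \<in> Lp q M" using f g L_subset by auto
    have le1: "cmod (\<phi> (Q h)) \<le> Lnorm q M h" if "h \<in> L" for h
    proof -
      have "cmod (\<phi> (Q h)) \<le> dual_norm E \<phi> * nrm E (Q h)" by (rule dual_norm_bound[OF \<phi>(1) Q_in[OF that]])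
      also have "\<dots> \<le> 1 * Lnorm q M h"
        using \<phi>(2) Q_nrm[OF that] nrm_nonneg[OF Q_in[OF that]] dual_norm_nonneg[OF \<phi>(1)] by (intro mult_mono) auto
      finally show ?thesis by simp
    qed
    define D where "D h = \<phi> (Q h) - (\<integral>x. duality_map q (f x) * h x \<partial>M)" for h
    have unit: "Re (D h) \<le> \<epsilon>" if h: "h \<in> L" "Lnorm q M h = 1" for h
    proof -
      have hL: "h \<in> Lp q M" using h L_subset by auto
      let ?k = "\<lambda>x. f x + complex_of_real t * h x"
      have k: "?k \<in> L" by (intro L_add L_scale f h)
      have "\<phi> (Q ?k) = \<phi> (Q f) + complex_of_real t * \<phi> (Q h)"
        using f h by (simp add: Q_add Q_scale L_scale dual_add[OF \<phi>(1)] dual_smult[OF \<phi>(1)] Q_in)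
      then have "Re (\<phi> (Q f)) + t * Re (\<phi> (Q h)) = Re (\<phi> (Q ?k))" by simp
      also have "\<dots> \<le> Lnorm q M ?k" using le1[OF k] complex_Re_le_cmod order_trans by blast
      also have "\<dots> \<le> 1 + t * (Re (\<integral>x. duality_map q (f x) * h x \<partial>M) + \<epsilon> / 2)"
        by (rule t(2)[OF fL hL f(2) h(2)])
      finally have "t * Re (D h) \<le> t * \<epsilon>" using near by (simp add: D_def algebra_simps)
      then show ?thesis using t by simp
    qed
    have Dscale: "D (\<lambda>x. c * h x) = c * D h" if h: "h \<in> L" for c h
    proof -
      have "(\<integral>x. duality_map q (f x) * (c * h x) \<partial>M) = (\<integral>x. c * (duality_map q (f x) * h x) \<partial>M)"
        by (simp add: ac_simps)
      then show ?thesis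
        using h by (simp add: D_def Q_scale dual_smult[OF \<phi>(1)] Q_in right_diff_distrib)
    qed
    show "cmod (\<phi> (Q g) - (\<integral>x. duality_map q (f x) * g x \<partial>M)) \<le> \<epsilon> * Lnorm q M g"
    proof (cases "Lnorm q M g = 0")
      case True
      have "cmod (\<integral>x. duality_map q (f x) * g x \<partial>M) \<le> Lnorm p M (\<lambda>x. duality_map q (f x)) * Lnorm q M g"
        by (rule Hoelder_integral_norm[OF p(1) q p(3) duality_map_Lp(1)[OF q p(1,2) fL] gL])
      then show ?thesis using le1[OF g] True by simp
    next
      case False
      let ?n = "Lnorm q M g"
      have n: "0 < ?n" using False Lnorm_nonneg[of q M g] by linarith
      obtain w where w: "cmod w = 1" "w * D g = complex_of_real (cmod (D g))"
        using ex_unit_multiplier by blast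
      let ?c = "w / complex_of_real ?n"
      have "cmod ?c * ?n = 1" using n w by (simp add: norm_divide)
      then have "Lnorm q M (\<lambda>x. ?c * g x) = 1" by (simp only: Lnorm_scale[OF q0])
      then have "Re (D (\<lambda>x. ?c * g x)) \<le> \<epsilon>" by (intro unit L_scale g)
      also have "D (\<lambda>x. ?c * g x) = complex_of_real (cmod (D g) / ?n)"
        unfolding Dscale[OF g] using w(2) by simp
      finally have "cmod (D g) \<le> \<epsilon> * ?n" by (simp only: Re_complex_of_real pos_divide_le_eq[OF n])
      then show ?thesis by (simp add: D_def)
    qed
  qed
qed

text \<open>A lift of a vector in the unit ball may have norm slightly above one. Rescaling it costs at most
  another \<open>\<delta> / 2\<close> of the values of the functionals.\<close>

lemma normalised_lift:
  assumes e: "e \<in> carrier E" "nrm E e \<le> 1" and \<phi>: "\<And>\<phi>. \<phi> \<in> \<Phi> \<Longrightarrow> \<phi> \<in> dual E \<and> 1 - \<delta> / 2 \<le> Re (\<phi> e)"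
    and d: "0 < \<delta>" "\<delta> \<le> 1" and ne: "\<Phi> \<noteq> {}"
  obtains f where "f \<in> L" "Lnorm q M f = 1" "\<And>\<phi>. \<phi> \<in> \<Phi> \<Longrightarrow> 1 - \<delta> \<le> Re (\<phi> (Q f))"
proof -
  have q0: "0 < q" using exponent by simp
  obtain h where h: "h \<in> L" "Q h = e" "Lnorm q M h \<le> nrm E e + \<delta> / 2"
    using Q_lift[OF e(1), of "\<delta> / 2"] d by auto
  let ?n = "Lnorm q M h"
  have n1: "?n \<le> 1 + \<delta> / 2" using h e by simp
  have n0: "0 < ?n"
  proof (rule ccontr)
    assume "\<not> 0 < ?n"
    then have "?n = 0" using Lnorm_nonneg[of q M h] by linarith
    then have "nrm E e = 0" using Q_nrm[OF h(1)] h(2) nrm_nonneg[OF e(1)] by simp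
    then have "e = \<zero>" using nrm_eq_zero_iff e by simp
    moreover obtain \<phi> where "\<phi> \<in> \<Phi>" using ne by blast
    ultimately show False using \<phi>[of \<phi>] d dual_zero[of \<phi>] by simp
  qed
  let ?f = "\<lambda>x. complex_of_real (1 / ?n) * h x"
  show thesis
  proof (rule that[of ?f])
    show "?f \<in> L" by (rule L_scale[OF h(1)])
    show "Lnorm q M ?f = 1" using n0 by (simp only: Lnorm_scale[OF q0]) (simp add: norm_divide)
    fix \<phi> assume "\<phi> \<in> \<Phi>"
    then have p: "\<phi> \<in> dual E" "1 - \<delta> / 2 \<le> Re (\<phi> e)" using \<phi> by auto
    have "\<phi> (Q ?f) = complex_of_real (1 / ?n) * \<phi> e"
      unfolding Q_scale[OF h(1)] h(2) by (rule dual_smult[OF p(1) e(1)])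
    then have eq: "Re (\<phi> (Q ?f)) = Re (\<phi> e) / ?n" by simp
    have "(1 - \<delta>) * ?n \<le> (1 - \<delta>) * (1 + \<delta> / 2)" using n1 d by (intro mult_left_mono) auto
    also have "\<dots> \<le> 1 - \<delta> / 2" using d by (simp add: algebra_simps)
    also have "\<dots> \<le> Re (\<phi> e)" by (rule p(2))
    finally show "1 - \<delta> \<le> Re (\<phi> (Q ?f))" unfolding eq by (simp only: pos_le_divide_eq[OF n0])
  qed
qed

text \<open>Uniform smoothness of \<open>E\<close> in dual form: two functionals that nearly attain their norm at the
  same vector are both close to the duality map of one lift.\<close>

lemma functionals_close:
  assumes e: "0 < \<epsilon>"
  obtains \<delta> where "0 < \<delta>" "\<delta> \<le> 1"
    "\<And>\<phi> \<psi> e x. \<phi> \<in> dual E \<Longrightarrow> \<psi> \<in> dual E \<Longrightarrow> dual_norm E \<phi> \<le> 1 \<Longrightarrow> dual_norm E \<psi> \<le> 1 \<Longrightarrow>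
       e \<in> carrier E \<Longrightarrow> nrm E e \<le> 1 \<Longrightarrow> 1 - \<delta> \<le> Re (\<phi> e) \<Longrightarrow> 1 - \<delta> \<le> Re (\<psi> e) \<Longrightarrow>
       x \<in> carrier E \<Longrightarrow> cmod (\<phi> x - \<psi> x) \<le> \<epsilon> * nrm E x"
proof -
  have "0 < \<epsilon> / 2" using e by simp
  from nearly_represented[OF this] obtain d where d: "0 < d"
    "\<And>\<phi> f g. \<phi> \<in> dual E \<Longrightarrow> dual_norm E \<phi> \<le> 1 \<Longrightarrow> f \<in> L \<Longrightarrow> Lnorm q M f = 1 \<Longrightarrow> 1 - d \<le> Re (\<phi> (Q f)) \<Longrightarrow>
       g \<in> L \<Longrightarrow> cmod (\<phi> (Q g) - (\<integral>x. duality_map q (f x) * g x \<partial>M)) \<le> \<epsilon> / 2 * Lnorm q M g" by blast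
  define \<delta> where "\<delta> = min d 1"
  have \<delta>: "0 < \<delta>" "\<delta> \<le> 1" "\<delta> \<le> d" using d(1) by (auto simp: \<delta>_def)
  show thesis
  proof (rule that[of "\<delta> / 2"])
    show "0 < \<delta> / 2" "\<delta> / 2 \<le> 1" using \<delta> by auto
    fix \<phi> \<psi> e x
    assume \<phi>: "\<phi> \<in> dual E" "dual_norm E \<phi> \<le> 1" "1 - \<delta> / 2 \<le> Re (\<phi> e)"
      and \<psi>: "\<psi> \<in> dual E" "dual_norm E \<psi> \<le> 1" "1 - \<delta> / 2 \<le> Re (\<psi> e)"
      and e': "e \<in> carrier E" "nrm E e \<le> 1" and x: "x \<in> carrier E"
    obtain f where f: "f \<in> L" "Lnorm q M f = 1" "\<And>\<theta>. \<theta> \<in> {\<phi>, \<psi>} \<Longrightarrow> 1 - \<delta> \<le> Re (\<theta> (Q f))"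
      using normalised_lift[OF e', of "{\<phi>, \<psi>}" \<delta>] \<phi> \<psi> \<delta> by auto
    have f1: "1 - d \<le> Re (\<phi> (Q f))" "1 - d \<le> Re (\<psi> (Q f))"
      using f(3)[of \<phi>] f(3)[of \<psi>] \<delta>(3) by auto
    show "cmod (\<phi> x - \<psi> x) \<le> \<epsilon> * nrm E x"
    proof (rule field_le_epsilon)
      fix r :: real assume r: "0 < r"
      obtain g where g: "g \<in> L" "Q g = x" "Lnorm q M g \<le> nrm E x + r / \<epsilon>"
        using Q_lift[OF x, of "r / \<epsilon>"] r e by auto
      have "cmod (\<phi> x - \<psi> x) \<le> \<epsilon> / 2 * Lnorm q M g + \<epsilon> / 2 * Lnorm q M g"
        using d(2)[OF \<phi>(1,2) f(1,2) f1(1) g(1)] d(2)[OF \<psi>(1,2) f(1,2) f1(2) g(1)]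
          norm_triangle_ineq4[of "\<phi> x - (\<integral>y. duality_map q (f y) * g y \<partial>M)"
            "\<psi> x - (\<integral>y. duality_map q (f y) * g y \<partial>M)"]
        unfolding g(2) by simp
      also have "\<dots> = \<epsilon> * Lnorm q M g" by simp
      also have "\<dots> \<le> \<epsilon> * (nrm E x + r / \<epsilon>)" using g(3) e by (intro mult_left_mono) auto
      also have "\<dots> = \<epsilon> * nrm E x + r" using e by (simp add: distrib_left)
      finally show "cmod (\<phi> x - \<psi> x) \<le> \<epsilon> * nrm E x + r" .
    qed
  qed
qed

text \<open>Approximate Riesz representation on the subspace \<open>L\<close>: the representing function is the duality
  map of a normalised lift of a vector at which the functional nearly attains its norm.\<close>

lemma approximate_Riesz:
  assumes \<phi>: "\<phi> \<in> dual E" and e: "0 < \<epsilon>"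
  obtains b where "b \<in> Lp (conj_exp q) M" "Lnorm (conj_exp q) M b \<le> dual_norm E \<phi>"
    "\<And>g. g \<in> L \<Longrightarrow> cmod (\<phi> (Q g) - (\<integral>x. b x * g x \<partial>M)) \<le> \<epsilon> * Lnorm q M g"
proof -
  have q: "1 < q" by (rule exponent)
  define p where "p = conj_exp q"
  have p: "1 < p" "1 / q + 1 / p = 1" "1 / p + 1 / q = 1"
    using q conj_exp_gt_1 conj_exp_sum conj_exp_sum' unfolding p_def by auto
  have p0: "0 < p" using p by simp
  let ?C = "dual_norm E \<phi>"
  have C0: "0 \<le> ?C" by (rule dual_norm_nonneg[OF \<phi>])
  show thesis
  proof (cases "?C = 0")
    case True
    have "cmod (\<phi> (Q g)) \<le> 0" if "g \<in> L" for g
      using dual_norm_bound[OF \<phi> Q_in[OF that]] True by simp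
    then show thesis
      using that[of "\<lambda>x. 0"] Lp_zero[OF p0, of M] Lnorm_zero[OF p0, of M] True e by (simp add: p_def)
  next
    case False
    then have C: "0 < ?C" using C0 by simp
    have "0 < \<epsilon> / ?C" using e C by simp
    from nearly_represented[OF this] obtain d where d: "0 < d"
      "\<And>\<phi> f g. \<phi> \<in> dual E \<Longrightarrow> dual_norm E \<phi> \<le> 1 \<Longrightarrow> f \<in> L \<Longrightarrow> Lnorm q M f = 1 \<Longrightarrow> 1 - d \<le> Re (\<phi> (Q f)) \<Longrightarrow>
         g \<in> L \<Longrightarrow> cmod (\<phi> (Q g) - (\<integral>x. duality_map q (f x) * g x \<partial>M)) \<le> \<epsilon> / ?C * Lnorm q M g" by blast
    define \<delta> where "\<delta> = min d 1"
    have \<delta>: "0 < \<delta>" "\<delta> \<le> 1" "\<delta> \<le> d" using d(1) by (auto simp: \<delta>_def)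
    define \<psi> where "\<psi> x = complex_of_real (1 / ?C) * \<phi> x" for x
    have \<psi>: "\<psi> \<in> dual E" unfolding \<psi>_def by (rule dual_intro_scale[OF \<phi>])
    have \<psi>1: "dual_norm E \<psi> \<le> 1"
    proof (rule dual_norm_least)
      fix x assume "x \<in> carrier E"
      from dual_norm_bound[OF \<phi> this] have "cmod (\<phi> x) / ?C \<le> nrm E x"
        by (simp only: pos_divide_le_eq[OF C] mult.commute)
      then show "cmod (\<psi> x) \<le> 1 * nrm E x"
        using C by (simp add: \<psi>_def norm_mult norm_divide)
    qed simp
    have "(1 - \<delta> / 2) * ?C < ?C" using C \<delta> by simp
    then obtain x where x: "x \<in> carrier E" "nrm E x \<le> 1" "(1 - \<delta> / 2) * ?C < cmod (\<phi> x)"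
      using dual_norm_attained_nearly[OF \<phi>] by blast
    obtain w where w: "cmod w = 1" "w * \<phi> x = complex_of_real (cmod (\<phi> x))"
      using ex_unit_multiplier by blast
    have "\<psi> (w \<odot> x) = complex_of_real (1 / ?C) * (w * \<phi> x)"
      unfolding \<psi>_def using dual_smult[OF \<phi> x(1), of w] by simp
    then have "Re (\<psi> (w \<odot> x)) = cmod (\<phi> x) / ?C" unfolding w(2) by simp
    moreover have "1 - \<delta> / 2 \<le> cmod (\<phi> x) / ?C" using x(3) by (simp only: pos_le_divide_eq[OF C] less_imp_le)
    ultimately have near: "1 - \<delta> / 2 \<le> Re (\<psi> (w \<odot> x))" by simp
    have wx: "w \<odot> x \<in> carrier E" "nrm E (w \<odot> x) \<le> 1" using x w by (auto simp: nrm_smult)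
    obtain f where f: "f \<in> L" "Lnorm q M f = 1" "1 - \<delta> \<le> Re (\<psi> (Q f))"
      using normalised_lift[OF wx, of "{\<psi>}" \<delta>] \<psi> near \<delta> by auto
    have f3: "1 - d \<le> Re (\<psi> (Q f))" using f(3) \<delta>(3) by simp
    have fL: "f \<in> Lp q M" using f L_subset by auto
    note J = duality_map_Lp[OF q p(1,2) fL]
    have J1: "Lnorm p M (\<lambda>x. duality_map q (f x)) = 1"
      unfolding Lnorm_def J(2) using Lnorm_powr[of q M f] f(2) q by simp
    show thesis
    proof (rule that[of "\<lambda>x. complex_of_real ?C * duality_map q (f x)", folded p_def])
      show "(\<lambda>x. complex_of_real ?C * duality_map q (f x)) \<in> Lp p M" by (rule Lp_scale[OF p0 J(1)])
      show "Lnorm p M (\<lambda>x. complex_of_real ?C * duality_map q (f x)) \<le> ?C"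
        using C0 by (simp add: Lnorm_scale[OF p0] J1)
      fix g assume g: "g \<in> L"
      have "(\<integral>x. complex_of_real ?C * duality_map q (f x) * g x \<partial>M)
          = (\<integral>x. complex_of_real ?C * (duality_map q (f x) * g x) \<partial>M)" by (simp add: mult.assoc)
      then have "(\<integral>x. complex_of_real ?C * duality_map q (f x) * g x \<partial>M)
          = complex_of_real ?C * (\<integral>x. duality_map q (f x) * g x \<partial>M)" by simp
      then have "\<phi> (Q g) - (\<integral>x. complex_of_real ?C * duality_map q (f x) * g x \<partial>M)
         = complex_of_real ?C * (\<psi> (Q g) - (\<integral>x. duality_map q (f x) * g x \<partial>M))"
        using C by (simp add: \<psi>_def right_diff_distrib)
      then have "cmod (\<phi> (Q g) - (\<integral>x. complex_of_real ?C * duality_map q (f x) * g x \<partial>M))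
         = ?C * cmod (\<psi> (Q g) - (\<integral>x. duality_map q (f x) * g x \<partial>M))"
        using C by (simp add: norm_mult)
      also have "\<dots> \<le> ?C * (\<epsilon> / ?C * Lnorm q M g)"
        using d(2)[OF \<psi> \<psi>1 f(1,2) f3 g] C by (intro mult_left_mono) auto
      finally show "cmod (\<phi> (Q g) - (\<integral>x. complex_of_real ?C * duality_map q (f x) * g x \<partial>M)) \<le> \<epsilon> * Lnorm q M g"
        using C by simp
    qed
  qed
qed

end

section \<open>Finite representability in finite-dimensional lq\<close>

text \<open>A value \<open>j\<close> taken on a set of infinite measure has \<open>F j = 0\<close> by integrability, in agreement with
  the value 0 of \<^const>\<open>measure\<close> there.\<close>

lemma integral_by_values:
  fixes F :: "'b \<Rightarrow> complex"
  assumes s: "simple_function M \<tau>" and i: "integrable M (\<lambda>x. F (\<tau> x))"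
  shows "(\<integral>x. F (\<tau> x) \<partial>M)
    = (\<Sum>j\<in>\<tau> ` space M. complex_of_real (measure M (\<tau> -` {j} \<inter> space M)) * F j)"
proof -
  let ?A = "\<lambda>j. \<tau> -` {j} \<inter> space M"
  have fin: "finite (\<tau> ` space M)" and A: "\<And>j. j \<in> \<tau> ` space M \<Longrightarrow> ?A j \<in> sets M"
    using s by (auto simp: simple_function_def)
  have eq: "F (\<tau> x) = (\<Sum>j\<in>\<tau> ` space M. complex_of_real (indicator (?A j) x) * F j)" if x: "x \<in> space M" for x
  proof -
    have "(\<Sum>j\<in>\<tau> ` space M. complex_of_real (indicator (?A j) x) * F j)
       = (\<Sum>j\<in>\<tau> ` space M. if j = \<tau> x then F j else 0)"
      by (rule sum.cong) (use x in \<open>auto simp: indicator_def\<close>)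
    also have "\<dots> = F (\<tau> x)" using fin x by simp
    finally show ?thesis by simp
  qed
  have int: "integrable M (\<lambda>x. complex_of_real (indicator (?A j) x) * F j)" if j: "j \<in> \<tau> ` space M" for j
  proof -
    have "integrable M (\<lambda>x. indicator (?A j) x *\<^sub>R F (\<tau> x))"
      by (rule integrable_mult_indicator[OF A[OF j] i])
    moreover have "(\<lambda>x. indicator (?A j) x *\<^sub>R F (\<tau> x)) = (\<lambda>x. complex_of_real (indicator (?A j) x) * F j)"
      by (auto simp: indicator_def)
    ultimately show ?thesis by simp
  qed
  have "(\<integral>x. F (\<tau> x) \<partial>M) = (\<integral>x. (\<Sum>j\<in>\<tau> ` space M. complex_of_real (indicator (?A j) x) * F j) \<partial>M)"
    by (rule Bochner_Integration.integral_cong[OF refl eq])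
  also have "\<dots> = (\<Sum>j\<in>\<tau> ` space M. \<integral>x. complex_of_real (indicator (?A j) x) * F j \<partial>M)"
    by (rule Bochner_Integration.integral_sum[OF int])
  also have "\<dots> = (\<Sum>j\<in>\<tau> ` space M. complex_of_real (measure M (?A j)) * F j)"
  proof (rule sum.cong[OF refl])
    fix j
    have "(\<integral>x. complex_of_real (indicator (?A j) x) * F j \<partial>M)
        = complex_of_real (\<integral>x. indicator (?A j) x \<partial>M) * F j"
      by (simp only: integral_mult_left_zero integral_complex_of_real)
    then show "(\<integral>x. complex_of_real (indicator (?A j) x) * F j \<partial>M)
        = complex_of_real (measure M (?A j)) * F j"
      by simp
  qed
  finally show ?thesis .
qed

lemma integral_by_values_real:
  fixes F :: "'b \<Rightarrow> real"
  assumes s: "simple_function M \<tau>" and i: "integrable M (\<lambda>x. F (\<tau> x))"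
  shows "(\<integral>x. F (\<tau> x) \<partial>M) = (\<Sum>j\<in>\<tau> ` space M. measure M (\<tau> -` {j} \<inter> space M) * F j)"
proof -
  have "integrable M (\<lambda>x. complex_of_real (F (\<tau> x)))" using i by simp
  from integral_by_values[OF s this]
  have "complex_of_real (\<integral>x. F (\<tau> x) \<partial>M)
      = complex_of_real (\<Sum>j\<in>\<tau> ` space M. measure M (\<tau> -` {j} \<inter> space M) * F j)"
    by simp
  then show ?thesis by (simp only: of_real_eq_iff)
qed

lemma simple_function_family:
  fixes f :: "'i \<Rightarrow> 'm \<Rightarrow> 'b::zero"
  assumes "finite A" "\<And>a. a \<in> A \<Longrightarrow> simple_function M (f a)"
  shows "simple_function M (\<lambda>x a. if a \<in> A then f a x else 0)"
  using assms
proof (induction A rule: finite_induct)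
  case (insert a A)
  have "simple_function M (\<lambda>x. (\<lambda>b. if b \<in> A then f b x else 0)(a := f a x))"
    using insert by (intro simple_function_compose2[where h = "\<lambda>g y. g(a := y)"]) auto
  moreover have "(\<lambda>x. (\<lambda>b. if b \<in> A then f b x else 0)(a := f a x)) = (\<lambda>x b. if b \<in> insert a A then f b x else 0)"
    by (auto simp: fun_eq_iff)
  ultimately show ?case by simp
qed simp

text \<open>Lift the vectors, represent the functionals by the approximate Riesz theorem, and replace all
  these functions by simple ones. The indices \<open>j\<close> are the joint values of the simple functions, and
  the measure of the level set is split as \<open>m\<^sup>1\<^sup>/\<^sup>q m\<^sup>1\<^sup>/\<^sup>p\<close> between the two sides.\<close>

lemma (in QSL_presentation) finite_representability:
  assumes A: "finite A" "A \<subseteq> carrier E" and B: "finite B" "B \<subseteq> dual E" and e: "0 < \<epsilon>"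
  obtains J :: "(('e \<Rightarrow> complex) \<times> (('e \<Rightarrow> complex) \<Rightarrow> complex)) set" and \<alpha> \<beta> where
    "finite J"
    "\<And>x. x \<in> A \<Longrightarrow> (\<Sum>j\<in>J. cmod (\<alpha> x j) powr q) \<le> (nrm E x + \<epsilon>) powr q"
    "\<And>\<phi>. \<phi> \<in> B \<Longrightarrow> (\<Sum>j\<in>J. cmod (\<beta> \<phi> j) powr conj_exp q) \<le> (dual_norm E \<phi> + \<epsilon>) powr conj_exp q"
    "\<And>x \<phi>. x \<in> A \<Longrightarrow> \<phi> \<in> B \<Longrightarrow> cmod (\<phi> x - (\<Sum>j\<in>J. \<alpha> x j * \<beta> \<phi> j)) \<le> \<epsilon>"
proof -
  have q: "1 < q" by (rule exponent)
  define p where "p = conj_exp q"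
  have p: "1 < p" "1 / q + 1 / p = 1" "1 / p + 1 / q = 1"
    using q conj_exp_gt_1 conj_exp_sum conj_exp_sum' unfolding p_def by auto
  have p0: "0 < p" and q0: "0 < q" using p q by auto
  have "\<forall>x\<in>A. \<exists>f. f \<in> L \<and> Q f = x \<and> Lnorm q M f \<le> nrm E x + \<epsilon> / 2"
    using Q_lift[of _ "\<epsilon> / 2"] A(2) e by (metis half_gt_zero subsetD)
  then obtain s where s: "\<And>x. x \<in> A \<Longrightarrow> s x \<in> L" "\<And>x. x \<in> A \<Longrightarrow> Q (s x) = x"
    "\<And>x. x \<in> A \<Longrightarrow> Lnorm q M (s x) \<le> nrm E x + \<epsilon> / 2" by metis
  have sL: "s x \<in> Lp q M" if "x \<in> A" for x using s(1)[OF that] L_subset by auto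
  \<comment> \<open>a common bound of the norms of the lifts, positive so that one may divide by it\<close>
  define K where "K = 1 + (\<Sum>x\<in>A. Lnorm q M (s x))"
  have K: "0 < K" "\<And>x. x \<in> A \<Longrightarrow> Lnorm q M (s x) \<le> K"
  proof -
    have "0 \<le> (\<Sum>x\<in>A. Lnorm q M (s x))" by (simp add: sum_nonneg)
    then show "0 < K" by (simp add: K_def)
    show "Lnorm q M (s x) \<le> K" if "x \<in> A" for x
      using member_le_sum[OF that, of "\<lambda>x. Lnorm q M (s x)"] A(1) by (simp add: K_def)
  qed
  have "\<forall>\<phi>\<in>B. \<exists>b. b \<in> Lp p M \<and> Lnorm p M b \<le> dual_norm E \<phi> \<and>
     (\<forall>g\<in>L. cmod (\<phi> (Q g) - (\<integral>x. b x * g x \<partial>M)) \<le> \<epsilon> / (2 * K) * Lnorm q M g)"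
  proof
    fix \<phi> assume that: "\<phi> \<in> B"
    have "\<phi> \<in> dual E" "0 < \<epsilon> / (2 * K)" using that B(2) e K(1) by auto
    then show "\<exists>b. b \<in> Lp p M \<and> Lnorm p M b \<le> dual_norm E \<phi> \<and>
        (\<forall>g\<in>L. cmod (\<phi> (Q g) - (\<integral>x. b x * g x \<partial>M)) \<le> \<epsilon> / (2 * K) * Lnorm q M g)"
      by (rule approximate_Riesz[folded p_def]) blast
  qed
  from bchoice[OF this] obtain b where "\<forall>\<phi>\<in>B. b \<phi> \<in> Lp p M \<and> Lnorm p M (b \<phi>) \<le> dual_norm E \<phi> \<and>
     (\<forall>g\<in>L. cmod (\<phi> (Q g) - (\<integral>x. b \<phi> x * g x \<partial>M)) \<le> \<epsilon> / (2 * K) * Lnorm q M g)" ..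
  then have b: "\<And>\<phi>. \<phi> \<in> B \<Longrightarrow> b \<phi> \<in> Lp p M" "\<And>\<phi>. \<phi> \<in> B \<Longrightarrow> Lnorm p M (b \<phi>) \<le> dual_norm E \<phi>"
    "\<And>\<phi> g. \<phi> \<in> B \<Longrightarrow> g \<in> L \<Longrightarrow> cmod (\<phi> (Q g) - (\<integral>x. b \<phi> x * g x \<partial>M)) \<le> \<epsilon> / (2 * K) * Lnorm q M g"
    by auto
  have Riesz: "cmod (\<phi> x - (\<integral>t. b \<phi> t * s x t \<partial>M)) \<le> \<epsilon> / 2" if "x \<in> A" "\<phi> \<in> B" for x \<phi>
  proof -
    have "cmod (\<phi> x - (\<integral>t. b \<phi> t * s x t \<partial>M)) \<le> \<epsilon> / (2 * K) * Lnorm q M (s x)"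
      using b(3)[OF that(2) s(1)[OF that(1)]] s(2)[OF that(1)] by simp
    also have "\<dots> \<le> \<epsilon> / (2 * K) * K" using K(1) K(2)[OF that(1)] e by (intro mult_left_mono) auto
    finally show ?thesis using K(1) by simp
  qed
  have approx: "\<exists>u. (\<forall>i::nat. simple_function M (u i) \<and> u i \<in> Lp r M \<and>
       (\<forall>x\<in>space M. cmod (u i x) \<le> 2 * cmod (f x))) \<and>
       (\<forall>x\<in>space M. (\<lambda>i. u i x) \<longlonglongrightarrow> f x) \<and> (\<lambda>i. Lnorm r M (u i)) \<longlonglongrightarrow> Lnorm r M f"
    if "0 < r" "f \<in> Lp r M" for f r
    by (rule Lp_simple_approximation[OF that]) blast
  have "\<forall>x\<in>A. \<exists>u. (\<forall>i::nat. simple_function M (u i) \<and> u i \<in> Lp q M \<and>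
       (\<forall>t\<in>space M. cmod (u i t) \<le> 2 * cmod (s x t))) \<and>
       (\<forall>t\<in>space M. (\<lambda>i. u i t) \<longlonglongrightarrow> s x t) \<and> (\<lambda>i. Lnorm q M (u i)) \<longlonglongrightarrow> Lnorm q M (s x)"
    using approx[OF q0 sL] by blast
  from bchoice[OF this] obtain S where "\<forall>x\<in>A. (\<forall>i::nat. simple_function M (S x i) \<and> S x i \<in> Lp q M \<and>
       (\<forall>t\<in>space M. cmod (S x i t) \<le> 2 * cmod (s x t))) \<and>
       (\<forall>t\<in>space M. (\<lambda>i. S x i t) \<longlonglongrightarrow> s x t) \<and> (\<lambda>i. Lnorm q M (S x i)) \<longlonglongrightarrow> Lnorm q M (s x)" ..
  then have S: "\<And>x i. x \<in> A \<Longrightarrow> simple_function M (S x i)" "\<And>x i. x \<in> A \<Longrightarrow> S x i \<in> Lp q M"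
    "\<And>x i t. x \<in> A \<Longrightarrow> t \<in> space M \<Longrightarrow> cmod (S x i t) \<le> 2 * cmod (s x t)"
    "\<And>x t. x \<in> A \<Longrightarrow> t \<in> space M \<Longrightarrow> (\<lambda>i::nat. S x i t) \<longlonglongrightarrow> s x t"
    "\<And>x. x \<in> A \<Longrightarrow> (\<lambda>i. Lnorm q M (S x i)) \<longlonglongrightarrow> Lnorm q M (s x)"
    by auto
  have "\<forall>\<phi>\<in>B. \<exists>u. (\<forall>i::nat. simple_function M (u i) \<and> u i \<in> Lp p M \<and>
       (\<forall>t\<in>space M. cmod (u i t) \<le> 2 * cmod (b \<phi> t))) \<and>
       (\<forall>t\<in>space M. (\<lambda>i. u i t) \<longlonglongrightarrow> b \<phi> t) \<and> (\<lambda>i. Lnorm p M (u i)) \<longlonglongrightarrow> Lnorm p M (b \<phi>)"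
    using approx[OF p0 b(1)] by blast
  from bchoice[OF this] obtain T where "\<forall>\<phi>\<in>B. (\<forall>i::nat. simple_function M (T \<phi> i) \<and> T \<phi> i \<in> Lp p M \<and>
       (\<forall>t\<in>space M. cmod (T \<phi> i t) \<le> 2 * cmod (b \<phi> t))) \<and>
       (\<forall>t\<in>space M. (\<lambda>i. T \<phi> i t) \<longlonglongrightarrow> b \<phi> t) \<and> (\<lambda>i. Lnorm p M (T \<phi> i)) \<longlonglongrightarrow> Lnorm p M (b \<phi>)" ..
  then have T: "\<And>\<phi> i. \<phi> \<in> B \<Longrightarrow> simple_function M (T \<phi> i)" "\<And>\<phi> i. \<phi> \<in> B \<Longrightarrow> T \<phi> i \<in> Lp p M"
    "\<And>\<phi> i t. \<phi> \<in> B \<Longrightarrow> t \<in> space M \<Longrightarrow> cmod (T \<phi> i t) \<le> 2 * cmod (b \<phi> t)"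
    "\<And>\<phi> t. \<phi> \<in> B \<Longrightarrow> t \<in> space M \<Longrightarrow> (\<lambda>i::nat. T \<phi> i t) \<longlonglongrightarrow> b \<phi> t"
    "\<And>\<phi>. \<phi> \<in> B \<Longrightarrow> (\<lambda>i. Lnorm p M (T \<phi> i)) \<longlonglongrightarrow> Lnorm p M (b \<phi>)"
    by auto
  have prod_lim: "(\<lambda>i. \<integral>t. T \<phi> i t * S x i t \<partial>M) \<longlonglongrightarrow> (\<integral>t. b \<phi> t * s x t \<partial>M)" if "x \<in> A" "\<phi> \<in> B" for x \<phi>
  proof (rule integral_dominated_convergence[where w = "\<lambda>t. 4 * cmod (b \<phi> t * s x t)"])
    show "(\<lambda>t. b \<phi> t * s x t) \<in> borel_measurable M"
      by (intro borel_measurable_times Lp_measurable[OF b(1)] Lp_measurable[OF sL] that)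
    show "(\<lambda>t. T \<phi> i t * S x i t) \<in> borel_measurable M" for i
      by (intro borel_measurable_times Lp_measurable[OF T(2)] Lp_measurable[OF S(2)] that)
    show "integrable M (\<lambda>t. 4 * cmod (b \<phi> t * s x t))"
      using Lp_mult_integrable[OF p(1) q p(3) b(1)[OF that(2)] sL[OF that(1)]] by (intro integrable_mult_right integrable_norm)
    show "AE t in M. (\<lambda>i. T \<phi> i t * S x i t) \<longlonglongrightarrow> b \<phi> t * s x t"
      using T(4)[OF that(2)] S(4)[OF that(1)] by (intro AE_I2 tendsto_mult)
    have "cmod (T \<phi> i t * S x i t) \<le> 4 * cmod (b \<phi> t * s x t)" if "t \<in> space M" for i t
    proof -
      have "cmod (T \<phi> i t) * cmod (S x i t) \<le> (2 * cmod (b \<phi> t)) * (2 * cmod (s x t))"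
        using T(3)[OF \<open>\<phi> \<in> B\<close> that, of i] S(3)[OF \<open>x \<in> A\<close> that, of i] by (intro mult_mono) auto
      then show ?thesis by (simp add: norm_mult)
    qed
    then show "AE t in M. norm (T \<phi> i t * S x i t) \<le> 4 * cmod (b \<phi> t * s x t)" for i by simp
  qed
  have ev1: "\<forall>\<^sub>F i in sequentially. \<forall>x\<in>A. Lnorm q M (S x i) < nrm E x + \<epsilon>"
    using A(1)
  proof (rule eventually_ball_finite, intro ballI)
    fix x assume x: "x \<in> A"
    have "Lnorm q M (s x) < nrm E x + \<epsilon>" using s(3)[OF x] e by simp
    then show "\<forall>\<^sub>F i in sequentially. Lnorm q M (S x i) < nrm E x + \<epsilon>"
      by (rule order_tendstoD(2)[OF S(5)[OF x]])
  qed
  have ev2: "\<forall>\<^sub>F i in sequentially. \<forall>\<phi>\<in>B. Lnorm p M (T \<phi> i) < dual_norm E \<phi> + \<epsilon>"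
    using B(1)
  proof (rule eventually_ball_finite, intro ballI)
    fix \<phi> assume x: "\<phi> \<in> B"
    have "Lnorm p M (b \<phi>) < dual_norm E \<phi> + \<epsilon>" using b(2)[OF x] e by simp
    then show "\<forall>\<^sub>F i in sequentially. Lnorm p M (T \<phi> i) < dual_norm E \<phi> + \<epsilon>"
      by (rule order_tendstoD(2)[OF T(5)[OF x]])
  qed
  have ev3: "\<forall>\<^sub>F i in sequentially. \<forall>x\<in>A. \<forall>\<phi>\<in>B.
      dist (\<integral>t. T \<phi> i t * S x i t \<partial>M) (\<integral>t. b \<phi> t * s x t \<partial>M) < \<epsilon> / 2"
    using e by (intro eventually_ball_finite A(1) B(1) ballI tendstoD[OF prod_lim]) auto
  obtain i where i: "\<And>x. x \<in> A \<Longrightarrow> Lnorm q M (S x i) < nrm E x + \<epsilon>"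
    "\<And>\<phi>. \<phi> \<in> B \<Longrightarrow> Lnorm p M (T \<phi> i) < dual_norm E \<phi> + \<epsilon>"
    "\<And>x \<phi>. x \<in> A \<Longrightarrow> \<phi> \<in> B \<Longrightarrow> dist (\<integral>t. T \<phi> i t * S x i t \<partial>M) (\<integral>t. b \<phi> t * s x t \<partial>M) < \<epsilon> / 2"
    using eventually_happens'[OF sequentially_bot eventually_conj[OF ev1 eventually_conj[OF ev2 ev3]]] by blast
  define \<tau> where "\<tau> t = ((\<lambda>x. if x \<in> A then S x i t else 0), (\<lambda>\<phi>. if \<phi> \<in> B then T \<phi> i t else 0))" for t
  have \<tau>: "simple_function M \<tau>"
    unfolding \<tau>_def[abs_def]
    by (intro simple_function_Pair simple_function_family A B S T)
  define m where "m j = measure M (\<tau> -` {j} \<inter> space M)" for j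
  have m0: "0 \<le> m j" for j by (simp add: m_def)
  define \<alpha> where "\<alpha> x j = complex_of_real (m j powr (1 / q)) * fst j x" for x and j :: "('e \<Rightarrow> complex) \<times> (('e \<Rightarrow> complex) \<Rightarrow> complex)"
  define \<beta> where "\<beta> \<phi> j = complex_of_real (m j powr (1 / p)) * snd j \<phi>" for \<phi> and j :: "('e \<Rightarrow> complex) \<times> (('e \<Rightarrow> complex) \<Rightarrow> complex)"
  show thesis
  proof (rule that[of "\<tau> ` space M" \<alpha> \<beta>, folded p_def])
    show "finite (\<tau> ` space M)" using \<tau> by (simp add: simple_function_def)
    show "(\<Sum>j\<in>\<tau> ` space M. cmod (\<alpha> x j) powr q) \<le> (nrm E x + \<epsilon>) powr q" if x: "x \<in> A" for x
    proof -
      have c: "cmod (\<alpha> x j) powr q = m j * cmod (fst j x) powr q" for j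
        using q0 m0[of j] by (simp add: \<alpha>_def norm_mult powr_mult powr_powr)
      have f: "(\<lambda>t. cmod (fst (\<tau> t) x) powr q) = (\<lambda>t. cmod (S x i t) powr q)" using x by (simp add: \<tau>_def)
      have "integrable M (\<lambda>t. cmod (fst (\<tau> t) x) powr q)" unfolding f by (rule Lp_integrable[OF S(2)[OF x]])
      from integral_by_values_real[OF \<tau> this]
      have "(\<Sum>j\<in>\<tau> ` space M. cmod (\<alpha> x j) powr q) = (\<integral>t. cmod (S x i t) powr q \<partial>M)"
        unfolding f by (simp add: c m_def)
      also have "\<dots> = Lnorm q M (S x i) powr q" by (rule Lnorm_powr[OF q0, symmetric])
      also have "\<dots> \<le> (nrm E x + \<epsilon>) powr q" using i(1)[OF x] q0 by (intro powr_mono2) auto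
      finally show ?thesis .
    qed
    show "(\<Sum>j\<in>\<tau> ` space M. cmod (\<beta> \<phi> j) powr p) \<le> (dual_norm E \<phi> + \<epsilon>) powr p" if \<phi>: "\<phi> \<in> B" for \<phi>
    proof -
      have c: "cmod (\<beta> \<phi> j) powr p = m j * cmod (snd j \<phi>) powr p" for j
        using p0 m0[of j] by (simp add: \<beta>_def norm_mult powr_mult powr_powr)
      have f: "(\<lambda>t. cmod (snd (\<tau> t) \<phi>) powr p) = (\<lambda>t. cmod (T \<phi> i t) powr p)" using \<phi> by (simp add: \<tau>_def)
      have "integrable M (\<lambda>t. cmod (snd (\<tau> t) \<phi>) powr p)" unfolding f by (rule Lp_integrable[OF T(2)[OF \<phi>]])
      from integral_by_values_real[OF \<tau> this]
      have "(\<Sum>j\<in>\<tau> ` space M. cmod (\<beta> \<phi> j) powr p) = (\<integral>t. cmod (T \<phi> i t) powr p \<partial>M)"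
        unfolding f by (simp add: c m_def)
      also have "\<dots> = Lnorm p M (T \<phi> i) powr p" by (rule Lnorm_powr[OF p0, symmetric])
      also have "\<dots> \<le> (dual_norm E \<phi> + \<epsilon>) powr p" using i(2)[OF \<phi>] p0 by (intro powr_mono2) auto
      finally show ?thesis .
    qed
    show "cmod (\<phi> x - (\<Sum>j\<in>\<tau> ` space M. \<alpha> x j * \<beta> \<phi> j)) \<le> \<epsilon>" if x: "x \<in> A" and \<phi>: "\<phi> \<in> B" for x \<phi>
    proof -
      have c: "\<alpha> x j * \<beta> \<phi> j = complex_of_real (m j) * (snd j \<phi> * fst j x)" for j
      proof -
        have "m j powr (1 / q) * m j powr (1 / p) = m j"
          using m0[of j] p(2) by (simp add: powr_add[symmetric])
        then have "complex_of_real (m j powr (1 / q)) * complex_of_real (m j powr (1 / p)) = complex_of_real (m j)"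
          by (simp flip: of_real_mult)
        then show ?thesis by (simp add: \<alpha>_def \<beta>_def ac_simps)
      qed
      have f: "(\<lambda>t. snd (\<tau> t) \<phi> * fst (\<tau> t) x) = (\<lambda>t. T \<phi> i t * S x i t)" using x \<phi> by (simp add: \<tau>_def)
      have "integrable M (\<lambda>t. snd (\<tau> t) \<phi> * fst (\<tau> t) x)"
        unfolding f by (rule Lp_mult_integrable[OF p(1) q p(3) T(2)[OF \<phi>] S(2)[OF x]])
      from integral_by_values[OF \<tau>, where F = "\<lambda>j. snd j \<phi> * fst j x", OF this]
      have "(\<Sum>j\<in>\<tau> ` space M. \<alpha> x j * \<beta> \<phi> j) = (\<integral>t. T \<phi> i t * S x i t \<partial>M)"
        unfolding f by (simp add: c m_def)
      then show ?thesis
        using Riesz[OF x \<phi>] i(3)[OF x \<phi>]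
          norm_triangle_ineq4[of "\<phi> x - (\<integral>t. b \<phi> t * s x t \<partial>M)"
            "(\<integral>t. T \<phi> i t * S x i t \<partial>M) - (\<integral>t. b \<phi> t * s x t \<partial>M)"]
        by (simp add: dist_norm)
    qed
  qed
qed

section \<open>Representations\<close>

locale isometric_representation = complex_normed_space E for E :: "'e cnspace" (structure) +
  fixes \<pi> :: "'g::{topological_group_add, t2_space} \<Rightarrow> 'e \<Rightarrow> 'e"
  assumes rep: "representation E \<pi>"
begin

lemma pi_isometry: "invertible_isometry (\<pi> x) E E"
  using rep by (simp add: representation_def)

lemma pi_in [simp, intro]: "\<xi> \<in> carrier E \<Longrightarrow> \<pi> x \<xi> \<in> carrier E"
  using pi_isometry[of x] by (auto simp: invertible_isometry_def bij_betw_def)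

lemma pi_nrm [simp]: "\<xi> \<in> carrier E \<Longrightarrow> nrm E (\<pi> x \<xi>) = nrm E \<xi>"
  using pi_isometry[of x] by (auto simp: invertible_isometry_def)

lemma pi_add: "\<xi> \<in> carrier E \<Longrightarrow> \<eta> \<in> carrier E \<Longrightarrow> \<pi> x (\<xi> \<oplus> \<eta>) = \<pi> x \<xi> \<oplus> \<pi> x \<eta>"
  using pi_isometry[of x] by (auto simp: invertible_isometry_def)

lemma pi_smult: "\<xi> \<in> carrier E \<Longrightarrow> \<pi> x (c \<odot> \<xi>) = c \<odot> \<pi> x \<xi>"
  using pi_isometry[of x] by (auto simp: invertible_isometry_def)

lemma pi_diff:
  assumes "\<xi> \<in> carrier E" "\<eta> \<in> carrier E"
  shows "\<pi> x (\<xi> \<ominus> \<eta>) = \<pi> x \<xi> \<ominus> \<pi> x \<eta>"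
  using assms by (simp add: a_minus_def pi_add pi_smult smult_minus_1[symmetric])

lemma pi_plus: "\<xi> \<in> carrier E \<Longrightarrow> \<pi> (x + y) \<xi> = \<pi> x (\<pi> y \<xi>)"
  using rep by (simp add: representation_def)

lemma pi_0 [simp]: assumes "\<xi> \<in> carrier E" shows "\<pi> 0 \<xi> = \<xi>"
proof -
  have "\<pi> 0 (\<pi> 0 \<xi>) = \<pi> 0 \<xi>" using pi_plus[OF assms, of 0 0] by simp
  moreover have "inj_on (\<pi> 0) (carrier E)" using pi_isometry[of 0] by (simp add: invertible_isometry_def bij_betw_def)
  ultimately show ?thesis using assms by (meson inj_onD pi_in)
qed

lemma pi_minus [simp]: "\<xi> \<in> carrier E \<Longrightarrow> \<pi> (- x) (\<pi> x \<xi>) = \<xi>"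
  using pi_plus[of \<xi> "- x" x] by simp

lemma pi_minus' [simp]: "\<xi> \<in> carrier E \<Longrightarrow> \<pi> x (\<pi> (- x) \<xi>) = \<xi>"
  using pi_plus[of \<xi> x "- x"] by simp

lemma pi_continuous:
  assumes \<xi>: "\<xi> \<in> carrier E" and e: "0 < \<epsilon>"
  obtains U where "open U" "y \<in> U" "\<And>z. z \<in> U \<Longrightarrow> nrm E (\<pi> z \<xi> \<ominus> \<pi> y \<xi>) < \<epsilon>"
proof -
  let ?B = "{v \<in> carrier E. nrm E (v \<ominus> \<pi> y \<xi>) < \<epsilon>}"
  have "openin (ntopology E) ?B"
    unfolding openin_ntopology
  proof (intro conjI ballI)
    fix x assume "x \<in> ?B"
    then have x: "x \<in> carrier E" "nrm E (x \<ominus> \<pi> y \<xi>) < \<epsilon>" by auto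
    show "\<exists>r>0. \<forall>v\<in>carrier E. nrm E (x \<ominus> v) < r \<longrightarrow> v \<in> ?B"
    proof (intro exI[of _ "\<epsilon> - nrm E (x \<ominus> \<pi> y \<xi>)"] conjI ballI impI)
      fix v assume v: "v \<in> carrier E" "nrm E (x \<ominus> v) < \<epsilon> - nrm E (x \<ominus> \<pi> y \<xi>)"
      have "nrm E (v \<ominus> \<pi> y \<xi>) \<le> nrm E (v \<ominus> x) + nrm E (x \<ominus> \<pi> y \<xi>)"
        by (rule nrm_diff_triangle[OF v(1) x(1) pi_in[OF \<xi>]])
      with v x show "v \<in> ?B" by (simp add: nrm_diff_commute[OF v(1) x(1)])
    qed (use x in simp)
  qed auto
  moreover have "\<forall>U. openin (ntopology E) U \<longrightarrow> open {z. \<pi> z \<xi> \<in> U}"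
    using rep \<xi> by (simp add: representation_def continuous_map_def)
  ultimately have "open {z. \<pi> z \<xi> \<in> ?B}" by blast
  moreover have "y \<in> {z. \<pi> z \<xi> \<in> ?B}" using \<xi> e by simp
  ultimately show thesis by (rule that) auto
qed

lemma dual_pi:
  assumes \<phi>: "\<phi> \<in> dual E"
  shows "(\<lambda>\<xi>. \<phi> (\<pi> x \<xi>)) \<in> dual E" "dual_norm E (\<lambda>\<xi>. \<phi> (\<pi> x \<xi>)) \<le> dual_norm E \<phi>"
proof -
  have b: "cmod (\<phi> (\<pi> x \<xi>)) \<le> dual_norm E \<phi> * nrm E \<xi>" if "\<xi> \<in> carrier E" for \<xi>
    using dual_norm_bound[OF \<phi>, of "\<pi> x \<xi>"] that by simp
  show "(\<lambda>\<xi>. \<phi> (\<pi> x \<xi>)) \<in> dual E"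
    by (rule dualI[OF _ _ b]) (use \<phi> in \<open>auto simp: pi_add pi_smult dual_add dual_smult\<close>)
  show "dual_norm E (\<lambda>\<xi>. \<phi> (\<pi> x \<xi>)) \<le> dual_norm E \<phi>"
    by (rule dual_norm_least[OF b dual_norm_nonneg[OF \<phi>]])
qed

text \<open>Near \<open>y\<close> the functionals \<open>\<phi> \<circ> \<pi>(z)\<close>, whose norms are all bounded by that of \<open>\<phi>\<close>, nearly attain
  this norm at a vector where \<open>\<phi> \<circ> \<pi>(y)\<close> nearly does. Such functionals are close by smoothness.\<close>

lemma dual_orbit_continuous:
  assumes P: "QSL_presentation E q M L Q" and \<phi>: "\<phi> \<in> dual E" and e: "0 < \<epsilon>"
  obtains U where "open U" "y \<in> U"
    "\<And>z \<xi>. z \<in> U \<Longrightarrow> \<xi> \<in> carrier E \<Longrightarrow> cmod (\<phi> (\<pi> z \<xi>) - \<phi> (\<pi> y \<xi>)) \<le> \<epsilon> * nrm E \<xi>"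
proof -
  interpret P: QSL_presentation E q M L Q by (rule P)
  let ?C = "dual_norm E \<phi>"
  have C0: "0 \<le> ?C" by (rule dual_norm_nonneg[OF \<phi>])
  show thesis
  proof (cases "?C = 0")
    case True
    have z: "\<phi> \<xi> = 0" if "\<xi> \<in> carrier E" for \<xi> using dual_norm_bound[OF \<phi> that] True by simp
    show thesis by (rule that[of UNIV]) (use z e nrm_nonneg in auto)
  next
    case False
    then have C: "0 < ?C" using C0 by simp
    have "0 < \<epsilon> / ?C" using e C by simp
    from P.functionals_close[OF this] obtain d where d: "0 < d" "d \<le> 1"
      "\<And>\<phi> \<psi> e x. \<phi> \<in> dual E \<Longrightarrow> \<psi> \<in> dual E \<Longrightarrow> dual_norm E \<phi> \<le> 1 \<Longrightarrow> dual_norm E \<psi> \<le> 1 \<Longrightarrow>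
       e \<in> carrier E \<Longrightarrow> nrm E e \<le> 1 \<Longrightarrow> 1 - d \<le> Re (\<phi> e) \<Longrightarrow> 1 - d \<le> Re (\<psi> e) \<Longrightarrow>
       x \<in> carrier E \<Longrightarrow> cmod (\<phi> x - \<psi> x) \<le> \<epsilon> / ?C * nrm E x" by blast
    define \<psi> where "\<psi> z \<xi> = complex_of_real (1 / ?C) * \<phi> (\<pi> z \<xi>)" for z \<xi>
    have \<psi>: "\<psi> z \<in> dual E" for z unfolding \<psi>_def by (rule dual_intro_scale[OF dual_pi(1)[OF \<phi>]])
    have \<psi>b: "cmod (\<psi> z \<xi>) \<le> 1 * nrm E \<xi>" if "\<xi> \<in> carrier E" for z \<xi>
    proof -
      have "cmod (\<phi> (\<pi> z \<xi>)) \<le> nrm E \<xi> * ?C"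
        using dual_norm_bound[OF \<phi>, of "\<pi> z \<xi>"] that by (simp add: mult.commute)
      then have "cmod (\<phi> (\<pi> z \<xi>)) / ?C \<le> nrm E \<xi>" by (simp only: pos_divide_le_eq[OF C])
      then show ?thesis using C by (simp add: \<psi>_def norm_mult norm_divide)
    qed
    have \<psi>1: "dual_norm E (\<psi> z) \<le> 1" for z by (rule dual_norm_least[OF \<psi>b]) auto
    have "(1 - d / 2) * ?C < ?C" using C d by simp
    then obtain x where x: "x \<in> carrier E" "nrm E x \<le> 1" "(1 - d / 2) * ?C < cmod (\<phi> x)"
      using dual_norm_attained_nearly[OF \<phi>] by blast
    obtain w where w: "cmod w = 1" "w * \<phi> x = complex_of_real (cmod (\<phi> x))"
      using ex_unit_multiplier by blast
    let ?v = "\<pi> (- y) (w \<odot> x)"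
    have v: "?v \<in> carrier E" "nrm E ?v \<le> 1" using x w by (auto simp: nrm_smult)
    have "\<psi> y ?v = complex_of_real (1 / ?C) * (w * \<phi> x)"
      using x by (simp add: \<psi>_def dual_smult[OF \<phi>])
    then have "Re (\<psi> y ?v) = cmod (\<phi> x) / ?C" unfolding w(2) by simp
    moreover have "1 - d / 2 \<le> cmod (\<phi> x) / ?C" using x(3) by (simp only: pos_le_divide_eq[OF C] less_imp_le)
    ultimately have near: "1 - d / 2 \<le> Re (\<psi> y ?v)" by simp
    have d2: "0 < d / 2" using d(1) by simp
    obtain U where U: "open U" "y \<in> U" "\<And>z. z \<in> U \<Longrightarrow> nrm E (\<pi> z ?v \<ominus> \<pi> y ?v) < d / 2"
      using pi_continuous[OF v(1) d2, of y] by blast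
    show thesis
    proof (rule that[OF U(1,2)])
      fix z \<xi> assume z: "z \<in> U" and \<xi>: "\<xi> \<in> carrier E"
      have "cmod (\<psi> z ?v - \<psi> y ?v) \<le> d / 2"
      proof -
        have "\<psi> z ?v - \<psi> y ?v = \<psi> 0 (\<pi> z ?v \<ominus> \<pi> y ?v)"
          using v(1) by (simp add: \<psi>_def dual_diff[OF \<phi>] right_diff_distrib)
        then show ?thesis using \<psi>b[of "\<pi> z ?v \<ominus> \<pi> y ?v" 0] U(3)[OF z] v(1) by simp
      qed
      then have "Re (\<psi> y ?v) - Re (\<psi> z ?v) \<le> d / 2"
        using complex_Re_le_cmod[of "\<psi> y ?v - \<psi> z ?v"] by (simp add: norm_minus_commute)
      then have nz: "1 - d \<le> Re (\<psi> z ?v)" "1 - d \<le> Re (\<psi> y ?v)" using near d(1) by auto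
      have "cmod (\<psi> z \<xi> - \<psi> y \<xi>) \<le> \<epsilon> / ?C * nrm E \<xi>"
        by (rule d(3)[OF \<psi> \<psi> \<psi>1 \<psi>1 v nz \<xi>])
      then have "?C * cmod (\<psi> z \<xi> - \<psi> y \<xi>) \<le> ?C * (\<epsilon> / ?C * nrm E \<xi>)" using C by (intro mult_left_mono) auto
      moreover have "\<phi> (\<pi> z \<xi>) - \<phi> (\<pi> y \<xi>) = complex_of_real ?C * (\<psi> z \<xi> - \<psi> y \<xi>)"
        using C by (simp add: \<psi>_def right_diff_distrib)
      ultimately show "cmod (\<phi> (\<pi> z \<xi>) - \<phi> (\<pi> y \<xi>)) \<le> \<epsilon> * nrm E \<xi>"
        using C by (simp add: norm_mult)
    qed
  qed
qed

end

section \<open>Regularity of Haar measure\<close>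

lemma
  assumes h: "left_haar_measure \<mu>"
  shows haar_compact_finite: "\<And>K. compact K \<Longrightarrow> emeasure \<mu> K < \<infinity>"
    and haar_outer: "\<And>B. B \<in> sets borel \<Longrightarrow> emeasure \<mu> B = (INF U\<in>{U. open U \<and> B \<subseteq> U}. emeasure \<mu> U)"
    and haar_inner: "\<And>U. open U \<Longrightarrow> emeasure \<mu> U = (SUP K\<in>{K. compact K \<and> K \<subseteq> U}. emeasure \<mu> K)"
    and haar_nonzero: "emeasure \<mu> UNIV \<noteq> 0"
proof -
  note H = h[unfolded left_haar_measure_def]
  show "\<And>K. compact K \<Longrightarrow> emeasure \<mu> K < \<infinity>"
    by (rule H[THEN conjunct2, THEN conjunct1, rule_format])
  show "\<And>B. B \<in> sets borel \<Longrightarrow> emeasure \<mu> B = (INF U\<in>{U. open U \<and> B \<subseteq> U}. emeasure \<mu> U)"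
    by (rule H[THEN conjunct2, THEN conjunct2, THEN conjunct1, rule_format])
  show "\<And>U. open U \<Longrightarrow> emeasure \<mu> U = (SUP K\<in>{K. compact K \<and> K \<subseteq> U}. emeasure \<mu> K)"
    by (rule H[THEN conjunct2, THEN conjunct2, THEN conjunct2, THEN conjunct1, rule_format])
  show "emeasure \<mu> UNIV \<noteq> 0"
    by (rule H[THEN conjunct2, THEN conjunct2, THEN conjunct2, THEN conjunct2, THEN conjunct2])
qed

lemma haar_compl_sets: "left_haar_measure \<mu> \<Longrightarrow> A \<in> sets \<mu> \<Longrightarrow> - A \<in> sets \<mu>"
  by (simp add: haar_sets)

text \<open>Enclose \<open>A\<close> in an open set \<open>U\<close> of finite measure, approximate \<open>U\<close> by a compact set from inside, and
  remove from it an open neighbourhood of \<open>U - A\<close> that is only slightly larger than \<open>U - A\<close>.\<close>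

lemma haar_inner_regular:
  fixes \<mu> :: "'g::{topological_group_add, t2_space} measure"
  assumes h: "left_haar_measure \<mu>" and A: "A \<in> sets borel" "emeasure \<mu> A < \<infinity>" and e: "0 < \<epsilon>"
  obtains K where "compact K" "K \<subseteq> A" "measure \<mu> (A - K) < \<epsilon>"
proof -
  have sets: "sets \<mu> = sets borel" by (rule haar_sets[OF h])
  note outer = haar_outer[OF h] and inner = haar_inner[OF h] and compact_finite = haar_compact_finite[OF h]
  have outer_approx: "\<exists>U. open U \<and> B \<subseteq> U \<and> emeasure \<mu> U < \<infinity> \<and> measure \<mu> U < measure \<mu> B + d"
    if B: "B \<in> sets borel" "emeasure \<mu> B < \<infinity>" and d: "0 < d" for B d
  proof -
    have "emeasure \<mu> B = ennreal (measure \<mu> B)" using B(2) by (simp add: emeasure_eq_ennreal_measure)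
    also have "\<dots> < ennreal (measure \<mu> B + d)" using d by (intro ennreal_lessI) (auto intro: add_nonneg_pos)
    finally have "(INF U\<in>{U. open U \<and> B \<subseteq> U}. emeasure \<mu> U) < ennreal (measure \<mu> B + d)"
      by (simp only: outer[OF B(1), symmetric])
    then obtain U where U: "open U" "B \<subseteq> U" "emeasure \<mu> U < ennreal (measure \<mu> B + d)"
      unfolding INF_less_iff by blast
    then have fin: "emeasure \<mu> U < \<infinity>" using ennreal_less_top order.strict_trans by fastforce
    then have "ennreal (measure \<mu> U) < ennreal (measure \<mu> B + d)"
      using U(3) by (simp add: emeasure_eq_ennreal_measure)
    then have "measure \<mu> U < measure \<mu> B + d" by (rule ennreal_less_iff[THEN iffD1, rotated]) simp
    with U fin show ?thesis by blast
  qed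
  obtain U where U: "open U" "A \<subseteq> U" "emeasure \<mu> U < \<infinity>" using outer_approx[OF A, of 1] by auto
  have Ub: "U \<in> sets borel" using U(1) by simp
  have UA: "U - A \<in> sets borel" using Ub A(1) by blast
  have UAf: "emeasure \<mu> (U - A) < \<infinity>"
    using U(3) emeasure_mono[of "U - A" U \<mu>] Ub sets by (auto intro: le_less_trans)
  obtain V where V: "open V" "U - A \<subseteq> V" "emeasure \<mu> V < \<infinity>" "measure \<mu> V < measure \<mu> (U - A) + \<epsilon> / 2"
    using outer_approx[OF UA UAf, of "\<epsilon> / 2"] e by auto
  have "\<exists>K. compact K \<and> K \<subseteq> U \<and> measure \<mu> U - \<epsilon> / 2 < measure \<mu> K"
  proof (cases "measure \<mu> U = 0")
    case True
    then show ?thesis using e by (intro exI[of _ "{}"]) auto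
  next
    case False
    then have pos: "0 < measure \<mu> U" by (simp add: zero_less_measure_iff)
    have "ennreal (measure \<mu> U - \<epsilon> / 2) < ennreal (measure \<mu> U)" using e pos by (intro ennreal_lessI) auto
    also have "\<dots> = emeasure \<mu> U" using U(3) by (simp add: emeasure_eq_ennreal_measure)
    finally have "ennreal (measure \<mu> U - \<epsilon> / 2) < (SUP K\<in>{K. compact K \<and> K \<subseteq> U}. emeasure \<mu> K)"
      by (simp only: inner[OF U(1), symmetric])
    then obtain K where K: "compact K" "K \<subseteq> U" "ennreal (measure \<mu> U - \<epsilon> / 2) < emeasure \<mu> K"
      unfolding less_SUP_iff by blast
    have "emeasure \<mu> K < \<infinity>" by (rule compact_finite[OF K(1)])
    then have "ennreal (measure \<mu> U - \<epsilon> / 2) < ennreal (measure \<mu> K)"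
      using K(3) by (simp add: emeasure_eq_ennreal_measure)
    then have "measure \<mu> U - \<epsilon> / 2 < measure \<mu> K"
      by (meson ennreal_leI not_less)
    with K show ?thesis by blast
  qed
  then obtain K where K: "compact K" "K \<subseteq> U" "measure \<mu> U - \<epsilon> / 2 < measure \<mu> K" by blast
  have Kb: "K \<in> sets borel" using compact_imp_closed[OF K(1)] by simp
  have Kf: "emeasure \<mu> K < \<infinity>" by (rule compact_finite[OF K(1)])
  have fm: "U \<in> fmeasurable \<mu>" "V \<in> fmeasurable \<mu>" "K \<in> fmeasurable \<mu>" "U - A \<in> fmeasurable \<mu>"
    using U(3) V(1,3) Ub Kb Kf UA UAf sets by (auto simp: fmeasurable_def)
  show thesis
  proof (rule that[of "K - V"])
    show "compact (K - V)" using K(1) V(1) by (simp add: compact_diff)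
    show "K - V \<subseteq> A" using K(2) V(2) by blast
    have "A - (K - V) \<subseteq> (U - K) \<union> (V - (U - A))" using U(2) by blast
    moreover have fm2: "U - K \<in> fmeasurable \<mu>" "V - (U - A) \<in> fmeasurable \<mu>"
      using fm by (auto intro: fmeasurable_Diff simp: fmeasurableD)
    moreover have "A - (K - V) \<in> sets \<mu>" using A(1) Kb V(1) sets by auto
    ultimately have "measure \<mu> (A - (K - V)) \<le> measure \<mu> ((U - K) \<union> (V - (U - A)))"
      by (intro measure_mono_fmeasurable) (auto intro: fmeasurable.Un)
    also have "\<dots> \<le> measure \<mu> (U - K) + measure \<mu> (V - (U - A))"
      using fm2 by (intro measure_Un_le) (auto simp: fmeasurableD)
    also have "measure \<mu> (U - K) = measure \<mu> U - measure \<mu> K"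
      using fm K(2) by (intro measure_Diff) (auto simp: fmeasurable_def)
    also have "measure \<mu> (V - (U - A)) = measure \<mu> V - measure \<mu> (U - A)"
      using fm V(2) by (intro measure_Diff) (auto simp: fmeasurable_def)
    finally show "measure \<mu> (A - (K - V)) < \<epsilon>" using K(3) V(4) by simp
  qed
qed

text \<open>First restrict to a set where the function is bounded above and away from zero. Such a set has finite
  measure, so inner regularity applies to it, and the upper bound controls what inner regularity leaves out.\<close>

lemma haar_integral_outside_compact:
  fixes \<mu> :: "'g::{topological_group_add, t2_space} measure" and w :: "'g \<Rightarrow> real"
  assumes h: "left_haar_measure \<mu>" and w: "integrable \<mu> w" "\<And>x. 0 \<le> w x" and d: "0 < \<delta>"
  obtains K where "compact K" "(\<integral>x. indicator (- K) x * w x \<partial>\<mu>) < \<delta>"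
proof -
  have sets: "sets \<mu> = sets borel" and space: "space \<mu> = UNIV" by (rule haar_sets[OF h], rule haar_space[OF h])
  have wm[measurable]: "w \<in> borel_measurable \<mu>" using w(1) by simp
  define A where "A n = {x. 1 / (real n + 1) \<le> w x \<and> w x \<le> real n + 1}" for n
  have As: "A n \<in> sets \<mu>" for n
  proof -
    have "{x \<in> space \<mu>. 1 / (real n + 1) \<le> w x \<and> w x \<le> real n + 1} \<in> sets \<mu>" by measurable
    then show ?thesis by (simp add: A_def space)
  qed
  have Af: "emeasure \<mu> (A n) < \<infinity>" for n
  proof -
    have "integrable \<mu> (indicator (A n) :: 'g \<Rightarrow> real)"
    proof (rule Bochner_Integration.integrable_bound)
      show "integrable \<mu> (\<lambda>x. (real n + 1) * w x)" using w(1) by simp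
      show "indicator (A n) \<in> borel_measurable \<mu>" using As by simp
      have "indicator (A n) x \<le> (real n + 1) * w x" for x
        using w(2)[of x] by (auto simp: A_def indicator_def divide_simps mult.commute)
      then show "AE x in \<mu>. norm (indicator (A n) x :: real) \<le> norm ((real n + 1) * w x)"
        using w(2) by (simp add: abs_mult)
    qed
    then show ?thesis using As by (simp add: integrable_indicator_iff space less_top)
  qed
  have "(\<lambda>n. \<integral>x. indicator (- A n) x * w x \<partial>\<mu>) \<longlonglongrightarrow> (\<integral>x. 0 \<partial>\<mu>)"
  proof (rule integral_dominated_convergence[where w = w])
    show "(\<lambda>x. indicator (- A n) x * w x) \<in> borel_measurable \<mu>" for n
      by (intro borel_measurable_times borel_measurable_indicator haar_compl_sets[OF h As] wm)
    show "AE x in \<mu>. norm (indicator (- A n) x * w x) \<le> w x" for n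
      using w(2) by (auto simp: indicator_def)
    show "AE x in \<mu>. (\<lambda>n. indicator (- A n) x * w x) \<longlonglongrightarrow> 0"
    proof (rule AE_I2)
      fix x
      show "(\<lambda>n. indicator (- A n) x * w x) \<longlonglongrightarrow> 0"
      proof (cases "w x = 0")
        case False
        then have pos: "0 < w x" using w(2)[of x] by simp
        have "\<forall>\<^sub>F n in sequentially. x \<in> A n"
        proof (rule eventually_sequentiallyI)
          fix n assume n: "nat \<lceil>max (w x) (1 / w x)\<rceil> \<le> n"
          have "max (w x) (1 / w x) \<le> real n" using n by linarith
          then have "w x \<le> real n + 1" "1 / w x \<le> real n + 1" by auto
          then show "x \<in> A n" using pos by (auto simp: A_def divide_simps mult.commute)
        qed
        then have "\<forall>\<^sub>F n in sequentially. indicator (- A n) x * w x = 0"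
          by eventually_elim simp
        then show ?thesis by (rule tendsto_eventually)
      qed simp
    qed
  qed (use w(1) in auto)
  then have "(\<lambda>n. \<integral>x. indicator (- A n) x * w x \<partial>\<mu>) \<longlonglongrightarrow> 0" by simp
  then have "\<forall>\<^sub>F n in sequentially. (\<integral>x. indicator (- A n) x * w x \<partial>\<mu>) < \<delta> / 2"
    using d by (intro order_tendstoD) auto
  then obtain n where n: "(\<integral>x. indicator (- A n) x * w x \<partial>\<mu>) < \<delta> / 2"
    using eventually_happens'[OF sequentially_bot] by blast
  have Ab: "A n \<in> sets borel" using As sets by simp
  have "0 < \<delta> / (2 * (real n + 1))" using d by simp
  then obtain K where K: "compact K" "K \<subseteq> A n" "measure \<mu> (A n - K) < \<delta> / (2 * (real n + 1))"
    using haar_inner_regular[OF h Ab Af] by blast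
  have Kb: "K \<in> sets \<mu>" using compact_imp_closed[OF K(1)] sets by simp
  have i1: "integrable \<mu> (\<lambda>x. indicator (- A n) x * w x)"
    using integrable_mult_indicator[OF haar_compl_sets[OF h As] w(1), of n] by simp
  have AK: "A n - K \<in> sets \<mu>" using As Kb by blast
  have "emeasure \<mu> (A n - K) < \<infinity>"
    using Af[of n] emeasure_mono[of "A n - K" "A n" \<mu>] As by (auto intro: le_less_trans)
  then have i2: "integrable \<mu> (\<lambda>x. (real n + 1) * indicator (A n - K) x)"
    using AK by (intro integrable_mult_right) (simp add: integrable_indicator_iff space less_top)
  have i3: "integrable \<mu> (\<lambda>x. indicator (- K) x * w x)"
    using integrable_mult_indicator[OF haar_compl_sets[OF h Kb] w(1)] by simp
  have "(\<integral>x. indicator (- K) x * w x \<partial>\<mu>)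
      \<le> (\<integral>x. indicator (- A n) x * w x + (real n + 1) * indicator (A n - K) x \<partial>\<mu>)"
    by (rule integral_mono[OF i3 Bochner_Integration.integrable_add[OF i1 i2]])
       (use w(2) K(2) in \<open>auto simp: indicator_def A_def\<close>)
  also have "\<dots> = (\<integral>x. indicator (- A n) x * w x \<partial>\<mu>) + (real n + 1) * measure \<mu> (A n - K)"
    using i1 i2 AK space by (simp add: Bochner_Integration.integral_add[OF i1 i2])
  also have "(real n + 1) * measure \<mu> (A n - K) \<le> (real n + 1) * (\<delta> / (2 * (real n + 1)))"
    using K(3) by (intro mult_left_mono) auto
  also have "\<dots> = \<delta> / 2" by (simp add: divide_simps)
  finally have "(\<integral>x. indicator (- K) x * w x \<partial>\<mu>) < \<delta>" using n by simp
  with K(1) show thesis by (rule that)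
qed

definition cutoff :: "'g set \<Rightarrow> ('g \<Rightarrow> complex) \<Rightarrow> 'g \<Rightarrow> complex" where
  "cutoff K f = (\<lambda>x. if x \<in> K then f x else 0)"

lemma cutoff_Lp:
  assumes p: "0 < p" and f: "f \<in> Lp p M" and K: "K \<inter> space M \<in> sets M"
  shows "cutoff K f \<in> Lp p M" "Lnorm p M (cutoff K f) \<le> Lnorm p M f"
proof -
  have m: "cutoff K f \<in> borel_measurable M"
    unfolding cutoff_def using Lp_measurable[OF f] K
    by (intro measurable_If_set) auto
  show "cutoff K f \<in> Lp p M" by (rule Lp_dominated[OF p f m, of 1]) (auto simp: cutoff_def)
  show "Lnorm p M (cutoff K f) \<le> Lnorm p M f" by (rule Lnorm_mono[OF p f m]) (auto simp: cutoff_def)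
qed

lemma haar_compact_sets:
  fixes \<mu> :: "'g::{topological_group_add, t2_space} measure"
  assumes "left_haar_measure \<mu>" "compact K" shows "K \<in> sets \<mu>"
  using compact_imp_closed[OF assms(2)] haar_sets[OF assms(1)] by simp

lemma Lp_outside_compact:
  fixes \<mu> :: "'g::{topological_group_add, t2_space} measure"
  assumes h: "left_haar_measure \<mu>" and p: "0 < p" and f: "f \<in> Lp p \<mu>" and d: "0 < \<delta>"
  obtains K where "compact K" "Lnorm p \<mu> (cutoff (- K) f) \<le> \<delta>"
proof -
  have "0 < \<delta> powr p" using d by simp
  from haar_integral_outside_compact[OF h Lp_integrable[OF f] _ this]
  obtain K where K: "compact K" "(\<integral>x. indicator (- K) x * cmod (f x) powr p \<partial>\<mu>) < \<delta> powr p" by auto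
  have "indicator (- K) x * cmod (f x) powr p = cmod (cutoff (- K) f x) powr p" for x
    by (simp add: cutoff_def indicator_def)
  then have "Lnorm p \<mu> (cutoff (- K) f) powr p < \<delta> powr p"
    using K(2) by (simp add: Lnorm_powr[OF p])
  then have "Lnorm p \<mu> (cutoff (- K) f) \<le> \<delta>"
    using powr_mono2[of p \<delta> "Lnorm p \<mu> (cutoff (- K) f)"] p d by linarith
  with K(1) show thesis by (rule that)
qed

text \<open>Finite unions of the compact sets for the two functions make the sequence increasing.\<close>

lemma compact_exhaustion:
  fixes \<mu> :: "'g::{topological_group_add, t2_space} measure" and \<delta> :: "nat \<Rightarrow> real"
  assumes h: "left_haar_measure \<mu>" and p: "0 < p" "f \<in> Lp p \<mu>" and r: "0 < r" "g \<in> Lp r \<mu>"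
    and d: "\<And>n. 0 < \<delta> n"
  obtains K where "\<And>n. compact (K n)" "\<And>n. K n \<subseteq> K (Suc n)"
    "\<And>n. Lnorm p \<mu> (cutoff (- K n) f) \<le> \<delta> n" "\<And>n. Lnorm r \<mu> (cutoff (- K n) g) \<le> \<delta> n"
proof -
  have "\<exists>K. compact K \<and> Lnorm p \<mu> (cutoff (- K) f) \<le> \<delta> n" for n
    using Lp_outside_compact[OF h p d] by metis
  then obtain A where A: "\<And>n. compact (A n)" "\<And>n. Lnorm p \<mu> (cutoff (- A n) f) \<le> \<delta> n" by metis
  have "\<exists>K. compact K \<and> Lnorm r \<mu> (cutoff (- K) g) \<le> \<delta> n" for n
    using Lp_outside_compact[OF h r d] by metis
  then obtain B where B: "\<And>n. compact (B n)" "\<And>n. Lnorm r \<mu> (cutoff (- B n) g) \<le> \<delta> n" by metis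
  define K where "K n = (\<Union>m\<le>n. A m \<union> B m)" for n
  have Kc: "compact (K n)" for n
    unfolding K_def using A B by (intro compact_UN) auto
  have anti: "Lnorm s \<mu> (cutoff (- K n) k) \<le> Lnorm s \<mu> (cutoff (- C) k)"
    if "compact C" "C \<subseteq> K n" "0 < s" "k \<in> Lp s \<mu>" for C n s k
  proof (rule Lnorm_mono[OF that(3)])
    show "cutoff (- C) k \<in> Lp s \<mu>"
      using haar_compl_sets[OF h haar_compact_sets[OF h that(1)]] haar_space[OF h] that
      by (intro cutoff_Lp) auto
    show "cutoff (- K n) k \<in> borel_measurable \<mu>"
      using haar_compl_sets[OF h haar_compact_sets[OF h Kc]] haar_space[OF h]
      by (intro Lp_measurable[OF cutoff_Lp(1)[OF that(3,4)]]) auto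
    show "cmod (cutoff (- K n) k x) \<le> cmod (cutoff (- C) k x)" for x
      using that(2) by (auto simp: cutoff_def)
  qed
  show thesis
  proof (rule that[of K, OF Kc])
    show "K n \<subseteq> K (Suc n)" for n unfolding K_def by (intro UN_mono) auto
    show "Lnorm p \<mu> (cutoff (- K n) f) \<le> \<delta> n" for n
      using anti[OF A(1) _ p, of n n] A(2)[of n] by (fastforce simp: K_def)
    show "Lnorm r \<mu> (cutoff (- K n) g) \<le> \<delta> n" for n
      using anti[OF B(1) _ r, of n n] B(2)[of n] by (fastforce simp: K_def)
  qed
qed

lemma exhaustion_AE:
  assumes h: "left_haar_measure (\<mu> :: 'g::{topological_group_add, t2_space} measure)"
    and p: "0 < p" and f: "f \<in> Lp p \<mu>" and K: "\<And>n::nat. compact (K n)"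
    and le: "\<And>n. Lnorm p \<mu> (cutoff (- K n) f) \<le> \<delta> n" and d: "\<delta> \<longlonglongrightarrow> 0"
  shows "AE x in \<mu>. f x = 0 \<or> (\<exists>n. x \<in> K n)"
proof -
  have Ks: "K n \<in> sets \<mu>" for n by (rule haar_compact_sets[OF h K])
  let ?U = "\<Union>n. K n"
  have Us: "?U \<in> sets \<mu>" using Ks by auto
  have U: "cutoff (- ?U) f \<in> Lp p \<mu>"
    using haar_compl_sets[OF h Us] haar_space[OF h]
    by (intro cutoff_Lp[OF p f]) auto
  have "Lnorm p \<mu> (cutoff (- ?U) f) \<le> \<delta> n" for n
  proof -
    have "cutoff (- K n) f \<in> Lp p \<mu>"
      using haar_compl_sets[OF h Ks[of n]] haar_space[OF h] by (intro cutoff_Lp[OF p f]) auto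
    then have "Lnorm p \<mu> (cutoff (- ?U) f) \<le> Lnorm p \<mu> (cutoff (- K n) f)"
      by (rule Lnorm_mono[OF p _ Lp_measurable[OF U]]) (auto simp: cutoff_def)
    with le show ?thesis using order_trans by blast
  qed
  then have "Lnorm p \<mu> (cutoff (- ?U) f) \<le> 0" by (intro LIMSEQ_le_const[OF d]) auto
  then have "Lnorm p \<mu> (cutoff (- ?U) f) = 0" using Lnorm_nonneg[of p \<mu> "cutoff (- ?U) f"] by linarith
  then have "AE x in \<mu>. cutoff (- ?U) f x = 0" using Lnorm_eq_0_iff[OF p U] by simp
  then show ?thesis by (auto simp: cutoff_def split: if_splits)
qed

text \<open>Finitely many of the neighbourhoods on which the relation holds cover the compact set; the selector
  sends a point to the centre of one that contains it.\<close>

lemma measurable_selector: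
  fixes K :: "'g::topological_space set"
  assumes K: "compact K" and R: "\<And>y. \<exists>U. open U \<and> y \<in> U \<and> (\<forall>z\<in>U. R y z)"
  obtains \<sigma> :: "'g \<Rightarrow> 'g" where "simple_function borel \<sigma>" "\<And>z. z \<in> K \<Longrightarrow> R (\<sigma> z) z"
proof -
  from R obtain U where U: "\<And>y. open (U y)" "\<And>y. y \<in> U y" "\<And>y z. z \<in> U y \<Longrightarrow> R y z" by metis
  obtain D where D: "D \<subseteq> K" "finite D" "K \<subseteq> (\<Union>y\<in>D. U y)"
    using compactE_image[OF K, of K U] U by blast
  have "\<exists>\<sigma>. simple_function borel \<sigma> \<and> (\<forall>z\<in>(\<Union>y\<in>D. U y). R (\<sigma> z) z)"
    using D(2)
  proof (induction D rule: finite_induct)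
    case empty
    show ?case by (intro exI[of _ "\<lambda>_. undefined"]) simp
  next
    case (insert y D)
    then obtain \<sigma> where \<sigma>: "simple_function borel \<sigma>" "\<forall>z\<in>(\<Union>y\<in>D. U y). R (\<sigma> z) z" by blast
    have "simple_function borel (\<lambda>z. if z \<in> U y then y else \<sigma> z)"
      using \<sigma>(1) U(1)[of y] by (intro simple_function_If_set) auto
    then show ?case using \<sigma>(2) U(3) by (intro exI[of _ "\<lambda>z. if z \<in> U y then y else \<sigma> z"]) auto
  qed
  then obtain \<sigma> where \<sigma>: "simple_function borel \<sigma>" "\<forall>z\<in>(\<Union>y\<in>D. U y). R (\<sigma> z) z" by blast
  show thesis by (rule that[OF \<sigma>(1)]) (use \<sigma>(2) D(3) in auto)
qed

section \<open>Vector-valued coefficients\<close>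

lemma simple_bounded:
  fixes s :: "'a \<Rightarrow> complex"
  assumes "simple_function M s" "space M = UNIV"
  obtains c where "0 \<le> c" "\<And>x. cmod (s x) \<le> c"
proof -
  have fin: "finite (s ` UNIV)" using assms by (simp add: simple_function_def)
  have "cmod (s x) \<le> (\<Sum>z\<in>s ` UNIV. cmod z)" for x
    by (rule member_le_sum[of "s x" _ cmod]) (use fin in auto)
  then show thesis by (intro that[of "\<Sum>z\<in>s ` UNIV. cmod z"]) (auto intro: sum_nonneg)
qed

lemma Lp_mult_simple:
  assumes p: "0 < p" and f: "f \<in> Lp p M" and s: "simple_function M s" and "space M = UNIV"
  shows "(\<lambda>x. f x * s x) \<in> Lp p M"
proof -
  obtain c where c: "0 \<le> c" "\<And>x. cmod (s x) \<le> c" using simple_bounded[OF s assms(4)] by blast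
  show ?thesis
  proof (rule Lp_dominated[OF p f _ c(1)])
    show "(\<lambda>x. f x * s x) \<in> borel_measurable M"
      using Lp_measurable[OF f] borel_measurable_simple_function[OF s] by (rule borel_measurable_times)
    show "cmod (f x * s x) \<le> c * cmod (f x)" for x
      using mult_right_mono[OF c(2)[of x], of "cmod (f x)"] by (simp add: norm_mult mult.commute)
  qed
qed

definition vector_coefficient ::
  "'g::topological_group_add measure \<Rightarrow> ('g \<Rightarrow> complex) \<Rightarrow> ('g \<Rightarrow> 'e) \<Rightarrow> ('g \<Rightarrow> complex) \<Rightarrow>
   ('g \<Rightarrow> 'e \<Rightarrow> complex) \<Rightarrow> 'g \<Rightarrow> complex" where
  "vector_coefficient \<mu> \<eta> u \<psi> v x = (\<integral>y. left_regular x \<eta> y * \<psi> y * v y (u (- x + y)) \<partial>\<mu>)"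

lemma vector_coefficient_integrable:
  assumes h: "left_haar_measure (\<mu> :: 'g::topological_group_add measure)" and p: "1 < p"
    and L: "\<eta> \<in> Lp (conj_exp p) \<mu>" "\<psi> \<in> Lp p \<mu>"
    and u: "simple_function \<mu> u" and v: "simple_function \<mu> v"
  shows "integrable \<mu> (\<lambda>y. left_regular x \<eta> y * \<psi> y * v y (u (- x + y)))"
proof -
  have sp: "space \<mu> = UNIV" by (rule haar_space[OF h])
  have "simple_function \<mu> (\<lambda>y. u (- x + y))"
    by (rule simple_function_comp[OF haar_translation_measurable[OF h] u])
  then have s: "simple_function \<mu> (\<lambda>y. v y (u (- x + y)))"
    using simple_function_compose2[OF v, of _ "\<lambda>\<phi> e. \<phi> e"] by blast
  obtain c where c: "0 \<le> c" "\<And>y. cmod (v y (u (- x + y))) \<le> c" using simple_bounded[OF s sp] by blast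
  note i = coefficient_integrable[OF h p L, of x]
  show ?thesis
  proof (rule Bochner_Integration.integrable_bound)
    show "integrable \<mu> (\<lambda>y. complex_of_real c * (left_regular x \<eta> y * \<psi> y))" using i by simp
    show "(\<lambda>y. left_regular x \<eta> y * \<psi> y * v y (u (- x + y))) \<in> borel_measurable \<mu>"
      using borel_measurable_integrable[OF i] borel_measurable_simple_function[OF s]
      by (rule borel_measurable_times)
    show "AE y in \<mu>. norm (left_regular x \<eta> y * \<psi> y * v y (u (- x + y)))
        \<le> norm (complex_of_real c * (left_regular x \<eta> y * \<psi> y))"
    proof (rule AE_I2)
      fix y
      show "norm (left_regular x \<eta> y * \<psi> y * v y (u (- x + y)))
        \<le> norm (complex_of_real c * (left_regular x \<eta> y * \<psi> y))"
        using mult_left_mono[OF c(2)[of y], of "cmod (left_regular x \<eta> y * \<psi> y)"] c(1)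
        by (simp add: norm_mult ac_simps)
    qed
  qed
qed

text \<open>For \<open>E\<close> replaced by \<open>l\<^sub>q(J)\<close> the vector-valued coefficient is a sum over \<open>J\<close> of scalar ones,
  and Hoelder's inequality for sums bounds it; the general case follows by finite representability,
  because only finitely many vectors and functionals occur.\<close>

lemma vector_coefficient_bounded:
  fixes \<mu> :: "'g::topological_group_add measure" and E :: "'e cnspace"
  assumes h: "left_haar_measure \<mu>" and p: "1 < p"
    and P: "QSL_presentation E (conj_exp p) M L Q"
    and \<eta>: "\<eta> \<in> Lp (conj_exp p) \<mu>" and \<psi>: "\<psi> \<in> Lp p \<mu>"
    and u: "simple_function \<mu> u" "\<And>z. u z \<in> carrier E" and v: "simple_function \<mu> v" "\<And>z. v z \<in> dual E"
    and a: "0 \<le> a" "\<And>z. \<eta> z \<noteq> 0 \<Longrightarrow> nrm E (u z) \<le> a"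
    and b: "0 \<le> b" "\<And>z. \<psi> z \<noteq> 0 \<Longrightarrow> dual_norm E (v z) \<le> b"
  shows "Ap_bounded \<mu> p (vector_coefficient \<mu> \<eta> u \<psi> v) (Lnorm (conj_exp p) \<mu> \<eta> * Lnorm p \<mu> \<psi> * (a * b))"
proof -
  interpret P: QSL_presentation E "conj_exp p" M L Q by (rule P)
  define q where "q = conj_exp p"
  have q: "1 < q" "1 / q + 1 / p = 1" using conj_exp_gt_1[OF p] conj_exp_sum'[OF p] by (auto simp: q_def)
  have q0: "0 < q" and p0: "0 < p" using q p by auto
  have cq: "conj_exp (conj_exp p) = p" by (rule conj_exp_involutive[OF p])
  have sp: "space \<mu> = UNIV" by (rule haar_space[OF h])
  let ?A = "range u" and ?B = "range v"
  have A: "finite ?A" "?A \<subseteq> carrier E" and B: "finite ?B" "?B \<subseteq> dual E"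
    using u v sp by (auto simp: simple_function_def)
  let ?n = "Lnorm q \<mu> \<eta>" and ?m = "Lnorm p \<mu> \<psi>"
  define N where "N = real (card (?A \<times> ?B))"
  have main: "Ap_bounded \<mu> p (vector_coefficient \<mu> \<eta> u \<psi> v)
      (((a + \<epsilon>) * ?n) * ((b + \<epsilon>) * ?m) + N * (\<epsilon> * ?n * ?m))" if e: "0 < \<epsilon>" for \<epsilon>
  proof -
    obtain J :: "(('e \<Rightarrow> complex) \<times> (('e \<Rightarrow> complex) \<Rightarrow> complex)) set" and \<alpha> \<beta> where J: "finite J"
      and \<alpha>: "\<And>x. x \<in> ?A \<Longrightarrow> (\<Sum>j\<in>J. cmod (\<alpha> x j) powr q) \<le> (nrm E x + \<epsilon>) powr q"
      and \<beta>: "\<And>\<phi>. \<phi> \<in> ?B \<Longrightarrow> (\<Sum>j\<in>J. cmod (\<beta> \<phi> j) powr p) \<le> (dual_norm E \<phi> + \<epsilon>) powr p"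
      and \<alpha>\<beta>: "\<And>x \<phi>. x \<in> ?A \<Longrightarrow> \<phi> \<in> ?B \<Longrightarrow> cmod (\<phi> x - (\<Sum>j\<in>J. \<alpha> x j * \<beta> \<phi> j)) \<le> \<epsilon>"
      using P.finite_representability[OF A B e, unfolded cq, folded q_def] by blast
    define H where "H j z = \<eta> z * \<alpha> (u z) j" for j z
    define S where "S j z = \<psi> z * \<beta> (v z) j" for j z
    have H: "H j \<in> Lp q \<mu>" for j
      unfolding H_def using \<eta> by (intro Lp_mult_simple q0 sp simple_function_compose1[OF u(1)]) (simp add: q_def)
    have S: "S j \<in> Lp p \<mu>" for j
      unfolding S_def using \<psi> by (intro Lp_mult_simple p0 sp simple_function_compose1[OF v(1)])
    define r where "r k = snd k (fst k) - (\<Sum>j\<in>J. \<alpha> (fst k) j * \<beta> (snd k) j)" for k :: "'e \<times> ('e \<Rightarrow> complex)"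
    define H' where "H' k z = \<eta> z * (r k * of_bool (u z = fst k))" for k z
    define S' where "S' k z = \<psi> z * of_bool (v z = snd k)" for k :: "'e \<times> ('e \<Rightarrow> complex)" and z
    have H': "H' k \<in> Lp q \<mu>" for k
      unfolding H'_def using \<eta> by (intro Lp_mult_simple q0 sp simple_function_compose1[OF u(1)]) (simp add: q_def)
    have S': "S' k \<in> Lp p \<mu>" for k
      unfolding S'_def using \<psi> by (intro Lp_mult_simple p0 sp simple_function_compose1[OF v(1)])
    have split: "vector_coefficient \<mu> \<eta> u \<psi> v
      = (\<lambda>x. (\<Sum>j\<in>J. coefficient \<mu> (H j) (S j) x) + (\<Sum>k\<in>?A \<times> ?B. coefficient \<mu> (H' k) (S' k) x))"
    proof
      fix x
      have pt: "left_regular x \<eta> y * \<psi> y * v y (u (- x + y))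
         = (\<Sum>j\<in>J. left_regular x (H j) y * S j y) + (\<Sum>k\<in>?A \<times> ?B. left_regular x (H' k) y * S' k y)" for y
      proof -
        let ?k = "(u (- x + y), v y)"
        have "(\<Sum>k\<in>?A \<times> ?B. left_regular x (H' k) y * S' k y)
          = (\<Sum>k\<in>?A \<times> ?B. if k = ?k then left_regular x \<eta> y * \<psi> y * r k else 0)"
          by (rule sum.cong) (auto simp: H'_def S'_def left_regular_def)
        also have "\<dots> = left_regular x \<eta> y * \<psi> y * r ?k" using A B by simp
        finally have 1: "(\<Sum>k\<in>?A \<times> ?B. left_regular x (H' k) y * S' k y) = left_regular x \<eta> y * \<psi> y * r ?k" .
        have 2: "(\<Sum>j\<in>J. left_regular x (H j) y * S j y)
          = left_regular x \<eta> y * \<psi> y * (\<Sum>j\<in>J. \<alpha> (u (- x + y)) j * \<beta> (v y) j)"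
          by (simp add: H_def S_def left_regular_def sum_distrib_left ac_simps)
        show ?thesis unfolding 1 2 by (simp add: r_def algebra_simps)
      qed
      note i = coefficient_integrable[OF h p, folded q_def]
      show "vector_coefficient \<mu> \<eta> u \<psi> v x
        = (\<Sum>j\<in>J. coefficient \<mu> (H j) (S j) x) + (\<Sum>k\<in>?A \<times> ?B. coefficient \<mu> (H' k) (S' k) x)"
        unfolding vector_coefficient_def pt coefficient_def
        using i[OF H S] i[OF H' S']
        by (simp add: Bochner_Integration.integral_add Bochner_Integration.integrable_sum
            Bochner_Integration.integral_sum)
    qed
    have 1: "Ap_bounded \<mu> p (\<lambda>x. \<Sum>j\<in>J. coefficient \<mu> (H j) (S j) x) (\<Sum>j\<in>J. Lnorm q \<mu> (H j) * Lnorm p \<mu> (S j))"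
      unfolding q_def using H S by (intro Ap_bounded_sum[OF h p J] Ap_bounded_coefficient[OF p]) (auto simp: q_def)
    have 2: "Ap_bounded \<mu> p (\<lambda>x. \<Sum>k\<in>?A \<times> ?B. coefficient \<mu> (H' k) (S' k) x)
        (\<Sum>k\<in>?A \<times> ?B. Lnorm q \<mu> (H' k) * Lnorm p \<mu> (S' k))"
      unfolding q_def using H' S' A B by (intro Ap_bounded_sum[OF h p] Ap_bounded_coefficient[OF p]) (auto simp: q_def)
    have mix: "(\<Sum>j\<in>J. Lnorm s \<mu> (\<lambda>z. f z * \<gamma> (w z) j) powr s) powr (1 / s) \<le> (c + \<epsilon>) * Lnorm s \<mu> f"
      if s: "0 < s" and f: "f \<in> Lp s \<mu>" and w: "simple_function \<mu> w" and c: "0 \<le> c"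
        and n: "\<And>z. f z \<noteq> 0 \<Longrightarrow> (\<Sum>j\<in>J. cmod (\<gamma> (w z) j) powr s) \<le> (c + \<epsilon>) powr s"
      for s f c and w :: "'g \<Rightarrow> 'w" and \<gamma>
    proof -
      have i: "integrable \<mu> (\<lambda>z. cmod (f z * \<gamma> (w z) j) powr s)" for j
        by (intro Lp_integrable Lp_mult_simple s f sp simple_function_compose1[OF w])
      have "(\<Sum>j\<in>J. Lnorm s \<mu> (\<lambda>z. f z * \<gamma> (w z) j) powr s)
         = (\<integral>z. (\<Sum>j\<in>J. cmod (f z * \<gamma> (w z) j) powr s) \<partial>\<mu>)"
        using i by (simp add: Lnorm_powr[OF s] Bochner_Integration.integral_sum)
      also have "\<dots> \<le> (\<integral>z. (c + \<epsilon>) powr s * cmod (f z) powr s \<partial>\<mu>)"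
      proof (rule integral_mono)
        show "integrable \<mu> (\<lambda>z. \<Sum>j\<in>J. cmod (f z * \<gamma> (w z) j) powr s)" using i by simp
        show "integrable \<mu> (\<lambda>z. (c + \<epsilon>) powr s * cmod (f z) powr s)" using Lp_integrable[OF f] by simp
        fix z
        have "(\<Sum>j\<in>J. cmod (f z * \<gamma> (w z) j) powr s) = cmod (f z) powr s * (\<Sum>j\<in>J. cmod (\<gamma> (w z) j) powr s)"
          by (simp add: norm_mult powr_mult sum_distrib_left)
        also have "\<dots> \<le> cmod (f z) powr s * (c + \<epsilon>) powr s"
          using n[of z] by (cases "f z = 0") (auto intro: mult_left_mono)
        finally show "(\<Sum>j\<in>J. cmod (f z * \<gamma> (w z) j) powr s) \<le> (c + \<epsilon>) powr s * cmod (f z) powr s"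
          by (simp add: mult.commute)
      qed
      also have "\<dots> = ((c + \<epsilon>) * Lnorm s \<mu> f) powr s"
        using c e by (simp add: powr_mult Lnorm_powr[OF s])
      finally have "(\<Sum>j\<in>J. Lnorm s \<mu> (\<lambda>z. f z * \<gamma> (w z) j) powr s) powr (1 / s)
          \<le> (((c + \<epsilon>) * Lnorm s \<mu> f) powr s) powr (1 / s)"
        using s by (intro powr_mono2) (auto intro: sum_nonneg)
      also have "\<dots> = (c + \<epsilon>) * Lnorm s \<mu> f" using s c e by (simp add: powr_powr)
      finally show ?thesis .
    qed
    have Hn: "(\<Sum>j\<in>J. Lnorm q \<mu> (H j) powr q) powr (1 / q) \<le> (a + \<epsilon>) * ?n"
      unfolding H_def
    proof (rule mix[OF q0 _ u(1) a(1)])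
      show "\<eta> \<in> Lp q \<mu>" using \<eta> by (simp add: q_def)
      show "(\<Sum>j\<in>J. cmod (\<alpha> (u z) j) powr q) \<le> (a + \<epsilon>) powr q" if "\<eta> z \<noteq> 0" for z
      proof -
        have "(nrm E (u z) + \<epsilon>) powr q \<le> (a + \<epsilon>) powr q"
          using a(2)[OF that] P.nrm_nonneg[OF u(2), of z] e q0 by (intro powr_mono2) auto
        with \<alpha>[of "u z"] show ?thesis by simp
      qed
    qed
    have Sn: "(\<Sum>j\<in>J. Lnorm p \<mu> (S j) powr p) powr (1 / p) \<le> (b + \<epsilon>) * ?m"
      unfolding S_def
    proof (rule mix[OF p0 \<psi> v(1) b(1)])
      show "(\<Sum>j\<in>J. cmod (\<beta> (v z) j) powr p) \<le> (b + \<epsilon>) powr p" if "\<psi> z \<noteq> 0" for z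
      proof -
        have "(dual_norm E (v z) + \<epsilon>) powr p \<le> (b + \<epsilon>) powr p"
          using b(2)[OF that] P.dual_norm_nonneg[OF v(2), of z] e p0 by (intro powr_mono2) auto
        with \<beta>[of "v z"] show ?thesis by simp
      qed
    qed
    have "(\<Sum>j\<in>J. Lnorm q \<mu> (H j) * Lnorm p \<mu> (S j))
      \<le> (\<Sum>j\<in>J. Lnorm q \<mu> (H j) powr q) powr (1 / q) * (\<Sum>j\<in>J. Lnorm p \<mu> (S j) powr p) powr (1 / p)"
      by (rule Hoelder_sum[OF q(1) p q(2) J]) auto
    also have "\<dots> \<le> ((a + \<epsilon>) * ?n) * ((b + \<epsilon>) * ?m)"
      using a(1) e by (intro mult_mono Hn Sn) auto
    finally have le1: "(\<Sum>j\<in>J. Lnorm q \<mu> (H j) * Lnorm p \<mu> (S j)) \<le> ((a + \<epsilon>) * ?n) * ((b + \<epsilon>) * ?m)" .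
    have "Lnorm q \<mu> (H' k) * Lnorm p \<mu> (S' k) \<le> \<epsilon> * ?n * ?m" if k: "k \<in> ?A \<times> ?B" for k
    proof -
      have rk: "cmod (r k) \<le> \<epsilon>" using k \<alpha>\<beta> by (auto simp: r_def)
      have "Lnorm q \<mu> (H' k) \<le> Lnorm q \<mu> (\<lambda>z. complex_of_real \<epsilon> * \<eta> z)"
      proof (rule Lnorm_mono[OF q0 _ Lp_measurable[OF H']])
        show "(\<lambda>z. complex_of_real \<epsilon> * \<eta> z) \<in> Lp q \<mu>" using \<eta> by (intro Lp_scale[OF q0]) (simp add: q_def)
        show "cmod (H' k z) \<le> cmod (complex_of_real \<epsilon> * \<eta> z)" for z
          using mult_right_mono[OF rk, of "cmod (\<eta> z)"] e
          by (auto simp: H'_def norm_mult mult.commute)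
      qed
      then have "Lnorm q \<mu> (H' k) \<le> \<epsilon> * ?n" using e by (simp add: Lnorm_scale[OF q0])
      moreover have "Lnorm p \<mu> (S' k) \<le> ?m"
        by (rule Lnorm_mono[OF p0 \<psi> Lp_measurable[OF S']]) (auto simp: S'_def)
      ultimately show ?thesis using e by (intro mult_mono) auto
    qed
    then have le2: "(\<Sum>k\<in>?A \<times> ?B. Lnorm q \<mu> (H' k) * Lnorm p \<mu> (S' k)) \<le> N * (\<epsilon> * ?n * ?m)"
      unfolding N_def by (rule sum_bounded_above)
    show ?thesis
      unfolding split by (rule Ap_bounded_mono[OF Ap_bounded_add[OF h p 1 2] add_mono[OF le1 le2]])
  qed
  show ?thesis
    unfolding q_def[symmetric]
  proof (rule Ap_bounded_limit)
    fix c assume c: "?n * ?m * (a * b) < c"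
    have "((\<lambda>\<epsilon>. ((a + \<epsilon>) * ?n) * ((b + \<epsilon>) * ?m) + N * (\<epsilon> * ?n * ?m)) \<longlongrightarrow>
        ((a + 0) * ?n) * ((b + 0) * ?m) + N * (0 * ?n * ?m)) (at_right 0)"
      by (intro tendsto_intros)
    then have "\<forall>\<^sub>F \<epsilon> in at_right 0. ((a + \<epsilon>) * ?n) * ((b + \<epsilon>) * ?m) + N * (\<epsilon> * ?n * ?m) < c"
      by (rule order_tendstoD(2)) (use c in \<open>simp add: ac_simps\<close>)
    moreover have "\<forall>\<^sub>F \<epsilon> in at_right 0. (0::real) < \<epsilon>" by (rule eventually_at_right_less)
    ultimately have "\<forall>\<^sub>F \<epsilon> in at_right 0. 0 < \<epsilon> \<and> ((a + \<epsilon>) * ?n) * ((b + \<epsilon>) * ?m) + N * (\<epsilon> * ?n * ?m) < c"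
      by eventually_elim simp
    then obtain \<epsilon> where "0 < \<epsilon>" "((a + \<epsilon>) * ?n) * ((b + \<epsilon>) * ?m) + N * (\<epsilon> * ?n * ?m) < c"
      using eventually_happens'[of "at_right (0::real)"] by (auto simp: trivial_limit_at_right_real)
    then show "Ap_bounded \<mu> p (vector_coefficient \<mu> \<eta> u \<psi> v) c"
      using Ap_bounded_mono[OF main] by fastforce
  qed
qed

section \<open>Products with coefficients of representations\<close>

text \<open>One rule for linearity in each of the four arguments: the integrands decide.\<close>

lemma vector_coefficient_diff:
  fixes \<mu> :: "'g::topological_group_add measure"
  assumes i1: "integrable \<mu> (\<lambda>y. left_regular x \<eta> y * \<psi> y * v y (u (- x + y)))"
    and i2: "integrable \<mu> (\<lambda>y. left_regular x \<eta>' y * \<psi>' y * v' y (u' (- x + y)))"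
    and eq: "\<And>y. left_regular x \<eta> y * \<psi> y * v y (u (- x + y))
       - left_regular x \<eta>' y * \<psi>' y * v' y (u' (- x + y))
       = left_regular x \<eta>'' y * \<psi>'' y * v'' y (u'' (- x + y))"
  shows "vector_coefficient \<mu> \<eta> u \<psi> v x - vector_coefficient \<mu> \<eta>' u' \<psi>' v' x
    = vector_coefficient \<mu> \<eta>'' u'' \<psi>'' v'' x"
  unfolding vector_coefficient_def
  by (simp only: Bochner_Integration.integral_diff[OF i1 i2, symmetric] eq)

lemma plus_minus_translate: "y + - (- x + y) = (x :: 'a::group_add)"
  by (simp only: minus_add add.assoc[symmetric] minus_minus right_minus add_0_left)

context isometric_representation
begin

text \<open>Near each point both the orbit of the vector and the dual orbit of the functional vary little in
  norm, so the selector lemma applies to the conjunction of the two estimates.\<close>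

lemma orbit_selector:
  assumes P: "QSL_presentation E q M L Q" and \<xi>: "\<xi> \<in> carrier E" and \<phi>: "\<phi> \<in> dual E"
    and K: "compact K" and d: "0 < \<delta>"
  obtains \<sigma> :: "'g \<Rightarrow> 'g" where "simple_function borel \<sigma>"
    "\<And>z. z \<in> K \<Longrightarrow> nrm E (\<pi> (- z) \<xi> \<ominus> \<pi> (- \<sigma> z) \<xi>) \<le> \<delta>"
    "\<And>z e. z \<in> K \<Longrightarrow> e \<in> carrier E \<Longrightarrow> cmod (\<phi> (\<pi> z e) - \<phi> (\<pi> (\<sigma> z) e)) \<le> \<delta> * nrm E e"
proof -
  define R where "R y z \<longleftrightarrow> nrm E (\<pi> (- z) \<xi> \<ominus> \<pi> (- y) \<xi>) \<le> \<delta> \<and>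
      (\<forall>e\<in>carrier E. cmod (\<phi> (\<pi> z e) - \<phi> (\<pi> y e)) \<le> \<delta> * nrm E e)" for y z
  have "\<exists>U. open U \<and> y \<in> U \<and> (\<forall>z\<in>U. R y z)" for y
  proof -
    obtain U where U: "open U" "- y \<in> U" "\<And>z. z \<in> U \<Longrightarrow> nrm E (\<pi> z \<xi> \<ominus> \<pi> (- y) \<xi>) < \<delta>"
      using pi_continuous[OF \<xi> d, of "- y"] by blast
    obtain V where V: "open V" "y \<in> V"
      "\<And>z e. z \<in> V \<Longrightarrow> e \<in> carrier E \<Longrightarrow> cmod (\<phi> (\<pi> z e) - \<phi> (\<pi> y e)) \<le> \<delta> * nrm E e"
      using dual_orbit_continuous[OF P \<phi> d, of y] by blast
    have "open (uminus -` U :: 'g set)"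
      using U(1) by (intro open_vimage continuous_intros) auto
    then have "open (uminus -` U \<inter> V)" using V(1) by (rule open_Int)
    moreover have "y \<in> uminus -` U \<inter> V" using U(2) V(2) by simp
    moreover have "\<forall>z\<in>uminus -` U \<inter> V. R y z" using U(3) V(3) by (auto simp: R_def less_imp_le)
    ultimately show ?thesis by blast
  qed
  then obtain \<sigma> :: "'g \<Rightarrow> 'g" where \<sigma>: "simple_function borel \<sigma>" "\<And>z. z \<in> K \<Longrightarrow> R (\<sigma> z) z"
    using measurable_selector[OF K, of R] by blast
  show thesis by (rule that[OF \<sigma>(1)]) (use \<sigma>(2) in \<open>auto simp: R_def\<close>)
qed

end

text \<open>The heart of the matter. Since \<open>\<phi>(\<pi>(x)\<xi>) = (\<phi> \<circ> \<pi>(y))(\<pi>((-x + y)\<^sup>-\<^sup>1)\<xi>)\<close>, the product is the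
  vector-valued coefficient of \<open>z \<mapsto> \<eta>(z) \<pi>(-z) \<xi>\<close> and \<open>y \<mapsto> \<psi>(y) (\<phi> \<circ> \<pi>(y))\<close>.
  Finite-valued approximations of both functions, of geometrically decreasing error, turn it into a
  telescoping series of vector-valued coefficients of finite-valued functions.\<close>

lemma product_coefficient_bounded:
  fixes \<mu> :: "'g::{topological_group_add, t2_space} measure" and E :: "'e cnspace"
  assumes h: "left_haar_measure \<mu>" and p: "1 < p"
    and rep: "representation E \<pi>" and P: "QSL_presentation E (conj_exp p) M L Q"
    and \<xi>: "\<xi> \<in> carrier E" and \<phi>: "\<phi> \<in> dual E"
    and \<eta>: "\<eta> \<in> Lp (conj_exp p) \<mu>" and \<psi>: "\<psi> \<in> Lp p \<mu>"
  shows "Ap_bounded \<mu> p (\<lambda>x. coefficient \<mu> \<eta> \<psi> x * \<phi> (\<pi> x \<xi>))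
    (Lnorm (conj_exp p) \<mu> \<eta> * Lnorm p \<mu> \<psi> * (nrm E \<xi> * dual_norm E \<phi>))"
proof (rule Ap_bounded_limit)
  interpret isometric_representation E \<pi>
    by (intro isometric_representation.intro isometric_representation_axioms.intro
        QSL_presentation.axioms(1)[OF P] rep)
  define q where "q = conj_exp p"
  have q: "1 < q" using conj_exp_gt_1[OF p] by (simp add: q_def)
  have q0: "0 < q" and p0: "0 < p" using q p by auto
  have sp: "space \<mu> = UNIV" and sets: "sets \<mu> = sets borel" by (rule haar_space[OF h], rule haar_sets[OF h])
  let ?n = "Lnorm q \<mu> \<eta>" and ?m = "Lnorm p \<mu> \<psi>" and ?a = "nrm E \<xi>" and ?b = "dual_norm E \<phi>"
  have a0: "0 \<le> ?a" and b0: "0 \<le> ?b" by (rule nrm_nonneg[OF \<xi>], rule dual_norm_nonneg[OF \<phi>])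
  have \<eta>q: "\<eta> \<in> Lp q \<mu>" using \<eta> by (simp add: q_def)
  define D where "D = ?m * (?a * ?b) + ?n * ?m * (2 * ?b) + ?n * (?a * ?b) + ?n * ?m * (?a * 2)"
  have D0: "0 \<le> D" using a0 b0 by (simp add: D_def)
  fix c assume "Lnorm (conj_exp p) \<mu> \<eta> * ?m * (?a * ?b) < c"
  then have c: "?n * ?m * (?a * ?b) < c" by (simp add: q_def)
  \<comment> \<open>the errors \<open>\<theta> / 2\<^sup>n\<close> add up to \<open>2 \<theta>\<close>, and \<open>D\<close> bounds the norm of the \<open>n\<close>-th difference
     per unit of error; \<open>+ 1\<close> avoids a division by zero\<close>
  define \<theta> where "\<theta> = (c - ?n * ?m * (?a * ?b)) / (2 * D + 1)"
  have \<theta>: "0 < \<theta>" using c D0 by (simp add: \<theta>_def)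
  have \<theta>c: "?n * ?m * (?a * ?b) + 2 * \<theta> * D \<le> c"
  proof -
    have "\<theta> * (2 * D + 1) = c - ?n * ?m * (?a * ?b)" using D0 by (simp add: \<theta>_def)
    then show ?thesis using \<theta> by (simp add: distrib_left mult.assoc mult.left_commute)
  qed
  define \<delta> where "\<delta> n = \<theta> * (1/2) ^ n" for n :: nat
  have \<delta>0: "0 < \<delta> n" for n using \<theta> by (simp add: \<delta>_def)
  have \<delta>Suc: "\<delta> (Suc n) \<le> \<delta> n" for n using \<theta> by (simp add: \<delta>_def)
  have \<delta>s: "\<delta> sums (2 * \<theta>)"
    unfolding \<delta>_def using sums_mult[OF geometric_sums[of "1/2 :: real"], of \<theta>] by (simp add: mult.commute)
  have \<delta>lim: "\<delta> \<longlonglongrightarrow> 0" by (rule summable_LIMSEQ_zero[OF sums_summable[OF \<delta>s]])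
  have "\<exists>K. \<forall>n. compact (K n) \<and> K n \<subseteq> K (Suc n) \<and>
    Lnorm q \<mu> (cutoff (- K n) \<eta>) \<le> \<delta> n \<and> Lnorm p \<mu> (cutoff (- K n) \<psi>) \<le> \<delta> n"
    by (rule compact_exhaustion[where \<delta> = \<delta>, OF h q0 \<eta>q p0 \<psi> \<delta>0]) blast
  then obtain K where K: "\<And>n. compact (K n)" "\<And>n. K n \<subseteq> K (Suc n)"
    "\<And>n. Lnorm q \<mu> (cutoff (- K n) \<eta>) \<le> \<delta> n" "\<And>n. Lnorm p \<mu> (cutoff (- K n) \<psi>) \<le> \<delta> n"
    by blast
  have Ks: "K n \<inter> space \<mu> \<in> sets \<mu>" "- K n \<inter> space \<mu> \<in> sets \<mu>" for n
    using haar_compact_sets[OF h K(1)] haar_compl_sets[OF h haar_compact_sets[OF h K(1)]] sp by auto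
  have Kmono: "K m \<subseteq> K n" if "m \<le> n" for m n using lift_Suc_mono_le[of K, OF K(2) that] .
  have "\<forall>n. \<exists>\<sigma>. simple_function borel \<sigma> \<and>
    (\<forall>z\<in>K n. nrm E (\<pi> (- z) \<xi> \<ominus>\<^bsub>E\<^esub> \<pi> (- \<sigma> z) \<xi>) \<le> \<delta> n) \<and>
    (\<forall>z\<in>K n. \<forall>e\<in>carrier E. cmod (\<phi> (\<pi> z e) - \<phi> (\<pi> (\<sigma> z) e)) \<le> \<delta> n * nrm E e)"
  proof
    fix n
    show "\<exists>\<sigma>. simple_function borel \<sigma> \<and>
      (\<forall>z\<in>K n. nrm E (\<pi> (- z) \<xi> \<ominus>\<^bsub>E\<^esub> \<pi> (- \<sigma> z) \<xi>) \<le> \<delta> n) \<and>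
      (\<forall>z\<in>K n. \<forall>e\<in>carrier E. cmod (\<phi> (\<pi> z e) - \<phi> (\<pi> (\<sigma> z) e)) \<le> \<delta> n * nrm E e)"
      by (rule orbit_selector[OF P \<xi> \<phi> K(1)[of n] \<delta>0[of n]]) blast
  qed
  from choice[OF this] obtain \<sigma> where "\<forall>n. simple_function borel (\<sigma> n) \<and>
    (\<forall>z\<in>K n. nrm E (\<pi> (- z) \<xi> \<ominus>\<^bsub>E\<^esub> \<pi> (- \<sigma> n z) \<xi>) \<le> \<delta> n) \<and>
    (\<forall>z\<in>K n. \<forall>e\<in>carrier E. cmod (\<phi> (\<pi> z e) - \<phi> (\<pi> (\<sigma> n z) e)) \<le> \<delta> n * nrm E e)" ..
  then have \<sigma>: "\<And>n. simple_function borel (\<sigma> n)"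
    "\<And>n z. z \<in> K n \<Longrightarrow> nrm E (\<pi> (- z) \<xi> \<ominus>\<^bsub>E\<^esub> \<pi> (- \<sigma> n z) \<xi>) \<le> \<delta> n"
    "\<And>n z e. z \<in> K n \<Longrightarrow> e \<in> carrier E \<Longrightarrow> cmod (\<phi> (\<pi> z e) - \<phi> (\<pi> (\<sigma> n z) e)) \<le> \<delta> n * nrm E e"
    by auto
  have \<sigma>\<mu>: "simple_function \<mu> (\<sigma> n)" for n
    using \<sigma>(1)[of n] sp sets by (simp add: simple_function_def)
  define u where "u n z = \<pi> (- \<sigma> n z) \<xi>" for n z
  define v where "v n y e = \<phi> (\<pi> (\<sigma> n y) e)" for n y e
  have us: "simple_function \<mu> (u n)" for n
    unfolding u_def by (rule simple_function_compose1[OF \<sigma>\<mu>])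
  have vs: "simple_function \<mu> (v n)" for n
    unfolding v_def by (rule simple_function_compose1[OF \<sigma>\<mu>])
  have uE: "u n z \<in> carrier E" and un: "nrm E (u n z) = ?a" for n z using \<xi> by (auto simp: u_def)
  have vE: "v n z \<in> dual E" and vn: "dual_norm E (v n z) \<le> ?b" for n z
    unfolding v_def by (rule dual_pi[OF \<phi>])+
  define H where "H n = cutoff (K n) \<eta>" for n
  define S where "S n = cutoff (K n) \<psi>" for n
  have H: "H n \<in> Lp q \<mu>" "Lnorm q \<mu> (H n) \<le> ?n" for n unfolding H_def by (rule cutoff_Lp[OF q0 \<eta>q Ks(1)])+
  have S: "S n \<in> Lp p \<mu>" "Lnorm p \<mu> (S n) \<le> ?m" for n unfolding S_def by (rule cutoff_Lp[OF p0 \<psi> Ks(1)])+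
  define dH where "dH n x = H (Suc n) x - H n x" for n x
  define dS where "dS n x = S (Suc n) x - S n x" for n x
  define du where "du n z = u (Suc n) z \<ominus>\<^bsub>E\<^esub> u n z" for n z
  define dv where "dv n y = (\<lambda>e. v (Suc n) y e - v n y e)" for n y
  have dH: "dH n \<in> Lp q \<mu>" "Lnorm q \<mu> (dH n) \<le> \<delta> n" for n
  proof -
    show L: "dH n \<in> Lp q \<mu>" unfolding dH_def by (intro Lp_diff q0 H)
    have "Lnorm q \<mu> (dH n) \<le> Lnorm q \<mu> (cutoff (- K n) \<eta>)"
      by (rule Lnorm_mono[OF q0 cutoff_Lp(1)[OF q0 \<eta>q Ks(2)] Lp_measurable[OF L]])
         (use K(2) in \<open>auto simp: dH_def H_def cutoff_def\<close>)
    then show "Lnorm q \<mu> (dH n) \<le> \<delta> n" using K(3)[of n] by simp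
  qed
  have dS: "dS n \<in> Lp p \<mu>" "Lnorm p \<mu> (dS n) \<le> \<delta> n" for n
  proof -
    show L: "dS n \<in> Lp p \<mu>" unfolding dS_def by (intro Lp_diff p0 S)
    have "Lnorm p \<mu> (dS n) \<le> Lnorm p \<mu> (cutoff (- K n) \<psi>)"
      by (rule Lnorm_mono[OF p0 cutoff_Lp(1)[OF p0 \<psi> Ks(2)] Lp_measurable[OF L]])
         (use K(2) in \<open>auto simp: dS_def S_def cutoff_def\<close>)
    then show "Lnorm p \<mu> (dS n) \<le> \<delta> n" using K(4)[of n] by simp
  qed
  have dus: "simple_function \<mu> (du n)" for n
    unfolding du_def by (rule simple_function_compose2[OF us us])
  have dvs: "simple_function \<mu> (dv n)" for n
    unfolding dv_def by (rule simple_function_compose2[OF vs vs, of "\<lambda>f g e. f e - g e"])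
  have duE: "du n z \<in> carrier E" for n z using uE by (simp add: du_def)
  have dvE: "dv n y \<in> dual E" for n y unfolding dv_def by (rule dual_intro_diff[OF vE vE])
  have dun: "nrm E (du n z) \<le> 2 * \<delta> n" if "H n z \<noteq> 0" for n z
  proof -
    have z: "z \<in> K n" "z \<in> K (Suc n)" using that K(2) by (auto simp: H_def cutoff_def split: if_splits)
    have "nrm E (du n z) \<le> nrm E (u (Suc n) z \<ominus>\<^bsub>E\<^esub> \<pi> (- z) \<xi>) + nrm E (\<pi> (- z) \<xi> \<ominus>\<^bsub>E\<^esub> u n z)"
      unfolding du_def by (rule nrm_diff_triangle[OF uE pi_in[OF \<xi>] uE])
    also have "nrm E (u (Suc n) z \<ominus>\<^bsub>E\<^esub> \<pi> (- z) \<xi>) \<le> \<delta> (Suc n)"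
      using \<sigma>(2)[OF z(2)] nrm_diff_commute[OF uE pi_in[OF \<xi>]] by (simp add: u_def)
    also have "nrm E (\<pi> (- z) \<xi> \<ominus>\<^bsub>E\<^esub> u n z) \<le> \<delta> n" using \<sigma>(2)[OF z(1)] by (simp add: u_def)
    finally show ?thesis using \<delta>Suc[of n] by simp
  qed
  have dvn: "dual_norm E (dv n y) \<le> 2 * \<delta> n" if "S n y \<noteq> 0" for n y
  proof (rule dual_norm_least)
    have y: "y \<in> K n" "y \<in> K (Suc n)" using that K(2) by (auto simp: S_def cutoff_def split: if_splits)
    fix e assume e: "e \<in> carrier E"
    have "cmod (dv n y e) \<le> cmod (\<phi> (\<pi> y e) - v n y e) + cmod (\<phi> (\<pi> y e) - v (Suc n) y e)"
      using norm_triangle_ineq4[of "\<phi> (\<pi> y e) - v n y e" "\<phi> (\<pi> y e) - v (Suc n) y e"] by (simp add: dv_def)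
    also have "\<dots> \<le> \<delta> n * nrm E e + \<delta> (Suc n) * nrm E e"
      using \<sigma>(3)[OF y(1) e] \<sigma>(3)[OF y(2) e] unfolding v_def by (rule add_mono)
    also have "\<dots> \<le> 2 * \<delta> n * nrm E e"
      using mult_right_mono[OF \<delta>Suc[of n] nrm_nonneg[OF e]] by simp
    finally show "cmod (dv n y e) \<le> 2 * \<delta> n * nrm E e" .
  qed (use \<delta>0[of n] in simp)
  define F where "F n = vector_coefficient \<mu> (H n) (u n) (S n) (v n)" for n
  note int = vector_coefficient_integrable[OF h p, folded q_def]
  note bound = vector_coefficient_bounded[OF h p P, folded q_def]
  have F0: "Ap_bounded \<mu> p (F 0) (?n * ?m * (?a * ?b))"
  proof -
    have "Ap_bounded \<mu> p (F 0) (Lnorm q \<mu> (H 0) * Lnorm p \<mu> (S 0) * (?a * ?b))"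
      unfolding F_def by (rule bound[OF H(1) S(1) us uE vs vE a0 _ b0 vn]) (simp add: un)
    moreover have "Lnorm q \<mu> (H 0) * Lnorm p \<mu> (S 0) * (?a * ?b) \<le> ?n * ?m * (?a * ?b)"
      using H(2) S(2) a0 b0 by (intro mult_right_mono mult_mono) auto
    ultimately show ?thesis by (rule Ap_bounded_mono)
  qed
  have step: "Ap_bounded \<mu> p (\<lambda>x. F (Suc n) x - F n x) (\<delta> n * D)" for n
  proof -
    \<comment> \<open>the four arguments are exchanged one after the other\<close>
    let ?G1 = "vector_coefficient \<mu> (dH n) (u (Suc n)) (S (Suc n)) (v (Suc n))"
    let ?G2 = "vector_coefficient \<mu> (H n) (du n) (S (Suc n)) (v (Suc n))"
    let ?G3 = "vector_coefficient \<mu> (H n) (u n) (dS n) (v (Suc n))"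
    let ?G4 = "vector_coefficient \<mu> (H n) (u n) (S n) (dv n)"
    have eq: "F (Suc n) x - F n x = ((?G1 x + ?G2 x) + ?G3 x) + ?G4 x" for x
    proof -
      have 1: "vector_coefficient \<mu> (H (Suc n)) (u (Suc n)) (S (Suc n)) (v (Suc n)) x
          - vector_coefficient \<mu> (H n) (u (Suc n)) (S (Suc n)) (v (Suc n)) x = ?G1 x"
        by (rule vector_coefficient_diff, rule int[OF H(1) S(1) us vs], rule int[OF H(1) S(1) us vs])
           (simp add: dH_def left_regular_def algebra_simps)
      have 2: "vector_coefficient \<mu> (H n) (u (Suc n)) (S (Suc n)) (v (Suc n)) x
          - vector_coefficient \<mu> (H n) (u n) (S (Suc n)) (v (Suc n)) x = ?G2 x"
        by (rule vector_coefficient_diff, rule int[OF H(1) S(1) us vs], rule int[OF H(1) S(1) us vs])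
           (simp add: du_def dual_diff[OF vE uE uE] right_diff_distrib)
      have 3: "vector_coefficient \<mu> (H n) (u n) (S (Suc n)) (v (Suc n)) x
          - vector_coefficient \<mu> (H n) (u n) (S n) (v (Suc n)) x = ?G3 x"
        by (rule vector_coefficient_diff, rule int[OF H(1) S(1) us vs], rule int[OF H(1) S(1) us vs])
           (simp add: dS_def algebra_simps)
      have 4: "vector_coefficient \<mu> (H n) (u n) (S n) (v (Suc n)) x
          - vector_coefficient \<mu> (H n) (u n) (S n) (v n) x = ?G4 x"
        by (rule vector_coefficient_diff, rule int[OF H(1) S(1) us vs], rule int[OF H(1) S(1) us vs])
           (simp add: dv_def right_diff_distrib)
      show ?thesis unfolding F_def 1[symmetric] 2[symmetric] 3[symmetric] 4[symmetric] by simp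
    qed
    have d2: "0 \<le> 2 * \<delta> n" using \<delta>0[of n] by simp
    have B1: "Ap_bounded \<mu> p ?G1 (Lnorm q \<mu> (dH n) * Lnorm p \<mu> (S (Suc n)) * (?a * ?b))"
      by (rule bound[OF dH(1) S(1) us uE vs vE a0 _ b0 vn]) (simp add: un)
    have B2: "Ap_bounded \<mu> p ?G2 (Lnorm q \<mu> (H n) * Lnorm p \<mu> (S (Suc n)) * ((2 * \<delta> n) * ?b))"
      by (rule bound[OF H(1) S(1) dus duE vs vE d2 dun b0 vn])
    have B3: "Ap_bounded \<mu> p ?G3 (Lnorm q \<mu> (H n) * Lnorm p \<mu> (dS n) * (?a * ?b))"
      by (rule bound[OF H(1) dS(1) us uE vs vE a0 _ b0 vn]) (simp add: un)
    have B4: "Ap_bounded \<mu> p ?G4 (Lnorm q \<mu> (H n) * Lnorm p \<mu> (S n) * (?a * (2 * \<delta> n)))"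
      by (rule bound[OF H(1) S(1) us uE dvs dvE a0 _ d2 dvn]) (simp add: un)
    have L1: "Lnorm q \<mu> (dH n) * Lnorm p \<mu> (S (Suc n)) * (?a * ?b) \<le> \<delta> n * ?m * (?a * ?b)"
      using dH(2)[of n] S(2)[of "Suc n"] \<delta>0[of n] a0 b0 by (intro mult_right_mono mult_mono) auto
    have L2: "Lnorm q \<mu> (H n) * Lnorm p \<mu> (S (Suc n)) * ((2 * \<delta> n) * ?b) \<le> ?n * ?m * ((2 * \<delta> n) * ?b)"
      using H(2)[of n] S(2)[of "Suc n"] d2 b0 by (intro mult_right_mono mult_mono) auto
    have L3: "Lnorm q \<mu> (H n) * Lnorm p \<mu> (dS n) * (?a * ?b) \<le> ?n * \<delta> n * (?a * ?b)"
      using H(2)[of n] dS(2)[of n] a0 b0 by (intro mult_right_mono mult_mono) auto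
    have L4: "Lnorm q \<mu> (H n) * Lnorm p \<mu> (S n) * (?a * (2 * \<delta> n)) \<le> ?n * ?m * (?a * (2 * \<delta> n))"
      using H(2)[of n] S(2)[of n] d2 a0 by (intro mult_right_mono mult_mono) auto
    have Deq: "\<delta> n * ?m * (?a * ?b) + ?n * ?m * ((2 * \<delta> n) * ?b) + ?n * \<delta> n * (?a * ?b) + ?n * ?m * (?a * (2 * \<delta> n)) = \<delta> n * D"
      unfolding D_def by (simp add: distrib_left ac_simps)
    have "Ap_bounded \<mu> p (\<lambda>x. ((?G1 x + ?G2 x) + ?G3 x) + ?G4 x)
      (Lnorm q \<mu> (dH n) * Lnorm p \<mu> (S (Suc n)) * (?a * ?b) + Lnorm q \<mu> (H n) * Lnorm p \<mu> (S (Suc n)) * ((2 * \<delta> n) * ?b)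
       + Lnorm q \<mu> (H n) * Lnorm p \<mu> (dS n) * (?a * ?b) + Lnorm q \<mu> (H n) * Lnorm p \<mu> (S n) * (?a * (2 * \<delta> n)))"
      by (intro Ap_bounded_add[OF h p] B1 B2 B3 B4)
    from Ap_bounded_mono[OF this add_mono[OF add_mono[OF add_mono[OF L1 L2] L3] L4]]
    show ?thesis unfolding eq Deq .
  qed
  have ae1: "AE y in \<mu>. \<eta> y = 0 \<or> (\<exists>n. y \<in> K n)" by (rule exhaustion_AE[OF h q0 \<eta>q K(1,3) \<delta>lim])
  have ae2: "AE y in \<mu>. \<psi> y = 0 \<or> (\<exists>n. y \<in> K n)" by (rule exhaustion_AE[OF h p0 \<psi> K(1,4) \<delta>lim])
  have Flim: "(\<lambda>n. F n x) \<longlonglongrightarrow> coefficient \<mu> \<eta> \<psi> x * \<phi> (\<pi> x \<xi>)" for x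
  proof -
    note ci = coefficient_integrable[OF h p \<eta> \<psi>, of x]
    have "(\<lambda>n. F n x) \<longlonglongrightarrow> (\<integral>y. left_regular x \<eta> y * \<psi> y * \<phi> (\<pi> x \<xi>) \<partial>\<mu>)"
      unfolding F_def vector_coefficient_def
    proof (rule integral_dominated_convergence[where w = "\<lambda>y. cmod (left_regular x \<eta> y * \<psi> y) * (?b * ?a)"])
      show "(\<lambda>y. left_regular x \<eta> y * \<psi> y * \<phi> (\<pi> x \<xi>)) \<in> borel_measurable \<mu>"
        using ci by (intro borel_measurable_times[OF borel_measurable_integrable]) auto
      show "(\<lambda>y. left_regular x (H n) y * S n y * v n y (u n (- x + y))) \<in> borel_measurable \<mu>" for n
        by (rule borel_measurable_integrable[OF int[OF H(1) S(1) us vs]])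
      show "integrable \<mu> (\<lambda>y. cmod (left_regular x \<eta> y * \<psi> y) * (?b * ?a))"
        using ci by (intro integrable_mult_left integrable_norm)
      show "AE y in \<mu>. norm (left_regular x (H n) y * S n y * v n y (u n (- x + y)))
          \<le> cmod (left_regular x \<eta> y * \<psi> y) * (?b * ?a)" for n
      proof (rule AE_I2)
        fix y
        have "cmod (v n y (u n (- x + y))) \<le> dual_norm E (v n y) * ?a"
          using dual_norm_bound[OF vE uE, of n y n "- x + y"] by (simp add: un)
        also have "\<dots> \<le> ?b * ?a" using vn a0 by (rule mult_right_mono)
        finally have 1: "cmod (v n y (u n (- x + y))) \<le> ?b * ?a" .
        have 2: "cmod (left_regular x (H n) y * S n y) \<le> cmod (left_regular x \<eta> y * \<psi> y)"
          by (simp add: left_regular_def H_def S_def cutoff_def)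
        show "norm (left_regular x (H n) y * S n y * v n y (u n (- x + y)))
          \<le> cmod (left_regular x \<eta> y * \<psi> y) * (?b * ?a)"
          using mult_mono[OF 2 1] by (simp only: norm_mult norm_ge_zero mult_nonneg_nonneg simp_thms)
      qed
      show "AE y in \<mu>. (\<lambda>n. left_regular x (H n) y * S n y * v n y (u n (- x + y)))
          \<longlonglongrightarrow> left_regular x \<eta> y * \<psi> y * \<phi> (\<pi> x \<xi>)"
        using haar_AE_translation[OF h ae1, of "- x"] ae2
      proof eventually_elim
        fix y assume y1: "\<eta> (- x + y) = 0 \<or> (\<exists>n. - x + y \<in> K n)" and y2: "\<psi> y = 0 \<or> (\<exists>n. y \<in> K n)"
        show "(\<lambda>n. left_regular x (H n) y * S n y * v n y (u n (- x + y)))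
          \<longlonglongrightarrow> left_regular x \<eta> y * \<psi> y * \<phi> (\<pi> x \<xi>)"
        proof (cases "\<eta> (- x + y) = 0 \<or> \<psi> y = 0")
          case True
          then have "left_regular x (H n) y * S n y = 0" for n
            by (auto simp: left_regular_def H_def S_def cutoff_def)
          moreover have "left_regular x \<eta> y * \<psi> y = 0" using True by (auto simp: left_regular_def)
          ultimately show ?thesis by (simp only: mult_zero_left tendsto_const)
        next
          case False
          then obtain n1 n2 where n12: "- x + y \<in> K n1" "y \<in> K n2" using y1 y2 by blast
          let ?z = "- x + y" and ?N = "max n1 n2"
          have in_K: "?z \<in> K n" "y \<in> K n" if "?N \<le> n" for n
            using n12 Kmono[of n1 n] Kmono[of n2 n] that by auto
          have le: "cmod (v n y (u n ?z) - \<phi> (\<pi> x \<xi>)) \<le> \<delta> n * (?a + ?b)" if n: "?N \<le> n" for n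
          proof -
            have px: "\<pi> x \<xi> = \<pi> y (\<pi> (- ?z) \<xi>)"
              using pi_plus[OF \<xi>, of y "- ?z"] by (simp only: plus_minus_translate)
            have 1: "cmod (\<phi> (\<pi> y (u n ?z)) - v n y (u n ?z)) \<le> \<delta> n * ?a"
              using \<sigma>(3)[OF in_K(2)[OF n] uE[of n ?z]] by (simp add: v_def un)
            have "\<phi> (\<pi> x \<xi>) - \<phi> (\<pi> y (u n ?z)) = \<phi> (\<pi> y (\<pi> (- ?z) \<xi> \<ominus>\<^bsub>E\<^esub> u n ?z))"
              unfolding px using uE \<xi> by (simp add: pi_diff dual_diff[OF \<phi>])
            also have "cmod \<dots> \<le> ?b * nrm E (\<pi> (- ?z) \<xi> \<ominus>\<^bsub>E\<^esub> u n ?z)"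
              using dual_norm_bound[OF \<phi>, of "\<pi> y (\<pi> (- ?z) \<xi> \<ominus>\<^bsub>E\<^esub> u n ?z)"] uE \<xi> by simp
            also have "\<dots> \<le> ?b * \<delta> n"
              using \<sigma>(2)[OF in_K(1)[OF n]] b0 unfolding u_def by (rule mult_left_mono)
            finally have 2: "cmod (\<phi> (\<pi> x \<xi>) - \<phi> (\<pi> y (u n ?z))) \<le> ?b * \<delta> n" .
            have "cmod (v n y (u n ?z) - \<phi> (\<pi> x \<xi>)) \<le> \<delta> n * ?a + ?b * \<delta> n"
              using 1 2 norm_triangle_ineq[of "\<phi> (\<pi> x \<xi>) - \<phi> (\<pi> y (u n ?z))" "\<phi> (\<pi> y (u n ?z)) - v n y (u n ?z)"]
              by (simp add: norm_minus_commute)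
            then show ?thesis by (simp only: distrib_left mult.commute)
          qed
          have "(\<lambda>n. v n y (u n ?z) - \<phi> (\<pi> x \<xi>)) \<longlonglongrightarrow> 0"
          proof (rule Lim_null_comparison)
            show "\<forall>\<^sub>F n in sequentially. norm (v n y (u n ?z) - \<phi> (\<pi> x \<xi>)) \<le> \<delta> n * (?a + ?b)"
              using le by (intro eventually_sequentiallyI)
            show "(\<lambda>n. \<delta> n * (?a + ?b)) \<longlonglongrightarrow> 0" using tendsto_mult_left_zero[OF \<delta>lim] .
          qed
          then have "(\<lambda>n. v n y (u n ?z)) \<longlonglongrightarrow> \<phi> (\<pi> x \<xi>)" by (rule LIM_zero_cancel)
          then have "(\<lambda>n. left_regular x \<eta> y * \<psi> y * v n y (u n ?z)) \<longlonglongrightarrow> left_regular x \<eta> y * \<psi> y * \<phi> (\<pi> x \<xi>)"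
            by (rule tendsto_mult_left)
          moreover have "\<forall>\<^sub>F n in sequentially. left_regular x \<eta> y * \<psi> y * v n y (u n ?z)
              = left_regular x (H n) y * S n y * v n y (u n ?z)"
            using in_K by (intro eventually_sequentiallyI[of ?N]) (auto simp: left_regular_def H_def S_def cutoff_def)
          ultimately show ?thesis by (rule Lim_transform_eventually)
        qed
      qed
    qed
    also have "(\<integral>y. left_regular x \<eta> y * \<psi> y * \<phi> (\<pi> x \<xi>) \<partial>\<mu>) = coefficient \<mu> \<eta> \<psi> x * \<phi> (\<pi> x \<xi>)"
      by (simp only: coefficient_def integral_mult_left_zero)
    finally show ?thesis .
  qed
  have "(\<lambda>n. \<delta> n * D) sums (2 * \<theta> * D)" by (rule sums_mult2[OF \<delta>s])
  then have ds: "summable (\<lambda>n. \<delta> n * D)" "(\<Sum>n. \<delta> n * D) = 2 * \<theta> * D" by (auto simp: sums_iff)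
  have "Ap_bounded \<mu> p (\<lambda>x. coefficient \<mu> \<eta> \<psi> x * \<phi> (\<pi> x \<xi>) - F 0 x) (\<Sum>n. \<delta> n * D)"
    by (rule Ap_bounded_suminf[OF h p step ds(1) telescope_sums[OF Flim]])
  from Ap_bounded_add[OF h p F0 this]
  have "Ap_bounded \<mu> p (\<lambda>x. coefficient \<mu> \<eta> \<psi> x * \<phi> (\<pi> x \<xi>)) (?n * ?m * (?a * ?b) + 2 * \<theta> * D)"
    unfolding ds(2) by simp
  then show "Ap_bounded \<mu> p (\<lambda>x. coefficient \<mu> \<eta> \<psi> x * \<phi> (\<pi> x \<xi>)) c"
    using \<theta>c by (rule Ap_bounded_mono)
qed

text \<open>Summation of the double series, first over the expansion of \<open>g\<close> and then over that of \<open>f\<close>.\<close>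

lemma product_expansion_bounded:
  fixes \<mu> :: "'g::{topological_group_add, t2_space} measure" and E :: "nat \<Rightarrow> 'e cnspace"
  assumes h: "left_haar_measure \<mu>" and p: "1 < p"
    and f: "Ap_expansion \<mu> p f \<eta> \<psi>"
    and rep: "\<And>n. Rep TYPE('m) (conj_exp p) (E n) (\<pi> n)"
    and mem: "\<And>n. \<xi> n \<in> carrier (E n)" "\<And>n. \<phi> n \<in> dual (E n)"
    and sm: "summable (\<lambda>n. nrm (E n) (\<xi> n) * dual_norm (E n) (\<phi> n))"
    and g: "\<And>x. (\<lambda>n. \<phi> n (\<pi> n x (\<xi> n))) sums g x"
  shows "Ap_bounded \<mu> p (\<lambda>x. f x * g x)
    ((\<Sum>n. Lnorm (conj_exp p) \<mu> (\<eta> n) * Lnorm p \<mu> (\<psi> n)) * (\<Sum>n. nrm (E n) (\<xi> n) * dual_norm (E n) (\<phi> n)))"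
proof -
  let ?q = "conj_exp p"
  let ?B = "\<Sum>n. nrm (E n) (\<xi> n) * dual_norm (E n) (\<phi> n)"
  have L: "\<eta> m \<in> Lp ?q \<mu>" "\<psi> m \<in> Lp p \<mu>" for m using f by (auto simp: Ap_expansion_def)
  have sA: "summable (\<lambda>n. Lnorm ?q \<mu> (\<eta> n) * Lnorm p \<mu> (\<psi> n))" using f by (simp add: Ap_expansion_def)
  have fs: "(\<lambda>n. coefficient \<mu> (\<eta> n) (\<psi> n) x) sums f x" for x
    using f by (simp add: Ap_expansion_def coefficient_def)
  have 1: "Ap_bounded \<mu> p (\<lambda>x. coefficient \<mu> (\<eta> m) (\<psi> m) x * \<phi> n (\<pi> n x (\<xi> n)))
      (Lnorm ?q \<mu> (\<eta> m) * Lnorm p \<mu> (\<psi> m) * (nrm (E n) (\<xi> n) * dual_norm (E n) (\<phi> n)))" for m n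
  proof -
    have r: "representation (E n) (\<pi> n)" and Q: "QSL_space TYPE('m) ?q (E n)"
      using rep[of n] by (auto simp: Rep_def)
    obtain M :: "'m measure" and SS QQ where P: "QSL_presentation (E n) ?q M SS QQ"
      by (rule QSL_space_presentation[OF Q conj_exp_gt_1[OF p]])
    show ?thesis by (rule product_coefficient_bounded[OF h p r P mem L])
  qed
  have 2: "Ap_bounded \<mu> p (\<lambda>x. coefficient \<mu> (\<eta> m) (\<psi> m) x * g x) (Lnorm ?q \<mu> (\<eta> m) * Lnorm p \<mu> (\<psi> m) * ?B)" for m
    unfolding suminf_mult[OF sm, symmetric]
    by (rule Ap_bounded_suminf[OF h p 1 summable_mult[OF sm] sums_mult[OF g]])
  show ?thesis
    unfolding suminf_mult2[OF sA]
    by (rule Ap_bounded_suminf[OF h p 2 summable_mult2[OF sA] sums_mult2[OF fs]])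
qed

section \<open>Subspaces of QSLp-spaces\<close>

text \<open>If \<open>E\<close> is presented as \<open>S / N\<close>, a closed subspace of \<open>E\<close> is presented as \<open>S' / N\<close>, where \<open>S'\<close> is its
  preimage in \<open>S\<close>. The preimage is closed because the quotient map does not increase distances.\<close>

lemma QSL_space_subspace:
  assumes QSL: "QSL_space TYPE('m) q E" and q: "1 \<le> q" and F: "closed_subspace F E"
  shows "QSL_space TYPE('m) q (E\<lparr>carrier := F\<rparr>)"
proof -
  obtain M :: "'m measure" and S N V where B: "complex_banach_space E"
    and S: "closed_subspace S (Lp_space q M)"
    and N: "closed_subspace N ((Lp_space q M)\<lparr>carrier := S\<rparr>)"
    and V: "invertible_isometry V E (quotient_space ((Lp_space q M)\<lparr>carrier := S\<rparr>) N)"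
    using QSL unfolding QSL_space_def by blast
  interpret complex_banach_space E by (rule B)
  let ?L = "Lp_space q M"
  let ?K = "?L\<lparr>carrier := S\<rparr>"
  let ?R = "quotient_space ?K N"
  interpret LL: complex_normed_space ?L by (rule Lp_space_normed[OF q])
  have Ssub: "submodule S scalars ?L" and Scl: "closedin (ntopology ?L) S"
    using S by (auto simp: closed_subspace_def)
  note Smem = LL.submodule_mem[OF Ssub]
  interpret K: complex_normed_space ?K by (rule LL.subspace_normed[OF Ssub])
  have Nsub: "submodule N scalars ?K" and Ncl: "closedin (ntopology ?K) N"
    using N by (auto simp: closed_subspace_def)
  note Nmem = K.submodule_mem[OF Nsub]
  have Fsub: "submodule F scalars E" and Fcl: "closedin (ntopology E) F"
    using F by (auto simp: closed_subspace_def)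
  note Fmem = submodule_mem[OF Fsub]
  note R_car = K.quotient_carrier[OF Nsub] and R_add = K.quotient_add[OF Nsub]
    and R_smult = K.quotient_smult[OF Nsub] and R_nrm = K.quotient_nrm_le[OF Nsub]
  let ?coset = "\<lambda>A. N +>\<^bsub>?K\<^esub> A"
  have Vb: "bij_betw V (carrier E) (?coset ` S)"
    and Va: "\<And>x y. x \<in> carrier E \<Longrightarrow> y \<in> carrier E \<Longrightarrow> V (x \<oplus>\<^bsub>E\<^esub> y) = V x \<oplus>\<^bsub>?R\<^esub> V y"
    and Vs: "\<And>c x. x \<in> carrier E \<Longrightarrow> V (c \<odot>\<^bsub>E\<^esub> x) = c \<odot>\<^bsub>?R\<^esub> V x"
    and Vn: "\<And>x. x \<in> carrier E \<Longrightarrow> nrm ?R (V x) = nrm E x"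
    using V unfolding invertible_isometry_def R_car by auto
  define S' where "S' = {A \<in> S. \<exists>e\<in>F. V e = ?coset A}"
  have add': "V (e \<oplus>\<^bsub>E\<^esub> e') = ?coset (A \<oplus>\<^bsub>?L\<^esub> A')"
    if "e \<in> carrier E" "e' \<in> carrier E" "A \<in> S" "A' \<in> S" "V e = ?coset A" "V e' = ?coset A'" for e e' A A'
    using that R_add[of A A'] by (simp add: Va)
  have smult': "V (c \<odot>\<^bsub>E\<^esub> e) = ?coset (c \<odot>\<^bsub>?L\<^esub> A)"
    if "e \<in> carrier E" "A \<in> S" "V e = ?coset A" for c e A
    using that R_smult[of A c] by (simp add: Vs)
  have zero': "V \<zero>\<^bsub>E\<^esub> = ?coset \<zero>\<^bsub>?L\<^esub>"
  proof -
    obtain A where A: "A \<in> S" "V \<zero>\<^bsub>E\<^esub> = ?coset A" using bij_betw_imp_surj_on[OF Vb] by blast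
    have "V (0 \<odot>\<^bsub>E\<^esub> \<zero>\<^bsub>E\<^esub>) = ?coset (0 \<odot>\<^bsub>?L\<^esub> A)" by (rule smult'[OF _ A]) simp
    moreover have "0 \<odot>\<^bsub>?L\<^esub> A = \<zero>\<^bsub>?L\<^esub>" using A(1) Smem(1) by (intro LL.smult_0) blast
    ultimately show ?thesis by simp
  qed
  have S'sub: "submodule S' scalars ?L"
  proof (rule LL.submodule_by_closure)
    show "S' \<subseteq> carrier ?L" using Smem(1) by (auto simp: S'_def)
    show "\<zero>\<^bsub>?L\<^esub> \<in> S'" using Smem(2) Fmem(2) zero' by (auto simp: S'_def)
    show "A \<oplus>\<^bsub>?L\<^esub> A' \<in> S'" if AA: "A \<in> S'" "A' \<in> S'" for A A'
    proof -
      obtain e e' where e: "e \<in> F" "V e = ?coset A" "e' \<in> F" "V e' = ?coset A'" "A \<in> S" "A' \<in> S"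
        using AA by (auto simp: S'_def)
      then have "V (e \<oplus>\<^bsub>E\<^esub> e') = ?coset (A \<oplus>\<^bsub>?L\<^esub> A')" using Fmem(1) by (intro add') auto
      then show ?thesis using Fmem(3)[OF e(1,3)] Smem(3)[OF e(5,6)] by (auto simp: S'_def)
    qed
    show "c \<odot>\<^bsub>?L\<^esub> A \<in> S'" if AA: "A \<in> S'" for c A
    proof -
      obtain e where e: "e \<in> F" "V e = ?coset A" "A \<in> S" using AA by (auto simp: S'_def)
      then have "V (c \<odot>\<^bsub>E\<^esub> e) = ?coset (c \<odot>\<^bsub>?L\<^esub> A)" using Fmem(1) by (intro smult') auto
      then show ?thesis using Fmem(4)[OF e(1)] Smem(4)[OF e(3)] by (auto simp: S'_def)
    qed
  qed
  have S'S: "S' \<subseteq> S" by (auto simp: S'_def)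
  have S'cl: "closedin (ntopology ?L) S'"
    unfolding LL.closedin_ntopology
  proof (intro conjI ballI)
    show "S' \<subseteq> carrier ?L" using S'S Smem(1) by blast
    fix A assume A: "A \<in> carrier ?L - S'"
    show "\<exists>r>0. \<forall>B\<in>carrier ?L. nrm ?L (A \<ominus>\<^bsub>?L\<^esub> B) < r \<longrightarrow> B \<notin> S'"
    proof (cases "A \<in> S")
      case False
      then show ?thesis using Scl A S'S unfolding LL.closedin_ntopology by blast
    next
      case True
      then have "?coset A \<in> V ` carrier E" unfolding bij_betw_imp_surj_on[OF Vb] by (rule imageI)
      then obtain e where e': "?coset A = V e" "e \<in> carrier E" by (rule imageE)
      note e = e'(2) e'(1)[symmetric]
      have "e \<notin> F" using A True e(2) by (auto simp: S'_def)
      then obtain r where r: "0 < r" "\<And>e'. e' \<in> carrier E \<Longrightarrow> nrm E (e \<ominus>\<^bsub>E\<^esub> e') < r \<Longrightarrow> e' \<notin> F"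
        using Fcl e(1) unfolding closedin_ntopology by blast
      show ?thesis
      proof (intro exI[of _ r] conjI ballI impI notI r(1))
        fix B assume B: "B \<in> carrier ?L" "nrm ?L (A \<ominus>\<^bsub>?L\<^esub> B) < r" "B \<in> S'"
        then obtain e' where e': "e' \<in> F" "V e' = ?coset B" "B \<in> S" by (auto simp: S'_def)
        have e'E: "e' \<in> carrier E" using e'(1) Fmem(1) by blast
        have m1: "V ((-1) \<odot>\<^bsub>E\<^esub> e') = ?coset ((-1) \<odot>\<^bsub>?L\<^esub> B)" by (rule smult'[OF e'E e'(3,2)])
        have "V (e \<oplus>\<^bsub>E\<^esub> (-1) \<odot>\<^bsub>E\<^esub> e') = ?coset (A \<oplus>\<^bsub>?L\<^esub> (-1) \<odot>\<^bsub>?L\<^esub> B)"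
          by (rule add'[OF e(1) _ True _ e(2) m1]) (use e'E Smem(4)[OF e'(3)] in auto)
        moreover have "e \<oplus>\<^bsub>E\<^esub> (-1) \<odot>\<^bsub>E\<^esub> e' = e \<ominus>\<^bsub>E\<^esub> e'"
          using e'E by (simp add: a_minus_def smult_minus_1)
        moreover have "A \<oplus>\<^bsub>?L\<^esub> (-1) \<odot>\<^bsub>?L\<^esub> B = A \<ominus>\<^bsub>?L\<^esub> B"
          using B(1) by (simp add: a_minus_def LL.smult_minus_1)
        ultimately have VV: "V (e \<ominus>\<^bsub>E\<^esub> e') = ?coset (A \<ominus>\<^bsub>?L\<^esub> B)" by simp
        have "nrm E (e \<ominus>\<^bsub>E\<^esub> e') = nrm ?R (?coset (A \<ominus>\<^bsub>?L\<^esub> B))"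
          using Vn[OF diff_in[OF e(1) e'E]] VV by simp
        also have "\<dots> \<le> nrm ?L (A \<ominus>\<^bsub>?L\<^esub> B)"
          using R_nrm[of "A \<ominus>\<^bsub>?L\<^esub> B"] Smem(6)[OF True e'(3)] by simp
        finally have "nrm E (e \<ominus>\<^bsub>E\<^esub> e') < r" using B(2) by simp
        then show False using r(2)[OF e'E] e'(1) by blast
      qed
    qed
  qed
  let ?K' = "?L\<lparr>carrier := S'\<rparr>"
  interpret K': complex_normed_space ?K' by (rule LL.subspace_normed[OF S'sub])
  have sg: "additive_subgroup N ?K"
    using submodule.axioms(1)[OF Nsub] by (simp add: additive_subgroup_def)
  interpret A: abelian_subgroup N ?K by (rule abelian_subgroupI3[OF sg K.abelian_group_E])
  have NS': "N \<subseteq> S'"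
  proof
    fix n assume n: "n \<in> N"
    have "?coset n = ?coset \<zero>\<^bsub>?L\<^esub>"
      using A.a_rcos_const[OF n] A.a_rcos_const[OF Nmem(2)] by simp
    then show "n \<in> S'" using zero' Fmem(2) n Nmem(1) by (auto simp: S'_def)
  qed
  have N': "closed_subspace N ?K'"
    unfolding closed_subspace_def K'.closedin_ntopology
  proof (intro conjI ballI)
    show "submodule N scalars ?K'"
      by (rule K'.submodule_by_closure) (use NS' Nmem in auto)
    show "N \<subseteq> carrier ?K'" using NS' by simp
    fix x assume "x \<in> carrier ?K' - N"
    then have x: "x \<in> S'" "x \<in> S" "x \<notin> N" using S'S by auto
    then have xK: "x \<in> carrier ?K - N" by simp
    have "\<forall>x\<in>carrier ?K - N. \<exists>r>0. \<forall>y\<in>carrier ?K. nrm ?K (x \<ominus>\<^bsub>?K\<^esub> y) < r \<longrightarrow> y \<notin> N"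
      using Ncl unfolding K.closedin_ntopology by (rule conjunct2)
    from bspec[OF this xK] obtain r where r0: "0 < r"
      "\<forall>y\<in>carrier ?K. nrm ?K (x \<ominus>\<^bsub>?K\<^esub> y) < r \<longrightarrow> y \<notin> N" by (elim exE conjE)
    have r: "0 < r" "\<And>y. y \<in> S \<Longrightarrow> nrm ?K (x \<ominus>\<^bsub>?K\<^esub> y) < r \<Longrightarrow> y \<notin> N"
      using r0 by auto
    show "\<exists>r>0. \<forall>y\<in>carrier ?K'. nrm ?K' (x \<ominus>\<^bsub>?K'\<^esub> y) < r \<longrightarrow> y \<notin> N"
    proof (intro exI[of _ r] conjI ballI impI r(1))
      fix y assume y: "y \<in> carrier ?K'" "nrm ?K' (x \<ominus>\<^bsub>?K'\<^esub> y) < r"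
      then have "y \<in> S'" "y \<in> S" using S'S by auto
      then show "y \<notin> N"
        using r(2)[of y] y(2) x by (simp add: LL.subspace_minus[OF Ssub] LL.subspace_minus[OF S'sub])
    qed
  qed
  have V': "invertible_isometry V (E\<lparr>carrier := F\<rparr>) (quotient_space ?K' N)"
  proof -
    have coset_eq: "N +>\<^bsub>?K'\<^esub> A = ?coset A" for A by (simp add: a_r_coset_def')
    have car: "carrier (quotient_space ?K' N) = ?coset ` S'"
      by (auto simp: quotient_space_def A_RCOSETS_def' coset_eq)
    have ops: "add (quotient_space ?K' N) = add ?R" "smult (quotient_space ?K' N) = smult ?R"
      "nrm (quotient_space ?K' N) = nrm ?R"
      by (simp_all add: quotient_space_def set_add_def')
    have inj: "inj_on V F" using bij_betw_imp_inj_on[OF Vb] Fmem(1) by (rule inj_on_subset)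
    have im: "V ` F = ?coset ` S'"
    proof
      show "V ` F \<subseteq> ?coset ` S'"
      proof
        fix w assume "w \<in> V ` F"
        then obtain e where e: "e \<in> F" "w = V e" by blast
        have "V e \<in> V ` carrier E" using e(1) Fmem(1) by blast
        then have "V e \<in> ?coset ` S" unfolding bij_betw_imp_surj_on[OF Vb] .
        then obtain A where "A \<in> S" "V e = ?coset A" by (rule imageE)
        then show "w \<in> ?coset ` S'" using e by (auto simp: S'_def)
      qed
      show "?coset ` S' \<subseteq> V ` F"
      proof
        fix w assume "w \<in> ?coset ` S'"
        then obtain A where A: "A \<in> S'" "w = ?coset A" by blast
        then obtain e where "e \<in> F" "V e = ?coset A" by (auto simp: S'_def)
        then show "w \<in> V ` F" using A(2) by (metis imageI)
      qed
    qed
    show ?thesis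
      unfolding invertible_isometry_def car ops
      using inj im Va Vs Vn Fmem(1) by (auto simp: bij_betw_def subset_iff)
  qed
  show ?thesis
    unfolding QSL_space_def
  proof (intro conjI exI)
    show "complex_banach_space (E\<lparr>carrier := F\<rparr>)" by (rule banach_closed_subspace[OF B F])
    show "closed_subspace S' ?L" using S'sub S'cl by (simp add: closed_subspace_def)
  qed (rule N' V')+
qed

section \<open>Integrals of simple functions\<close>

context complex_normed_space
begin

lemma finsum_in [simp]:
  "(\<And>i. i \<in> I \<Longrightarrow> f i \<in> carrier E) \<Longrightarrow> (\<Oplus>i\<in>I. f i) \<in> carrier E"
  by (rule M.finsum_closed) auto

lemma smult_sum_left:
  assumes "v \<in> carrier E" "finite I"
  shows "(\<Sum>i\<in>I. c i) \<odot> v = (\<Oplus>i\<in>I. c i \<odot> v)"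
  using assms(2) by (induction I rule: finite_induct) (use assms(1) in \<open>auto simp: smult_add_left\<close>)

lemma nrm_finsum:
  assumes "finite I" "\<And>i. i \<in> I \<Longrightarrow> f i \<in> carrier E"
  shows "nrm E (\<Oplus>i\<in>I. f i) \<le> (\<Sum>i\<in>I. nrm E (f i))"
  using assms
proof (induction I rule: finite_induct)
  case (insert i I)
  have "(\<Oplus>i\<in>insert i I. f i) = f i \<oplus> (\<Oplus>i\<in>I. f i)"
    by (rule M.finsum_insert) (use insert in auto)
  moreover have "nrm E (f i \<oplus> (\<Oplus>i\<in>I. f i)) \<le> nrm E (f i) + nrm E (\<Oplus>i\<in>I. f i)"
    by (rule nrm_triangle) (use insert in auto)
  ultimately show ?case using insert by simp
qed simp

text \<open>The sum defining the integral of a simple function may be taken over the values of any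
  finer simple function. Pieces of infinite measure contribute zero on both sides.\<close>

lemma simple_integral_refine:
  assumes s: "simple_integrable_in E M s" and t: "simple_function M t"
    and B: "finite B" "t ` space M \<subseteq> B" and val: "\<And>b. b \<in> B \<Longrightarrow> val b \<in> carrier E"
    and st: "\<And>x. x \<in> space M \<Longrightarrow> s x = val (t x)"
  shows "simple_integral_in E M s = (\<Oplus>b\<in>B. complex_of_real (measure M {x \<in> space M. t x = b}) \<odot> val b)"
proof -
  let ?m = "\<lambda>b. complex_of_real (measure M {x \<in> space M. t x = b})"
  let ?V = "val ` B"
  have sV: "s ` space M \<subseteq> ?V" using st B(2) by auto
  have fV: "finite ?V" using B(1) by simp
  have VE: "v \<in> carrier E" if "v \<in> ?V" for v using that val by auto
  have ts: "{x \<in> space M. t x = b} \<in> sets M" for b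
  proof -
    have "{x \<in> space M. t x = b} = t -` {b} \<inter> space M" by auto
    then show ?thesis using simple_functionD(2)[OF t, of "{b}"] by simp
  qed
  have "simple_integral_in E M s
      = (\<Oplus>v\<in>s ` space M. complex_of_real (measure M {x \<in> space M. s x = v}) \<odot> v)"
    by (simp add: simple_integral_in_def)
  also have "\<dots> = (\<Oplus>v\<in>?V. complex_of_real (measure M {x \<in> space M. s x = v}) \<odot> v)"
  proof (rule M.add.finprod_mono_neutral_cong_left[OF fV sV])
    show "complex_of_real (measure M {x \<in> space M. s x = v}) \<odot> v = \<zero>" if "v \<in> ?V - s ` space M" for v
    proof -
      have "{x \<in> space M. s x = v} = {}" using that by blast
      then have "measure M {x \<in> space M. s x = v} = 0" by (simp only: measure_empty)
      then show ?thesis using VE that by simp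
    qed
  qed (use VE in auto)
  also have "\<dots> = (\<Oplus>v\<in>?V. \<Oplus>b\<in>{b \<in> B. val b = v}. ?m b \<odot> val b)"
  proof (rule M.finsum_cong'[OF refl])
    show "(\<lambda>v. \<Oplus>b\<in>{b \<in> B. val b = v}. ?m b \<odot> val b) \<in> ?V \<rightarrow> carrier E"
      using val by (auto intro!: finsum_in)
    fix v assume v: "v \<in> ?V"
    let ?B = "{b \<in> B. val b = v}"
    have fB: "finite ?B" using B(1) by simp
    have "complex_of_real (measure M {x \<in> space M. s x = v}) \<odot> v = (\<Oplus>b\<in>?B. ?m b \<odot> v)"
    proof (cases "v = \<zero>")
      case True
      have "(\<Oplus>b\<in>?B. ?m b \<odot> v) = (\<Sum>b\<in>?B. ?m b) \<odot> v" by (rule smult_sum_left[symmetric, OF VE[OF v] fB])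
      then show ?thesis using True by simp
    next
      case False
      have fin: "emeasure M {x \<in> space M. s x \<noteq> \<zero>} \<noteq> \<infinity>" using s by (simp add: simple_integrable_in_def)
      have ss: "{x \<in> space M. s x \<noteq> \<zero>} \<in> sets M"
      proof -
        have "{x \<in> space M. s x \<noteq> \<zero>} = s -` (- {\<zero>}) \<inter> space M" by auto
        then show ?thesis using s simple_functionD(2)[of M s "- {\<zero>}"] by (simp add: simple_integrable_in_def)
      qed
      have un: "{x \<in> space M. s x = v} = (\<Union>b\<in>?B. {x \<in> space M. t x = b})" using st B(2) by auto
      have "measure M (\<Union>b\<in>?B. {x \<in> space M. t x = b}) = (\<Sum>b\<in>?B. measure M {x \<in> space M. t x = b})"
      proof (rule measure_finite_Union[OF fB])
        show "(\<lambda>b. {x \<in> space M. t x = b}) ` ?B \<subseteq> sets M" using ts by auto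
        show "disjoint_family_on (\<lambda>b. {x \<in> space M. t x = b}) ?B" by (auto simp: disjoint_family_on_def)
        fix b assume b: "b \<in> ?B"
        have "{x \<in> space M. t x = b} \<subseteq> {x \<in> space M. s x \<noteq> \<zero>}" using b st False by auto
        from emeasure_mono[OF this ss] fin show "emeasure M {x \<in> space M. t x = b} \<noteq> \<infinity>"
          by (auto simp: top_unique)
      qed
      then show ?thesis unfolding un by (simp add: smult_sum_left[OF VE[OF v] fB])
    qed
    also have "\<dots> = (\<Oplus>b\<in>?B. ?m b \<odot> val b)"
      by (rule M.finsum_cong'[OF refl]) (use val in auto)
    finally show "complex_of_real (measure M {x \<in> space M. s x = v}) \<odot> v = (\<Oplus>b\<in>?B. ?m b \<odot> val b)" .
  qed
  also have "\<dots> = (\<Oplus>b\<in>(\<Union>v\<in>?V. {b \<in> B. val b = v}). ?m b \<odot> val b)"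
    by (rule M.add.finprod_UN_disjoint[symmetric]) (use B(1) val in \<open>auto simp: disjnt_def pairwise_def\<close>)
  also have "(\<Union>v\<in>?V. {b \<in> B. val b = v}) = B" by auto
  finally show ?thesis .
qed

lemma simple_integrable_inI:
  assumes "simple_function M s" "\<And>x. s x \<in> carrier E" "A \<in> sets M" "emeasure M A < \<infinity>"
    and "\<And>x. x \<notin> A \<Longrightarrow> s x = \<zero>"
  shows "simple_integrable_in E M s"
proof -
  have "emeasure M {x \<in> space M. s x \<noteq> \<zero>} \<le> emeasure M A"
    using assms(5) by (intro emeasure_mono assms(3)) auto
  then show ?thesis using assms by (auto simp: simple_integrable_in_def top_unique)
qed

lemma simple_integral_in_carrier:
  assumes "simple_integrable_in E M s" shows "simple_integral_in E M s \<in> carrier E"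
  unfolding simple_integral_in_def using assms by (intro finsum_in) (auto simp: simple_integrable_in_def)

lemma simple_integral_add:
  assumes s: "simple_integrable_in E M s" "simple_integrable_in E M t" "simple_integrable_in E M (\<lambda>x. s x \<oplus> t x)"
  shows "simple_integral_in E M (\<lambda>x. s x \<oplus> t x) = simple_integral_in E M s \<oplus> simple_integral_in E M t"
proof -
  let ?\<tau> = "\<lambda>x. (s x, t x)"
  have sf: "simple_function M s" "simple_function M t" and car: "s ` space M \<subseteq> carrier E" "t ` space M \<subseteq> carrier E"
    using s by (auto simp: simple_integrable_in_def)
  have \<tau>: "simple_function M ?\<tau>" by (rule simple_function_Pair[OF sf])
  let ?B = "?\<tau> ` space M"
  have fB: "finite ?B" by (rule simple_functionD(1)[OF \<tau>])
  have BE: "fst b \<in> carrier E" "snd b \<in> carrier E" if "b \<in> ?B" for b using that car by auto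
  let ?m = "\<lambda>b. complex_of_real (measure M {x \<in> space M. ?\<tau> x = b})"
  have "simple_integral_in E M (\<lambda>x. s x \<oplus> t x) = (\<Oplus>b\<in>?B. ?m b \<odot> (fst b \<oplus> snd b))"
    by (rule simple_integral_refine[OF s(3) \<tau> fB]) (use BE in auto)
  also have "\<dots> = (\<Oplus>b\<in>?B. ?m b \<odot> fst b \<oplus> ?m b \<odot> snd b)"
    by (rule M.finsum_cong'[OF refl]) (use BE in \<open>auto simp: smult_add_right\<close>)
  also have "\<dots> = (\<Oplus>b\<in>?B. ?m b \<odot> fst b) \<oplus> (\<Oplus>b\<in>?B. ?m b \<odot> snd b)"
    by (rule M.finsum_addf) (use BE in auto)
  also have "(\<Oplus>b\<in>?B. ?m b \<odot> fst b) = simple_integral_in E M s"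
    by (rule simple_integral_refine[OF s(1) \<tau> fB, symmetric]) (use BE in auto)
  also have "(\<Oplus>b\<in>?B. ?m b \<odot> snd b) = simple_integral_in E M t"
    by (rule simple_integral_refine[OF s(2) \<tau> fB, symmetric]) (use BE in auto)
  finally show ?thesis .
qed

lemma simple_integral_smult:
  assumes s: "simple_integrable_in E M s" "simple_integrable_in E M (\<lambda>x. c \<odot> s x)"
  shows "simple_integral_in E M (\<lambda>x. c \<odot> s x) = c \<odot> simple_integral_in E M s"
proof -
  have sf: "simple_function M s" and car: "s ` space M \<subseteq> carrier E"
    using s by (auto simp: simple_integrable_in_def)
  let ?B = "s ` space M"
  have fB: "finite ?B" by (rule simple_functionD(1)[OF sf])
  let ?m = "\<lambda>b. complex_of_real (measure M {x \<in> space M. s x = b})"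
  have "simple_integral_in E M (\<lambda>x. c \<odot> s x) = (\<Oplus>b\<in>?B. ?m b \<odot> (c \<odot> b))"
    by (rule simple_integral_refine[OF s(2) sf fB]) (use car in auto)
  also have "\<dots> = (\<Oplus>b\<in>?B. c \<odot> (?m b \<odot> b))"
    by (rule M.finsum_cong'[OF refl]) (use car in \<open>auto simp: smult_mult[symmetric] mult.commute\<close>)
  also have "\<dots> = c \<odot> (\<Oplus>b\<in>?B. ?m b \<odot> b)"
    by (rule finsum_smult_ldistr[symmetric]) (use fB car in auto)
  finally show ?thesis by (simp add: simple_integral_in_def)
qed

text \<open>The usual estimate of a Bochner integral, for simple functions.\<close>

lemma simple_integral_bound:
  assumes s: "simple_integrable_in E M s" and A: "A \<in> sets M" "emeasure M A < \<infinity>"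
    and z: "\<And>x. x \<notin> A \<Longrightarrow> s x = \<zero>" and le: "\<And>x. x \<in> A \<Longrightarrow> nrm E (s x) \<le> \<delta>" and d: "0 \<le> \<delta>"
  shows "nrm E (simple_integral_in E M s) \<le> \<delta> * measure M A"
proof -
  have sf: "simple_function M s" and car: "s ` space M \<subseteq> carrier E"
    using s by (auto simp: simple_integrable_in_def)
  let ?B = "s ` space M"
  have fB: "finite ?B" by (rule simple_functionD(1)[OF sf])
  let ?S = "\<lambda>b. {x \<in> space M. s x = b}"
  have Ss: "?S b \<in> sets M" for b
  proof -
    have "?S b = s -` {b} \<inter> space M" by auto
    then show ?thesis using simple_functionD(2)[OF sf, of "{b}"] by simp
  qed
  have "nrm E (simple_integral_in E M s) \<le> (\<Sum>b\<in>?B. nrm E (complex_of_real (measure M (?S b)) \<odot> b))"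
    unfolding simple_integral_in_def by (rule nrm_finsum[OF fB]) (use car in auto)
  also have "\<dots> \<le> (\<Sum>b\<in>?B. \<delta> * measure M (?S b \<inter> A))"
  proof (rule sum_mono)
    fix b assume b: "b \<in> ?B"
    then have bE: "b \<in> carrier E" using car by blast
    show "nrm E (complex_of_real (measure M (?S b)) \<odot> b) \<le> \<delta> * measure M (?S b \<inter> A)"
    proof (cases "b = \<zero>")
      case True
      then show ?thesis using d by simp
    next
      case False
      then have eq: "?S b \<inter> A = ?S b" using z by blast
      have "nrm E b \<le> \<delta>" using b False z le by blast
      then show ?thesis unfolding eq using bE by (simp add: nrm_smult mult.commute mult_right_mono)
    qed
  qed
  also have "\<dots> = \<delta> * (\<Sum>b\<in>?B. measure M (?S b \<inter> A))" by (simp add: sum_distrib_left)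
  also have "(\<Sum>b\<in>?B. measure M (?S b \<inter> A)) = measure M (\<Union>b\<in>?B. ?S b \<inter> A)"
  proof (rule measure_finite_Union[OF fB, symmetric])
    show "(\<lambda>b. ?S b \<inter> A) ` ?B \<subseteq> sets M" using Ss A by auto
    show "disjoint_family_on (\<lambda>b. ?S b \<inter> A) ?B" by (auto simp: disjoint_family_on_def)
    show "emeasure M (?S b \<inter> A) \<noteq> \<infinity>" for b
      using emeasure_mono[of "?S b \<inter> A" A M] A by (auto simp: top_unique)
  qed
  also have "(\<Union>b\<in>?B. ?S b \<inter> A) = A" using sets.sets_into_space[OF A(1)] by auto
  finally show ?thesis .
qed

lemma simple_integral_diff_bound:
  assumes s: "simple_function M s" "\<And>x. s x \<in> carrier E" "\<And>x. x \<notin> A \<Longrightarrow> s x = \<zero>"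
    and t: "simple_function M t" "\<And>x. t x \<in> carrier E" "\<And>x. x \<notin> A \<Longrightarrow> t x = \<zero>"
    and A: "A \<in> sets M" "emeasure M A < \<infinity>"
    and le: "\<And>x. x \<in> A \<Longrightarrow> nrm E (s x \<ominus> t x) \<le> \<delta>" and d: "0 \<le> \<delta>"
  shows "nrm E (simple_integral_in E M s \<ominus> simple_integral_in E M t) \<le> \<delta> * measure M A"
proof -
  have si: "simple_integrable_in E M s" by (rule simple_integrable_inI[OF s(1,2) A s(3)])
  have ti: "simple_integrable_in E M t" by (rule simple_integrable_inI[OF t(1,2) A t(3)])
  have mti: "simple_integrable_in E M (\<lambda>x. (-1) \<odot> t x)"
    by (rule simple_integrable_inI[OF simple_function_compose1[OF t(1)] _ A]) (use t in auto)
  have di: "simple_integrable_in E M (\<lambda>x. s x \<oplus> (-1) \<odot> t x)"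
    by (rule simple_integrable_inI[OF simple_function_compose2[OF s(1) t(1), of "\<lambda>a b. a \<oplus> (-1) \<odot> b"] _ A])
       (use s t in auto)
  have "simple_integral_in E M (\<lambda>x. s x \<oplus> (-1) \<odot> t x) = simple_integral_in E M s \<oplus> (-1) \<odot> simple_integral_in E M t"
    by (simp only: simple_integral_add[OF si mti di] simple_integral_smult[OF ti mti])
  also have "\<dots> = simple_integral_in E M s \<ominus> simple_integral_in E M t"
    using simple_integral_in_carrier[OF ti] by (simp add: a_minus_def smult_minus_1)
  finally have eq: "simple_integral_in E M (\<lambda>x. s x \<oplus> (-1) \<odot> t x) = simple_integral_in E M s \<ominus> simple_integral_in E M t" .
  show ?thesis
    unfolding eq[symmetric]
    by (rule simple_integral_bound[OF di A _ _ d]) (use s t le in \<open>auto simp: a_minus_def smult_minus_1\<close>)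
qed

end

section \<open>Cyclic subrepresentations\<close>

text \<open>Otherwise every compact set, being covered by finitely many translates of a null open set, would be
  null, and by inner regularity so would be the whole group.\<close>

lemma haar_open_positive:
  fixes \<mu> :: "'g::{topological_group_add, t2_space} measure"
  assumes h: "left_haar_measure \<mu>" and U: "open U" "x \<in> U"
  shows "emeasure \<mu> U \<noteq> 0"
proof
  assume U0: "emeasure \<mu> U = 0"
  have sets: "sets \<mu> = sets borel" and space: "space \<mu> = UNIV" by (rule haar_sets[OF h], rule haar_space[OF h])
  let ?T = "\<lambda>a. (\<lambda>y. a + y) -` U"
  have T: "open (?T a)" for a by (rule open_vimage[OF U(1) continuous_translation])
  have T0: "emeasure \<mu> (?T a) = 0" for a
  proof -
    have "emeasure \<mu> (?T a) = emeasure (distr \<mu> \<mu> (\<lambda>y. a + y)) U"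
      using emeasure_distr[OF haar_translation_measurable[OF h, of a], of U] U(1) sets space by simp
    then show ?thesis using U0 by (simp only: haar_distr_translation[OF h])
  qed
  have "emeasure \<mu> K = 0" if K: "compact K" for K
  proof -
    have cov: "K \<subseteq> (\<Union>y\<in>K. ?T (x + - y))"
    proof
      fix y assume y: "y \<in> K"
      have "(x + - y) + y = x" by (simp only: add.assoc left_minus add_0_right)
      then have "y \<in> ?T (x + - y)" using U(2) by simp
      then show "y \<in> (\<Union>y\<in>K. ?T (x + - y))" using y by blast
    qed
    obtain D where D: "D \<subseteq> K" "finite D" "K \<subseteq> (\<Union>y\<in>D. ?T (x + - y))"
      by (rule compactE_image[OF K T cov])
    have Ts: "?T a \<in> sets \<mu>" for a using T sets by simp
    have "emeasure \<mu> K \<le> emeasure \<mu> (\<Union>y\<in>D. ?T (x + - y))"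
      using D(2) Ts by (intro emeasure_mono[OF D(3)] sets.finite_UN) auto
    also have "\<dots> \<le> (\<Sum>y\<in>D. emeasure \<mu> (?T (x + - y)))"
      using D(2) Ts by (intro emeasure_subadditive_finite) auto
    finally show ?thesis by (simp add: T0)
  qed
  then have "(SUP K\<in>{K. compact K \<and> K \<subseteq> UNIV}. emeasure \<mu> K) \<le> 0" by (intro SUP_least) simp
  then have "emeasure \<mu> UNIV \<le> 0" using haar_inner[OF h open_UNIV] by simp
  then show False using haar_nonzero[OF h] by simp
qed

text \<open>The linear span of the orbit, built up one summand at a time, because every property of
  it below is proved by adding a summand.\<close>

inductive_set orbit_span ::
  "'e cnspace \<Rightarrow> ('g \<Rightarrow> 'e \<Rightarrow> 'e) \<Rightarrow> 'e \<Rightarrow> 'e set"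
  for E :: "'e cnspace" and \<pi> :: "'g \<Rightarrow> 'e \<Rightarrow> 'e" and \<xi> :: 'e where
  zero: "\<zero>\<^bsub>E\<^esub> \<in> orbit_span E \<pi> \<xi>"
| step: "v \<in> orbit_span E \<pi> \<xi> \<Longrightarrow> v \<oplus>\<^bsub>E\<^esub> c \<odot>\<^bsub>E\<^esub> \<pi> x \<xi> \<in> orbit_span E \<pi> \<xi>"

context isometric_representation
begin

text \<open>\<open>step_integral \<mu> \<xi> f w\<close>: the Bochner integral of \<open>f(x) \<pi>(x) \<xi>\<close> is \<open>w\<close> for the step function
  \<open>f\<close>, in a form that is stable under sums without any measurability of norms: the
  approximating simple functions converge uniformly and vanish off one set of finite measure.\<close>

definition step_integral :: "'g measure \<Rightarrow> 'e \<Rightarrow> ('g \<Rightarrow> complex) \<Rightarrow> 'e \<Rightarrow> bool" where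
  "step_integral \<mu> \<xi> f w \<longleftrightarrow> simple_function \<mu> f \<and> w \<in> carrier E \<and>
     (\<exists>A C s. A \<in> sets \<mu> \<and> emeasure \<mu> A < \<infinity> \<and> 0 \<le> C \<and> (\<forall>x. x \<notin> A \<longrightarrow> f x = 0) \<and>
        (\<forall>i::nat. simple_function \<mu> (s i) \<and> (\<forall>x. s i x \<in> carrier E) \<and> (\<forall>x. x \<notin> A \<longrightarrow> s i x = \<zero>) \<and>
           (\<forall>x\<in>A. nrm E (f x \<odot> \<pi> x \<xi> \<ominus> s i x) \<le> C * (1 / (real i + 1)))) \<and>
        (\<lambda>i. nrm E (simple_integral_in E \<mu> (s i) \<ominus> w)) \<longlonglongrightarrow> 0)"

lemma step_integralI:
  assumes "simple_function \<mu> f" "w \<in> carrier E" "A \<in> sets \<mu>" "emeasure \<mu> A < \<infinity>" "0 \<le> C"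
    "\<And>x. x \<notin> A \<Longrightarrow> f x = 0" "\<And>i::nat. simple_function \<mu> (s i)" "\<And>i x. s i x \<in> carrier E"
    "\<And>i x. x \<notin> A \<Longrightarrow> s i x = \<zero>"
    "\<And>i x. x \<in> A \<Longrightarrow> nrm E (f x \<odot> \<pi> x \<xi> \<ominus> s i x) \<le> C * (1 / (real i + 1))"
    "(\<lambda>i. nrm E (simple_integral_in E \<mu> (s i) \<ominus> w)) \<longlonglongrightarrow> 0"
  shows "step_integral \<mu> \<xi> f w"
  unfolding step_integral_def
  by (intro conjI exI[of _ A] exI[of _ C] exI[of _ s] allI impI ballI assms)

lemma step_integralE:
  assumes "step_integral \<mu> \<xi> f w"
  obtains A C s where "simple_function \<mu> f" "w \<in> carrier E" "A \<in> sets \<mu>" "emeasure \<mu> A < \<infinity>" "0 \<le> C"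
    "\<forall>x. x \<notin> A \<longrightarrow> f x = 0" "\<forall>i::nat. simple_function \<mu> (s i)" "\<forall>i x. s i x \<in> carrier E"
    "\<forall>i x. x \<notin> A \<longrightarrow> s i x = \<zero>"
    "\<forall>i. \<forall>x\<in>A. nrm E (f x \<odot> \<pi> x \<xi> \<ominus> s i x) \<le> C * (1 / (real i + 1))"
    "(\<lambda>i. nrm E (simple_integral_in E \<mu> (s i) \<ominus> w)) \<longlonglongrightarrow> 0"
proof -
  obtain A C s where *: "A \<in> sets \<mu>" "emeasure \<mu> A < \<infinity>" "0 \<le> C" "\<forall>x. x \<notin> A \<longrightarrow> f x = 0"
      "(\<lambda>i. nrm E (simple_integral_in E \<mu> (s i) \<ominus> w)) \<longlonglongrightarrow> 0"
    and s: "\<forall>i::nat. simple_function \<mu> (s i) \<and> (\<forall>x. s i x \<in> carrier E) \<and> (\<forall>x. x \<notin> A \<longrightarrow> s i x = \<zero>) \<and>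
      (\<forall>x\<in>A. nrm E (f x \<odot> \<pi> x \<xi> \<ominus> s i x) \<le> C * (1 / (real i + 1)))"
    using assms unfolding step_integral_def by (elim conjE exE) (rule that)
  have fw: "simple_function \<mu> f" "w \<in> carrier E" using assms by (auto simp: step_integral_def)
  have s': "\<forall>i. simple_function \<mu> (s i)" "\<forall>i x. s i x \<in> carrier E" "\<forall>i x. x \<notin> A \<longrightarrow> s i x = \<zero>"
    "\<forall>i. \<forall>x\<in>A. nrm E (f x \<odot> \<pi> x \<xi> \<ominus> s i x) \<le> C * (1 / (real i + 1))"
    using s by blast+
  show thesis by (rule that[OF fw *(1-4) s' *(5)])
qed

lemma step_integral_zero: "step_integral \<mu> \<xi> (\<lambda>x. 0) \<zero>"
proof (rule step_integralI[where A = "{}" and C = 0 and s = "\<lambda>i x. \<zero>"])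
  have si: "simple_integrable_in E \<mu> (\<lambda>x. \<zero>)"
    by (rule simple_integrable_inI[where A = "{}"]) auto
  have "nrm E (simple_integral_in E \<mu> (\<lambda>x. \<zero>)) \<le> 0 * measure \<mu> {}"
    by (rule simple_integral_bound[OF si]) auto
  then have "nrm E (simple_integral_in E \<mu> (\<lambda>x. \<zero>)) = 0"
    using nrm_nonneg[OF simple_integral_in_carrier[OF si]] by simp
  then have "nrm E (simple_integral_in E \<mu> (\<lambda>x. \<zero>) \<ominus> \<zero>) = 0"
    using simple_integral_in_carrier[OF si] by (simp add: diff_zero)
  then show "(\<lambda>i::nat. nrm E (simple_integral_in E \<mu> (\<lambda>x. \<zero>) \<ominus> \<zero>)) \<longlonglongrightarrow> 0" by simp
qed auto

lemma step_integral_add: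
  assumes \<xi>: "\<xi> \<in> carrier E" and f: "step_integral \<mu> \<xi> f w" and g: "step_integral \<mu> \<xi> g w'"
  shows "step_integral \<mu> \<xi> (\<lambda>x. f x + g x) (w \<oplus> w')"
proof -
  obtain A C s where F: "simple_function \<mu> f" "w \<in> carrier E" "A \<in> sets \<mu>" "emeasure \<mu> A < \<infinity>" "0 \<le> C"
    "\<forall>x. x \<notin> A \<longrightarrow> f x = 0" "\<forall>i::nat. simple_function \<mu> (s i)" "\<forall>i x. s i x \<in> carrier E"
    "\<forall>i x. x \<notin> A \<longrightarrow> s i x = \<zero>"
    "\<forall>i. \<forall>x\<in>A. nrm E (f x \<odot> \<pi> x \<xi> \<ominus> s i x) \<le> C * (1 / (real i + 1))"
    "(\<lambda>i. nrm E (simple_integral_in E \<mu> (s i) \<ominus> w)) \<longlonglongrightarrow> 0"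
    using f by (rule step_integralE)
  obtain A' C' t where G: "simple_function \<mu> g" "w' \<in> carrier E" "A' \<in> sets \<mu>" "emeasure \<mu> A' < \<infinity>" "0 \<le> C'"
    "\<forall>x. x \<notin> A' \<longrightarrow> g x = 0" "\<forall>i::nat. simple_function \<mu> (t i)" "\<forall>i x. t i x \<in> carrier E"
    "\<forall>i x. x \<notin> A' \<longrightarrow> t i x = \<zero>"
    "\<forall>i. \<forall>x\<in>A'. nrm E (g x \<odot> \<pi> x \<xi> \<ominus> t i x) \<le> C' * (1 / (real i + 1))"
    "(\<lambda>i. nrm E (simple_integral_in E \<mu> (t i) \<ominus> w')) \<longlonglongrightarrow> 0"
    using g by (rule step_integralE)
  have Ff: "nrm E (f x \<odot> \<pi> x \<xi> \<ominus> s i x) \<le> C * (1 / (real i + 1))" for i x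
    using F(5,6,9,10) \<xi> by (cases "x \<in> A") auto
  have Gg: "nrm E (g x \<odot> \<pi> x \<xi> \<ominus> t i x) \<le> C' * (1 / (real i + 1))" for i x
    using G(5,6,9,10) \<xi> by (cases "x \<in> A'") auto
  have car: "s i x \<in> carrier E" "t i x \<in> carrier E" for i x using F(8) G(8) by auto
  have si: "simple_integrable_in E \<mu> (s i)" for i
    by (rule simple_integrable_inI[OF _ _ F(3,4)]) (use F in auto)
  have ti: "simple_integrable_in E \<mu> (t i)" for i
    by (rule simple_integrable_inI[OF _ _ G(3,4)]) (use G in auto)
  have st: "simple_function \<mu> (\<lambda>x. s i x \<oplus> t i x)" for i
    by (rule simple_function_compose2[where h = "\<lambda>a b. a \<oplus> b"]) (use F G in auto)
  have A: "A \<union> A' \<in> sets \<mu>" using F G by auto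
  have Af: "emeasure \<mu> (A \<union> A') < \<infinity>"
    using emeasure_subadditive[OF F(3) G(3)] F(4) G(4) by (auto intro: le_less_trans simp: ennreal_add_eq_top less_top)
  have sti: "simple_integrable_in E \<mu> (\<lambda>x. s i x \<oplus> t i x)" for i
    by (rule simple_integrable_inI[OF st _ A Af]) (use F G car in auto)
  note Is = simple_integral_in_carrier[OF si] and It = simple_integral_in_carrier[OF ti]
  show ?thesis
  proof (rule step_integralI[where A = "A \<union> A'" and C = "C + C'" and s = "\<lambda>i x. s i x \<oplus> t i x"])
    show "simple_function \<mu> (\<lambda>x. f x + g x)" by (intro simple_function_add F G)
    show "nrm E ((f x + g x) \<odot> \<pi> x \<xi> \<ominus> (s i x \<oplus> t i x)) \<le> (C + C') * (1 / (real i + 1))" for i x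
    proof -
      have e: "(f x + g x) \<odot> \<pi> x \<xi> \<ominus> (s i x \<oplus> t i x) = (f x \<odot> \<pi> x \<xi> \<ominus> s i x) \<oplus> (g x \<odot> \<pi> x \<xi> \<ominus> t i x)"
        using \<xi> car by (simp add: smult_add_left add_diff_add)
      have "nrm E ((f x + g x) \<odot> \<pi> x \<xi> \<ominus> (s i x \<oplus> t i x))
          \<le> nrm E (f x \<odot> \<pi> x \<xi> \<ominus> s i x) + nrm E (g x \<odot> \<pi> x \<xi> \<ominus> t i x)"
        unfolding e using \<xi> car by (intro nrm_triangle) auto
      also have "\<dots> \<le> C * (1 / (real i + 1)) + C' * (1 / (real i + 1))" by (rule add_mono[OF Ff Gg])
      finally show ?thesis by (simp only: distrib_right)
    qed
    have b: "nrm E (simple_integral_in E \<mu> (\<lambda>x. s i x \<oplus> t i x) \<ominus> (w \<oplus> w'))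
        \<le> nrm E (simple_integral_in E \<mu> (s i) \<ominus> w) + nrm E (simple_integral_in E \<mu> (t i) \<ominus> w')" for i
      unfolding simple_integral_add[OF si ti sti] add_diff_add[OF Is It F(2) G(2)]
      using Is It F(2) G(2) by (intro nrm_triangle) auto
    show "(\<lambda>i. nrm E (simple_integral_in E \<mu> (\<lambda>x. s i x \<oplus> t i x) \<ominus> (w \<oplus> w'))) \<longlonglongrightarrow> 0"
    proof (rule real_tendsto_sandwich[OF _ _ tendsto_const])
      show "\<forall>\<^sub>F i in sequentially. 0 \<le> nrm E (simple_integral_in E \<mu> (\<lambda>x. s i x \<oplus> t i x) \<ominus> (w \<oplus> w'))"
        using simple_integral_in_carrier[OF sti] F(2) G(2) by (intro always_eventually allI nrm_nonneg) auto
      show "\<forall>\<^sub>F i in sequentially. nrm E (simple_integral_in E \<mu> (\<lambda>x. s i x \<oplus> t i x) \<ominus> (w \<oplus> w'))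
        \<le> nrm E (simple_integral_in E \<mu> (s i) \<ominus> w) + nrm E (simple_integral_in E \<mu> (t i) \<ominus> w')"
        using b by (intro always_eventually allI)
      show "(\<lambda>i. nrm E (simple_integral_in E \<mu> (s i) \<ominus> w) + nrm E (simple_integral_in E \<mu> (t i) \<ominus> w')) \<longlonglongrightarrow> 0"
        using tendsto_add[OF F(11) G(11)] by simp
    qed
  qed (use F G A Af car st in auto)
qed

lemma step_integral_L1_orbit:
  fixes \<mu> :: "'g measure"
  assumes h: "left_haar_measure \<mu>" and \<xi>: "\<xi> \<in> carrier E" and f: "step_integral \<mu> \<xi> f w"
  shows "w \<in> L1_orbit \<mu> E \<pi> \<xi>"
proof -
  have sets: "sets \<mu> = sets borel" and space: "space \<mu> = UNIV" by (rule haar_sets[OF h], rule haar_space[OF h])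
  obtain A C s where F: "simple_function \<mu> f" "w \<in> carrier E" "A \<in> sets \<mu>" "emeasure \<mu> A < \<infinity>" "0 \<le> C"
    "\<forall>x. x \<notin> A \<longrightarrow> f x = 0" "\<forall>i::nat. simple_function \<mu> (s i)" "\<forall>i x. s i x \<in> carrier E"
    "\<forall>i x. x \<notin> A \<longrightarrow> s i x = \<zero>"
    "\<forall>i. \<forall>x\<in>A. nrm E (f x \<odot> \<pi> x \<xi> \<ominus> s i x) \<le> C * (1 / (real i + 1))"
    "(\<lambda>i. nrm E (simple_integral_in E \<mu> (s i) \<ominus> w)) \<longlonglongrightarrow> 0"
    using f by (rule step_integralE)
  have si: "simple_integrable_in E \<mu> (s i)" for i
    by (rule simple_integrable_inI[OF _ _ F(3,4)]) (use F in auto)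
  note Is = simple_integral_in_carrier[OF si]
  obtain c where c: "0 \<le> c" "\<And>x. cmod (f x) \<le> c" using simple_bounded[OF F(1) space] by blast
  have int: "integrable \<mu> f"
  proof (rule Bochner_Integration.integrable_bound)
    show "integrable \<mu> (\<lambda>x. c * indicator A x)"
      using F(3,4) by (intro integrable_mult_right) (simp add: integrable_indicator_iff space less_top)
    show "f \<in> borel_measurable \<mu>" by (rule borel_measurable_simple_function[OF F(1)])
    show "AE x in \<mu>. norm (f x) \<le> norm (c * indicator A x)"
      using c F(6) by (intro AE_I2) (auto simp: indicator_def)
  qed
  have "has_integral_in E \<mu> (\<lambda>x. f x \<odot> \<pi> x \<xi>) w"
    unfolding has_integral_in_def
  proof (intro conjI allI impI exI[of _ s])
    show "(\<lambda>x. f x \<odot> \<pi> x \<xi>) \<in> space \<mu> \<rightarrow> carrier E" using \<xi> by auto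
    show "simple_integrable_in E \<mu> (s i)" for i by (rule si)
    fix U assume U: "openin (ntopology E) U"
    have op: "open {x. a \<odot> \<pi> x \<xi> \<in> U}" for a
    proof -
      have "\<forall>V. openin (ntopology E) V \<longrightarrow> open {x. \<pi> x (a \<odot> \<xi>) \<in> V}"
        using rep \<xi> by (simp add: representation_def continuous_map_def)
      then show ?thesis using U \<xi> by (simp add: pi_smult)
    qed
    have "{x \<in> space \<mu>. f x \<odot> \<pi> x \<xi> \<in> U} = (\<Union>a\<in>f ` space \<mu>. (f -` {a} \<inter> space \<mu>) \<inter> {x. a \<odot> \<pi> x \<xi> \<in> U})"
      by auto
    moreover have "(f -` {a} \<inter> space \<mu>) \<inter> {x. a \<odot> \<pi> x \<xi> \<in> U} \<in> sets \<mu>" for a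
      by (rule sets.Int[OF simple_functionD(2)[OF F(1)]]) (simp only: sets borel_open[OF op])
    ultimately show "{x \<in> space \<mu>. f x \<odot> \<pi> x \<xi> \<in> U} \<in> sets \<mu>"
      using simple_functionD(1)[OF F(1)] by (simp only: sets.finite_UN)
  next
    have le: "(\<integral>\<^sup>+ x. ennreal (nrm E (f x \<odot> \<pi> x \<xi> \<ominus> s i x)) \<partial>\<mu>) \<le> ennreal (C * (1 / (real i + 1)) * measure \<mu> A)" for i
    proof -
      have "(\<integral>\<^sup>+ x. ennreal (nrm E (f x \<odot> \<pi> x \<xi> \<ominus> s i x)) \<partial>\<mu>)
          \<le> (\<integral>\<^sup>+ x. ennreal (C * (1 / (real i + 1))) * indicator A x \<partial>\<mu>)"
      proof (rule nn_integral_mono)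
        fix x
        show "ennreal (nrm E (f x \<odot> \<pi> x \<xi> \<ominus> s i x)) \<le> ennreal (C * (1 / (real i + 1))) * indicator A x"
          using F(6,9,10) \<xi> by (cases "x \<in> A") (auto intro: ennreal_leI)
      qed
      also have "\<dots> = ennreal (C * (1 / (real i + 1))) * emeasure \<mu> A"
        using F(3) by (rule nn_integral_cmult_indicator)
      also have "\<dots> = ennreal (C * (1 / (real i + 1)) * measure \<mu> A)"
      proof -
        have "emeasure \<mu> A = ennreal (measure \<mu> A)"
          using F(4) by (intro emeasure_eq_ennreal_measure) auto
        then show ?thesis using F(5) by (simp only:) (intro ennreal_mult[symmetric], auto)
      qed
      finally show ?thesis .
    qed
    have "(\<lambda>i. C * (1 / (real i + 1)) * measure \<mu> A) \<longlonglongrightarrow> C * 0 * measure \<mu> A"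
      using LIMSEQ_inverse_real_of_nat
      by (intro tendsto_intros) (simp add: inverse_eq_divide add.commute)
    then have "(\<lambda>i. ennreal (C * (1 / (real i + 1)) * measure \<mu> A)) \<longlonglongrightarrow> ennreal 0"
      by (intro tendsto_ennrealI) simp
    then have lim: "(\<lambda>i. ennreal (C * (1 / (real i + 1)) * measure \<mu> A)) \<longlonglongrightarrow> 0" by simp
    show "(\<lambda>i. \<integral>\<^sup>+ x. ennreal (nrm E (f x \<odot> \<pi> x \<xi> \<ominus> s i x)) \<partial>\<mu>) \<longlonglongrightarrow> 0"
      by (rule tendsto_sandwich[OF _ _ tendsto_const lim]) (use le in auto)
    show "limitin (ntopology E) (\<lambda>i. simple_integral_in E \<mu> (s i)) w sequentially"
      unfolding ntopology_def N.limitin_metric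
    proof (intro conjI allI impI F(2))
      fix e :: real assume e: "0 < e"
      have "\<forall>\<^sub>F i in sequentially. nrm E (simple_integral_in E \<mu> (s i) \<ominus> w) < e"
        by (rule order_tendstoD(2)[OF F(11) e])
      then show "\<forall>\<^sub>F i in sequentially. simple_integral_in E \<mu> (s i) \<in> carrier E
          \<and> ndist E (simple_integral_in E \<mu> (s i)) w < e"
        by eventually_elim (use Is F(2) in \<open>simp add: ndist_def\<close>)
    qed
  qed
  with int show ?thesis unfolding L1_orbit_def by blast
qed

text \<open>On a relatively compact open set the orbit map has totally bounded range, so finite-valued
  selectors approximate it uniformly. Their integrals form a Cauchy sequence, and comparison with
  the constant function \<open>c \<pi>(x) \<xi>\<close> shows where the limit lies.\<close>

lemma step_integral_atom:
  fixes \<mu> :: "'g::{topological_group_add, t2_space} measure"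
  assumes B: "complex_banach_space E" and h: "left_haar_measure \<mu>" and \<xi>: "\<xi> \<in> carrier E"
    and A: "open A" "A \<subseteq> K" "compact K"
    and near: "\<And>y. y \<in> A \<Longrightarrow> nrm E (\<pi> y \<xi> \<ominus> \<pi> x \<xi>) \<le> \<delta>" and d: "0 \<le> \<delta>"
  obtains w where "step_integral \<mu> \<xi> (\<lambda>y. if y \<in> A then c else 0) w"
    "nrm E (w \<ominus> (c * complex_of_real (measure \<mu> A)) \<odot> \<pi> x \<xi>) \<le> cmod c * \<delta> * measure \<mu> A"
proof -
  have sets: "sets \<mu> = sets borel" and space: "space \<mu> = UNIV" by (rule haar_sets[OF h], rule haar_space[OF h])
  have As: "A \<in> sets \<mu>" using A(1) sets by simp
  have Asp: "A \<inter> space \<mu> \<in> sets \<mu>" using As space by simp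
  have Af: "emeasure \<mu> A < \<infinity>"
    using emeasure_mono[OF A(2), of \<mu>] haar_compact_sets[OF h A(3)] haar_compact_finite[OF h A(3)]
    by (auto intro: le_less_trans)
  let ?m = "measure \<mu> A"
  have "\<forall>i::nat. \<exists>r :: 'g \<Rightarrow> 'g. simple_function borel r \<and>
      (\<forall>z\<in>K. nrm E (\<pi> z \<xi> \<ominus> \<pi> (r z) \<xi>) \<le> 1 / (real i + 1))"
  proof
    fix i :: nat
    have pos: "0 < 1 / (real i + 1)" by simp
    have "\<exists>U. open U \<and> y \<in> U \<and> (\<forall>z\<in>U. nrm E (\<pi> z \<xi> \<ominus> \<pi> y \<xi>) \<le> 1 / (real i + 1))" for y
    proof -
      obtain U where "open U" "y \<in> U" "\<And>z. z \<in> U \<Longrightarrow> nrm E (\<pi> z \<xi> \<ominus> \<pi> y \<xi>) < 1 / (real i + 1)"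
        using pi_continuous[OF \<xi> pos, of y] by blast
      then show ?thesis by (intro exI[of _ U]) (auto intro: less_imp_le)
    qed
    then show "\<exists>r :: 'g \<Rightarrow> 'g. simple_function borel r \<and>
      (\<forall>z\<in>K. nrm E (\<pi> z \<xi> \<ominus> \<pi> (r z) \<xi>) \<le> 1 / (real i + 1))"
      by (rule measurable_selector[OF A(3), of "\<lambda>y z. nrm E (\<pi> z \<xi> \<ominus> \<pi> y \<xi>) \<le> 1 / (real i + 1)"]) blast
  qed
  from choice[OF this] obtain r :: "nat \<Rightarrow> 'g \<Rightarrow> 'g" where "\<forall>i. simple_function borel (r i) \<and>
      (\<forall>z\<in>K. nrm E (\<pi> z \<xi> \<ominus> \<pi> (r i z) \<xi>) \<le> 1 / (real i + 1))" ..
  then have r: "\<And>i. simple_function borel (r i)"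
    "\<And>i z. z \<in> A \<Longrightarrow> nrm E (\<pi> z \<xi> \<ominus> \<pi> (r i z) \<xi>) \<le> 1 / (real i + 1)" using A(2) by auto
  have r\<mu>: "simple_function \<mu> (r i)" for i using r(1)[of i] space sets by (simp add: simple_function_def)
  define s where "s i y = (if y \<in> A then c \<odot> \<pi> (r i y) \<xi> else \<zero>)" for i y
  have s: "simple_function \<mu> (s i)" for i
    unfolding s_def[abs_def]
    by (intro simple_function_If_set simple_function_compose1[OF r\<mu>] simple_function_const Asp)
  have sE: "s i y \<in> carrier E" for i y using \<xi> by (simp add: s_def)
  have s0: "y \<notin> A \<Longrightarrow> s i y = \<zero>" for i y by (simp add: s_def)
  have sd: "nrm E (c \<odot> \<pi> y \<xi> \<ominus> s i y) \<le> cmod c * (1 / (real i + 1))" if y: "y \<in> A" for i y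
  proof -
    have "c \<odot> \<pi> y \<xi> \<ominus> s i y = c \<odot> (\<pi> y \<xi> \<ominus> \<pi> (r i y) \<xi>)" using y \<xi> by (simp add: s_def smult_diff)
    then have "nrm E (c \<odot> \<pi> y \<xi> \<ominus> s i y) = cmod c * nrm E (\<pi> y \<xi> \<ominus> \<pi> (r i y) \<xi>)"
      using \<xi> by (simp add: nrm_smult)
    then show ?thesis using r(2)[OF y, of i] by (simp only: mult_left_mono norm_ge_zero)
  qed
  define I where "I i = simple_integral_in E \<mu> (s i)" for i
  have IE: "I i \<in> carrier E" for i
    unfolding I_def by (rule simple_integral_in_carrier[OF simple_integrable_inI[OF s sE As Af s0]])
  have Idiff: "nrm E (I i \<ominus> I j) \<le> (cmod c * (1 / (real i + 1)) + cmod c * (1 / (real j + 1))) * ?m" for i j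
    unfolding I_def
  proof (rule simple_integral_diff_bound[OF s sE s0 s sE s0 As Af])
    fix y assume y: "y \<in> A"
    have cE: "c \<odot> \<pi> y \<xi> \<in> carrier E" using \<xi> by simp
    have "nrm E (s i y \<ominus> s j y) \<le> nrm E (s i y \<ominus> c \<odot> \<pi> y \<xi>) + nrm E (c \<odot> \<pi> y \<xi> \<ominus> s j y)"
      by (rule nrm_diff_triangle[OF sE cE sE])
    then show "nrm E (s i y \<ominus> s j y) \<le> cmod c * (1 / (real i + 1)) + cmod c * (1 / (real j + 1))"
      using sd[OF y, of i] sd[OF y, of j] nrm_diff_commute[OF sE[of i y] cE] by simp
  qed (auto intro!: add_nonneg_nonneg)
  have inv_lim: "(\<lambda>i. 1 / (real i + 1)) \<longlonglongrightarrow> 0"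
    using LIMSEQ_inverse_real_of_nat by (simp add: inverse_eq_divide add.commute)
  have "N.MCauchy I"
    unfolding N.MCauchy_def
  proof (intro conjI allI impI)
    show "range I \<subseteq> carrier E" using IE by blast
    fix e :: real assume e: "0 < e"
    have "(\<lambda>i. (cmod c * (1 / (real i + 1))) * ?m) \<longlonglongrightarrow> (cmod c * 0) * ?m"
      by (intro tendsto_intros inv_lim)
    then have "\<forall>\<^sub>F i in sequentially. (cmod c * (1 / (real i + 1))) * ?m < e / 2"
      by (rule order_tendstoD(2)) (use e in simp)
    then obtain n0 where n0: "\<And>i. n0 \<le> i \<Longrightarrow> (cmod c * (1 / (real i + 1))) * ?m < e / 2"
      unfolding eventually_sequentially by blast
    show "\<exists>n0. \<forall>i j. n0 \<le> i \<longrightarrow> n0 \<le> j \<longrightarrow> ndist E (I i) (I j) < e"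
    proof (intro exI[of _ n0] allI impI)
      fix i j assume ij: "n0 \<le> i" "n0 \<le> j"
      show "ndist E (I i) (I j) < e"
      proof -
        have "nrm E (I i \<ominus> I j) \<le> (cmod c * (1 / (real i + 1))) * ?m + (cmod c * (1 / (real j + 1))) * ?m"
          using Idiff[of i j] by (simp only: distrib_right)
        also have "\<dots> < e / 2 + e / 2" by (rule add_strict_mono[OF n0[OF ij(1)] n0[OF ij(2)]])
        finally show ?thesis using IE by (simp add: ndist_def)
      qed
    qed
  qed
  then obtain w where w: "limitin N.mtopology I w sequentially"
    using complex_banach_space.complete[OF B] unfolding N.mcomplete_def by blast
  have wE: "w \<in> carrier E" using w N.limitin_mspace by blast
  have wl: "(\<lambda>i. nrm E (I i \<ominus> w)) \<longlonglongrightarrow> 0"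
  proof (rule order_tendstoI)
    show "\<forall>\<^sub>F i in sequentially. a < nrm E (I i \<ominus> w)" if "a < 0" for a
    proof (rule always_eventually, rule allI)
      show "a < nrm E (I i \<ominus> w)" for i using that nrm_nonneg[OF diff_in[OF IE[of i] wE]] by linarith
    qed
    show "\<forall>\<^sub>F i in sequentially. nrm E (I i \<ominus> w) < a" if "0 < a" for a
    proof -
      have "\<forall>\<^sub>F i in sequentially. I i \<in> carrier E \<and> ndist E (I i) w < a"
        using w that unfolding N.limitin_metric by blast
      then show ?thesis by eventually_elim (simp add: ndist_def wE IE)
    qed
  qed
  define s' where "s' y = (if y \<in> A then c \<odot> \<pi> x \<xi> else \<zero>)" for y
  have s': "simple_function \<mu> s'"
    unfolding s'_def[abs_def] by (intro simple_function_If_set simple_function_const Asp)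
  have s'E: "s' y \<in> carrier E" for y using \<xi> by (simp add: s'_def)
  have s'0: "y \<notin> A \<Longrightarrow> s' y = \<zero>" for y by (simp add: s'_def)
  have s'i: "simple_integrable_in E \<mu> s'" by (rule simple_integrable_inI[OF s' s'E As Af s'0])
  have I': "simple_integral_in E \<mu> s' = (c * complex_of_real ?m) \<odot> \<pi> x \<xi>"
  proof -
    have t: "simple_function \<mu> (\<lambda>y. if y \<in> A then True else False)"
      by (intro simple_function_If_set simple_function_const Asp)
    have "simple_integral_in E \<mu> s' = (\<Oplus>b\<in>{True, False}.
       complex_of_real (measure \<mu> {y \<in> space \<mu>. (if y \<in> A then True else False) = b}) \<odot> (if b then c \<odot> \<pi> x \<xi> else \<zero>))"
      by (rule simple_integral_refine[OF s'i t]) (use \<xi> in \<open>auto simp: s'_def\<close>)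
    also have "\<dots> = complex_of_real ?m \<odot> (c \<odot> \<pi> x \<xi>)"
      using \<xi> by (simp add: M.finsum_insert space)
    finally show ?thesis using \<xi> by (simp add: smult_mult[symmetric] mult.commute)
  qed
  let ?v = "(c * complex_of_real ?m) \<odot> \<pi> x \<xi>"
  have vE: "?v \<in> carrier E" using \<xi> by simp
  have b1: "nrm E (I i \<ominus> ?v) \<le> (cmod c * (1 / (real i + 1)) + cmod c * \<delta>) * ?m" for i
    unfolding I_def I'[symmetric]
  proof (rule simple_integral_diff_bound[OF s sE s0 s' s'E s'0 As Af])
    fix y assume y: "y \<in> A"
    have cE: "c \<odot> \<pi> y \<xi> \<in> carrier E" using \<xi> by simp
    have "nrm E (s i y \<ominus> s' y) \<le> nrm E (s i y \<ominus> c \<odot> \<pi> y \<xi>) + nrm E (c \<odot> \<pi> y \<xi> \<ominus> s' y)"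
      by (rule nrm_diff_triangle[OF sE cE s'E])
    moreover have "c \<odot> \<pi> y \<xi> \<ominus> s' y = c \<odot> (\<pi> y \<xi> \<ominus> \<pi> x \<xi>)" using y \<xi> by (simp add: s'_def smult_diff)
    moreover have "nrm E (c \<odot> (\<pi> y \<xi> \<ominus> \<pi> x \<xi>)) \<le> cmod c * \<delta>"
      using near[OF y] \<xi> by (simp add: nrm_smult mult_left_mono)
    ultimately show "nrm E (s i y \<ominus> s' y) \<le> cmod c * (1 / (real i + 1)) + cmod c * \<delta>"
      using sd[OF y, of i] nrm_diff_commute[OF sE[of i y] cE] by simp
  qed (use d in \<open>auto intro!: add_nonneg_nonneg\<close>)
  have b2: "nrm E (w \<ominus> ?v) \<le> nrm E (I i \<ominus> w) + (cmod c * (1 / (real i + 1)) + cmod c * \<delta>) * ?m" for i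
    using nrm_diff_triangle[OF wE IE[of i] vE] b1[of i] nrm_diff_commute[OF wE IE[of i]] by simp
  have "(\<lambda>i. nrm E (I i \<ominus> w) + (cmod c * (1 / (real i + 1)) + cmod c * \<delta>) * ?m) \<longlonglongrightarrow> 0 + (cmod c * 0 + cmod c * \<delta>) * ?m"
    by (intro tendsto_intros wl inv_lim)
  then have "nrm E (w \<ominus> ?v) \<le> 0 + (cmod c * 0 + cmod c * \<delta>) * ?m"
    by (rule LIMSEQ_le_const) (use b2 in blast)
  then have close: "nrm E (w \<ominus> ?v) \<le> cmod c * \<delta> * ?m" by simp
  have "step_integral \<mu> \<xi> (\<lambda>y. if y \<in> A then c else 0) w"
  proof (rule step_integralI[OF _ wE As Af, where C = "cmod c" and s = s])
    show "simple_function \<mu> (\<lambda>y. if y \<in> A then c else 0)"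
      by (intro simple_function_If_set simple_function_const Asp)
    show "(\<lambda>i. nrm E (simple_integral_in E \<mu> (s i) \<ominus> w)) \<longlonglongrightarrow> 0" using wl by (simp only: I_def)
  qed (use s sE s0 sd in auto)
  from this close show thesis by (rule that)
qed

lemma orbit_span_in:
  assumes \<xi>: "\<xi> \<in> carrier E" and v: "v \<in> orbit_span E \<pi> \<xi>"
  shows "v \<in> carrier E"
  using v by (induction rule: orbit_span.induct) (use \<xi> in auto)

lemma orbit_span_add:
  assumes \<xi>: "\<xi> \<in> carrier E" and "v \<in> orbit_span E \<pi> \<xi>" "w \<in> orbit_span E \<pi> \<xi>"
  shows "v \<oplus> w \<in> orbit_span E \<pi> \<xi>"
  using assms(3)
proof (induction rule: orbit_span.induct)
  case zero
  then show ?case using assms(2) orbit_span_in[OF \<xi> assms(2)] by simp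
next
  case (step w c x)
  have "v \<oplus> (w \<oplus> c \<odot> \<pi> x \<xi>) = (v \<oplus> w) \<oplus> c \<odot> \<pi> x \<xi>"
    using orbit_span_in[OF \<xi>] assms(2) step.hyps \<xi> by (simp add: M.a_assoc)
  then show ?case using orbit_span.step[OF step.IH] by simp
qed

lemma orbit_span_smult:
  assumes \<xi>: "\<xi> \<in> carrier E" and "v \<in> orbit_span E \<pi> \<xi>"
  shows "a \<odot> v \<in> orbit_span E \<pi> \<xi>"
  using assms(2)
proof (induction rule: orbit_span.induct)
  case zero
  show ?case by (simp add: orbit_span.zero)
next
  case (step v c x)
  have "a \<odot> (v \<oplus> c \<odot> \<pi> x \<xi>) = a \<odot> v \<oplus> (a * c) \<odot> \<pi> x \<xi>"
    using orbit_span_in[OF \<xi>] step.hyps \<xi> by (simp add: smult_add_right smult_mult)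
  then show ?case using orbit_span.step[OF step.IH] by simp
qed

lemma orbit_span_pi:
  assumes \<xi>: "\<xi> \<in> carrier E" and "v \<in> orbit_span E \<pi> \<xi>"
  shows "\<pi> y v \<in> orbit_span E \<pi> \<xi>"
  using assms(2)
proof (induction rule: orbit_span.induct)
  case zero
  have "\<pi> y \<zero> = 0 \<odot> \<pi> y \<zero>" using pi_smult[of "\<zero>" y 0] by simp
  then show ?case by (simp add: orbit_span.zero)
next
  case (step v c x)
  have "\<pi> y (v \<oplus> c \<odot> \<pi> x \<xi>) = \<pi> y v \<oplus> c \<odot> \<pi> (y + x) \<xi>"
    using orbit_span_in[OF \<xi>] step.hyps \<xi> by (simp add: pi_add pi_smult pi_plus)
  then show ?case using orbit_span.step[OF step.IH] by simp
qed

end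

text \<open>Each \<open>c \<pi>(x) \<xi>\<close> is approximated by integrating the orbit against \<open>c / \<mu>(A)\<close> on a small
  neighbourhood \<open>A\<close> of \<open>x\<close>; the rest is linearity.\<close>

lemma (in isometric_representation) orbit_span_approximated:
  fixes \<mu> :: "'g::{topological_group_add, t2_space} measure"
  assumes lc: "locally_compact_space (euclidean :: 'g topology)"
    and B: "complex_banach_space E" and h: "left_haar_measure \<mu>" and \<xi>: "\<xi> \<in> carrier E"
    and v: "v \<in> orbit_span E \<pi> \<xi>" and e: "0 < \<epsilon>"
  shows "\<exists>f w. step_integral \<mu> \<xi> f w \<and> nrm E (v \<ominus> w) < \<epsilon>"
  using v e
proof (induction arbitrary: \<epsilon> rule: orbit_span.induct)
  case zero
  show ?case
    by (intro exI[of _ "\<lambda>x. 0"] exI[of _ "\<zero>"] conjI step_integral_zero) (use zero in simp)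
next
  case (step v c x)
  have vE: "v \<in> carrier E" by (rule orbit_span_in[OF \<xi> step.hyps])
  obtain f w where f: "step_integral \<mu> \<xi> f w" "nrm E (v \<ominus> w) < \<epsilon> / 2"
    using step.IH[of "\<epsilon> / 2"] step.prems by auto
  have wE: "w \<in> carrier E" using f(1) by (simp add: step_integral_def)
  define \<delta> where "\<delta> = (\<epsilon> / 2) / (cmod c + 1)"
  have c1: "0 < cmod c + 1" by (simp add: add_nonneg_pos)
  have d: "0 < \<delta>" using step.prems c1 by (simp add: \<delta>_def)
  have cd: "cmod c * \<delta> < \<epsilon> / 2"
  proof -
    have "cmod c * \<delta> < (cmod c + 1) * \<delta>" using d by simp
    also have "\<dots> = \<delta> * (cmod c + 1)" by (rule mult.commute)
    also have "\<dots> = \<epsilon> / 2"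
      by (rule nonzero_eq_divide_eq[THEN iffD1, OF _ \<delta>_def]) (use c1 in simp)
    finally show ?thesis .
  qed
  obtain U where U: "open U" "x \<in> U" "\<And>z. z \<in> U \<Longrightarrow> nrm E (\<pi> z \<xi> \<ominus> \<pi> x \<xi>) < \<delta>"
    using pi_continuous[OF \<xi> d, of x] by blast
  obtain V K where V: "open V" "x \<in> V" "V \<subseteq> K" "compact K"
  proof -
    have "\<forall>x. \<exists>V. open V \<and> (\<exists>K. compact K \<and> (x :: 'g) \<in> V \<and> V \<subseteq> K)"
      using lc by (simp add: locally_compact_space_def)
    then show thesis using that by blast
  qed
  let ?A = "U \<inter> V"
  have A: "open ?A" "x \<in> ?A" "?A \<subseteq> K" using U V by auto
  have As: "?A \<in> sets \<mu>" using A(1) haar_sets[OF h] by simp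
  have Af: "emeasure \<mu> ?A < \<infinity>"
    using emeasure_mono[OF A(3), of \<mu>] haar_compact_sets[OF h V(4)] haar_compact_finite[OF h V(4)]
    by (auto intro: le_less_trans)
  have "emeasure \<mu> ?A = ennreal (measure \<mu> ?A)"
    using Af by (intro emeasure_eq_ennreal_measure) auto
  then have "measure \<mu> ?A \<noteq> 0" using haar_open_positive[OF h A(1,2)] by auto
  then have m: "0 < measure \<mu> ?A" by (simp add: zero_less_measure_iff)
  let ?c = "c / complex_of_real (measure \<mu> ?A)"
  have near: "nrm E (\<pi> y \<xi> \<ominus> \<pi> x \<xi>) \<le> \<delta>" if "y \<in> ?A" for y using U(3)[of y] that by simp
  obtain w' where w': "step_integral \<mu> \<xi> (\<lambda>y. if y \<in> ?A then ?c else 0) w'"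
    "nrm E (w' \<ominus> (?c * complex_of_real (measure \<mu> ?A)) \<odot> \<pi> x \<xi>) \<le> cmod ?c * \<delta> * measure \<mu> ?A"
    using step_integral_atom[OF B h \<xi> A(1,3) V(4) near less_imp_le[OF d], of ?c] by blast
  have w'E: "w' \<in> carrier E" using w'(1) by (simp add: step_integral_def)
  have ceq: "?c * complex_of_real (measure \<mu> ?A) = c" "cmod ?c * \<delta> * measure \<mu> ?A = cmod c * \<delta>"
    using m by (auto simp: norm_divide)
  have n2: "nrm E (w' \<ominus> c \<odot> \<pi> x \<xi>) < \<epsilon> / 2" using w'(2) cd unfolding ceq by linarith
  have cE: "c \<odot> \<pi> x \<xi> \<in> carrier E" using \<xi> by simp
  have "nrm E ((v \<oplus> c \<odot> \<pi> x \<xi>) \<ominus> (w \<oplus> w')) \<le> nrm E (v \<ominus> w) + nrm E (c \<odot> \<pi> x \<xi> \<ominus> w')"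
    unfolding add_diff_add[OF vE cE wE w'E] by (rule nrm_triangle) (use vE cE wE w'E in auto)
  also have "\<dots> < \<epsilon>" using f(2) n2 nrm_diff_commute[OF w'E cE] by simp
  finally show ?case using step_integral_add[OF \<xi> f(1) w'(1)] by blast
qed

lemma (in isometric_representation) dense_span_cyclic:
  fixes \<mu> :: "'g::{topological_group_add, t2_space} measure"
  assumes lc: "locally_compact_space (euclidean :: 'g topology)"
    and B: "complex_banach_space E" and h: "left_haar_measure \<mu>" and \<xi>: "\<xi> \<in> carrier E"
    and dense: "\<And>v \<epsilon>. v \<in> carrier E \<Longrightarrow> 0 < \<epsilon> \<Longrightarrow> \<exists>w\<in>orbit_span E \<pi> \<xi>. nrm E (v \<ominus> w) < \<epsilon>"
  shows "ntopology E closure_of L1_orbit \<mu> E \<pi> \<xi> = carrier E"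
proof
  show "ntopology E closure_of L1_orbit \<mu> E \<pi> \<xi> \<subseteq> carrier E"
    using closure_of_subset_topspace[of "ntopology E"] by simp
  show "carrier E \<subseteq> ntopology E closure_of L1_orbit \<mu> E \<pi> \<xi>"
  proof
    fix v assume v: "v \<in> carrier E"
    show "v \<in> ntopology E closure_of L1_orbit \<mu> E \<pi> \<xi>"
      unfolding closure_of_def
    proof (intro CollectI conjI allI impI)
      show "v \<in> topspace (ntopology E)" using v by simp
      fix T assume T: "v \<in> T \<and> openin (ntopology E) T"
      then obtain r where r: "0 < r" "\<And>y. y \<in> carrier E \<Longrightarrow> nrm E (v \<ominus> y) < r \<Longrightarrow> y \<in> T"
        unfolding openin_ntopology by blast
      obtain u where u: "u \<in> orbit_span E \<pi> \<xi>" "nrm E (v \<ominus> u) < r / 2" using dense[OF v, of "r / 2"] r(1) by auto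
      have uE: "u \<in> carrier E" by (rule orbit_span_in[OF \<xi> u(1)])
      obtain f w where w: "step_integral \<mu> \<xi> f w" "nrm E (u \<ominus> w) < r / 2"
        using orbit_span_approximated[OF lc B h \<xi> u(1), of "r / 2"] r(1) by auto
      have wE: "w \<in> carrier E" using w(1) by (simp add: step_integral_def)
      have "nrm E (v \<ominus> w) < r" using nrm_diff_triangle[OF v uE wE] u(2) w(2) by simp
      then have "w \<in> T" by (rule r(2)[OF wE])
      with step_integral_L1_orbit[OF h \<xi> w(1)] show "\<exists>y\<in>L1_orbit \<mu> E \<pi> \<xi>. y \<in> T" by blast
    qed
  qed
qed

text \<open>The closed linear span of the orbit is invariant and inherits the presentation as a QSLp-space; the
  vector is cyclic in it because Bochner integrals along the orbit approximate the span.\<close>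

lemma cyclic_subrepresentation:
  fixes \<mu> :: "'g::{topological_group_add, t2_space} measure" and E :: "'e cnspace"
  assumes lc: "locally_compact_space (euclidean :: 'g topology)"
    and h: "left_haar_measure \<mu>" and q: "1 \<le> q" and R: "Rep TYPE('m) q E \<pi>" and \<xi>: "\<xi> \<in> carrier E"
  obtains F where "Cyc TYPE('m) \<mu> q (E\<lparr>carrier := F\<rparr>) \<pi>" "\<xi> \<in> F" "F \<subseteq> carrier E"
proof -
  have rep: "representation E \<pi>" and Q: "QSL_space TYPE('m) q E" using R by (auto simp: Rep_def)
  have B: "complex_banach_space E" using rep by (simp add: representation_def)
  interpret complex_normed_space E by (rule complex_banach_space.axioms(1)[OF B])
  interpret isometric_representation E \<pi> by unfold_locales (rule rep)
  define F where "F = {v \<in> carrier E. \<forall>\<epsilon>>0. \<exists>w\<in>orbit_span E \<pi> \<xi>. nrm E (v \<ominus>\<^bsub>E\<^esub> w) < \<epsilon>}"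
  have FE: "F \<subseteq> carrier E" by (auto simp: F_def)
  note spE = orbit_span_in[OF \<xi>]
  have span_F: "orbit_span E \<pi> \<xi> \<subseteq> F"
  proof
    fix v assume v: "v \<in> orbit_span E \<pi> \<xi>"
    have "nrm E (v \<ominus>\<^bsub>E\<^esub> v) = 0" using spE[OF v] by simp
    then show "v \<in> F" using spE[OF v] v by (auto simp: F_def intro!: bexI[of _ v])
  qed
  \<comment> \<open>Lipschitz maps that preserve the span preserve its closure\<close>
  have F_map: "T v \<in> F" if v: "v \<in> F" and T: "\<And>w. w \<in> carrier E \<Longrightarrow> T w \<in> carrier E"
      "\<And>w. w \<in> orbit_span E \<pi> \<xi> \<Longrightarrow> T w \<in> orbit_span E \<pi> \<xi>"
      "\<And>w u. w \<in> carrier E \<Longrightarrow> u \<in> carrier E \<Longrightarrow> nrm E (T w \<ominus>\<^bsub>E\<^esub> T u) \<le> C * nrm E (w \<ominus>\<^bsub>E\<^esub> u)"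
      and C: "0 \<le> C" for T v C
  proof -
    have vE: "v \<in> carrier E" using v FE by blast
    have "\<exists>w\<in>orbit_span E \<pi> \<xi>. nrm E (T v \<ominus>\<^bsub>E\<^esub> w) < \<epsilon>" if e: "0 < \<epsilon>" for \<epsilon>
    proof -
      have C1: "0 < C + 1" using C by simp
      have "0 < \<epsilon> / (C + 1)" using e C1 by simp
      then obtain w where w: "w \<in> orbit_span E \<pi> \<xi>" "nrm E (v \<ominus>\<^bsub>E\<^esub> w) < \<epsilon> / (C + 1)"
        using v unfolding F_def by blast
      have "nrm E (T v \<ominus>\<^bsub>E\<^esub> T w) \<le> C * nrm E (v \<ominus>\<^bsub>E\<^esub> w)" by (rule T(3)[OF vE spE[OF w(1)]])
      also have "\<dots> \<le> (C + 1) * nrm E (v \<ominus>\<^bsub>E\<^esub> w)"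
        using nrm_nonneg[OF diff_in[OF vE spE[OF w(1)]]] by (intro mult_right_mono) auto
      also have "\<dots> < (C + 1) * (\<epsilon> / (C + 1))" using w(2) C1 by (rule mult_strict_left_mono)
      finally show ?thesis using T(2)[OF w(1)] C1 by auto
    qed
    then show ?thesis using T(1)[OF vE] by (simp add: F_def)
  qed
  have F_smult: "c \<odot>\<^bsub>E\<^esub> v \<in> F" if v: "v \<in> F" for c v
    by (rule F_map[OF v, of "\<lambda>v. c \<odot>\<^bsub>E\<^esub> v" "cmod c"])
       (auto simp: orbit_span_smult[OF \<xi>] smult_diff[symmetric] nrm_smult)
  have F_pi: "\<pi> y v \<in> F" if v: "v \<in> F" for y v
    by (rule F_map[OF v, of "\<pi> y" 1]) (auto simp: orbit_span_pi[OF \<xi>] pi_diff[symmetric])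
  have F_add: "v \<oplus>\<^bsub>E\<^esub> u \<in> F" if v: "v \<in> F" and u: "u \<in> F" for v u
  proof -
    have vu: "v \<in> carrier E" "u \<in> carrier E" using v u FE by auto
    have "\<exists>w\<in>orbit_span E \<pi> \<xi>. nrm E ((v \<oplus>\<^bsub>E\<^esub> u) \<ominus>\<^bsub>E\<^esub> w) < \<epsilon>" if e: "0 < \<epsilon>" for \<epsilon>
    proof -
      have e2: "0 < \<epsilon> / 2" using e by simp
      obtain w where w: "w \<in> orbit_span E \<pi> \<xi>" "nrm E (v \<ominus>\<^bsub>E\<^esub> w) < \<epsilon> / 2" using v e2 unfolding F_def by blast
      obtain w' where w': "w' \<in> orbit_span E \<pi> \<xi>" "nrm E (u \<ominus>\<^bsub>E\<^esub> w') < \<epsilon> / 2" using u e2 unfolding F_def by blast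
      have "nrm E ((v \<oplus>\<^bsub>E\<^esub> u) \<ominus>\<^bsub>E\<^esub> (w \<oplus>\<^bsub>E\<^esub> w')) \<le> nrm E (v \<ominus>\<^bsub>E\<^esub> w) + nrm E (u \<ominus>\<^bsub>E\<^esub> w')"
        unfolding add_diff_add[OF vu spE[OF w(1)] spE[OF w'(1)]]
        by (rule nrm_triangle) (use vu spE[OF w(1)] spE[OF w'(1)] in auto)
      also have "\<dots> < \<epsilon>" using w w' by simp
      finally show ?thesis using orbit_span_add[OF \<xi> w(1) w'(1)] by blast
    qed
    then show ?thesis using vu by (simp add: F_def)
  qed
  have Fsub: "submodule F scalars E"
    by (rule submodule_by_closure[OF FE subsetD[OF span_F orbit_span.zero] F_add F_smult])
  have Fcl: "closedin (ntopology E) F"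
    unfolding closedin_ntopology
  proof (intro conjI ballI FE)
    fix v assume v: "v \<in> carrier E - F"
    then obtain \<epsilon> where e: "0 < \<epsilon>" "\<And>w. w \<in> orbit_span E \<pi> \<xi> \<Longrightarrow> \<not> nrm E (v \<ominus>\<^bsub>E\<^esub> w) < \<epsilon>"
      unfolding F_def by blast
    show "\<exists>r>0. \<forall>y\<in>carrier E. nrm E (v \<ominus>\<^bsub>E\<^esub> y) < r \<longrightarrow> y \<notin> F"
    proof (intro exI[of _ "\<epsilon> / 2"] conjI ballI impI notI)
      show "0 < \<epsilon> / 2" using e by simp
      fix y assume y: "y \<in> carrier E" "nrm E (v \<ominus>\<^bsub>E\<^esub> y) < \<epsilon> / 2" "y \<in> F"
      have "0 < \<epsilon> / 2" using e by simp
      then obtain w where w: "w \<in> orbit_span E \<pi> \<xi>" "nrm E (y \<ominus>\<^bsub>E\<^esub> w) < \<epsilon> / 2"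
        using y(3) unfolding F_def by blast
      have "nrm E (v \<ominus>\<^bsub>E\<^esub> w) < \<epsilon>"
        using nrm_diff_triangle[of v y w] v y spE[OF w(1)] w(2) by simp
      with e(2)[OF w(1)] show False by simp
    qed
  qed
  have Fc: "closed_subspace F E" using Fsub Fcl by (simp add: closed_subspace_def)
  let ?F = "E\<lparr>carrier := F\<rparr>"
  have FB: "complex_banach_space ?F" by (rule banach_closed_subspace[OF B Fc])
  have FQ: "QSL_space TYPE('m) q ?F" by (rule QSL_space_subspace[OF Q q Fc])
  interpret FN: complex_normed_space ?F by (rule subspace_normed[OF Fsub])
  have iso: "invertible_isometry (\<pi> x) ?F ?F" for x
  proof -
    have "inj_on (\<pi> x) F"
    proof (rule inj_onI)
      fix a b assume ab: "a \<in> F" "b \<in> F" and eq: "\<pi> x a = \<pi> x b"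
      have "a \<in> carrier E" "b \<in> carrier E" using ab FE by auto
      from pi_minus[OF this(1), of x] pi_minus[OF this(2), of x] show "a = b" unfolding eq by simp
    qed
    moreover have "\<pi> x ` F = F"
    proof
      show "\<pi> x ` F \<subseteq> F" using F_pi by blast
      show "F \<subseteq> \<pi> x ` F"
      proof
        fix v assume v: "v \<in> F"
        then have "v = \<pi> x (\<pi> (- x) v)" using FE by auto
        then show "v \<in> \<pi> x ` F" using F_pi[OF v, of "- x"] by (rule image_eqI)
      qed
    qed
    ultimately show ?thesis
      using FE by (auto simp: invertible_isometry_def bij_betw_def pi_add pi_smult subset_iff)
  qed
  have cont: "continuous_map euclidean (ntopology ?F) (\<lambda>x. \<pi> x \<eta>)" if \<eta>: "\<eta> \<in> F" for \<eta>
    unfolding continuous_map_def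
  proof (intro conjI allI impI)
    show "(\<lambda>x. \<pi> x \<eta>) \<in> topspace euclidean \<rightarrow> topspace (ntopology ?F)" using F_pi[OF \<eta>] by simp
    fix U assume U: "openin (ntopology ?F) U"
    have "open {x. \<pi> x \<eta> \<in> U}"
    proof (subst open_subopen, intro ballI)
      fix x assume "x \<in> {x. \<pi> x \<eta> \<in> U}"
      then have "\<pi> x \<eta> \<in> U" by simp
      then obtain r where r: "0 < r" "\<And>y. y \<in> F \<Longrightarrow> nrm E (\<pi> x \<eta> \<ominus>\<^bsub>?F\<^esub> y) < r \<Longrightarrow> y \<in> U"
        using U unfolding FN.openin_ntopology by auto
      have \<eta>E: "\<eta> \<in> carrier E" using \<eta> FE by blast
      obtain T where T: "open T" "x \<in> T" "\<And>z. z \<in> T \<Longrightarrow> nrm E (\<pi> z \<eta> \<ominus>\<^bsub>E\<^esub> \<pi> x \<eta>) < r"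
        using pi_continuous[OF \<eta>E r(1), of x] by blast
      have "\<pi> z \<eta> \<in> U" if "z \<in> T" for z
        using r(2)[OF F_pi[OF \<eta>], of z] T(3)[OF that] nrm_diff_commute[OF pi_in[OF \<eta>E] pi_in[OF \<eta>E]]
        by (simp add: subspace_minus[OF Fsub F_pi[OF \<eta>] F_pi[OF \<eta>]])
      then show "\<exists>T. open T \<and> x \<in> T \<and> T \<subseteq> {x. \<pi> x \<eta> \<in> U}" using T(1,2) by blast
    qed
    then show "openin euclidean {x \<in> topspace euclidean. \<pi> x \<eta> \<in> U}" by simp
  qed
  have Frep: "representation ?F \<pi>"
    unfolding representation_def
    using FB iso cont pi_plus FE by auto
  interpret FR: isometric_representation ?F \<pi> by unfold_locales (rule Frep)
  have \<xi>F: "\<xi> \<in> F"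
  proof -
    have "\<zero>\<^bsub>E\<^esub> \<oplus>\<^bsub>E\<^esub> 1 \<odot>\<^bsub>E\<^esub> \<pi> 0 \<xi> \<in> orbit_span E \<pi> \<xi>" by (rule orbit_span.step[OF orbit_span.zero])
    then show ?thesis using span_F \<xi> by auto
  qed
  have span_eq: "v \<in> orbit_span ?F \<pi> \<xi>" if "v \<in> orbit_span E \<pi> \<xi>" for v
    using that
  proof (induction rule: orbit_span.induct)
    case zero
    show ?case using orbit_span.zero[of ?F \<pi> \<xi>] by simp
  next
    case (step v c x)
    show ?case using orbit_span.step[OF step.IH, of c x] by simp
  qed
  have "ntopology ?F closure_of L1_orbit \<mu> ?F \<pi> \<xi> = carrier ?F"
  proof (rule FR.dense_span_cyclic[OF lc FB h])
    show "\<xi> \<in> carrier ?F" using \<xi>F by simp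
    fix v and \<epsilon> :: real assume v: "v \<in> carrier ?F" and e: "0 < \<epsilon>"
    then obtain w where w: "w \<in> orbit_span E \<pi> \<xi>" "nrm E (v \<ominus>\<^bsub>E\<^esub> w) < \<epsilon>" by (auto simp: F_def)
    have "w \<in> F" using w(1) span_F by blast
    then have "nrm ?F (v \<ominus>\<^bsub>?F\<^esub> w) < \<epsilon>" using v w(2) by (simp add: subspace_minus[OF Fsub])
    then show "\<exists>w\<in>orbit_span ?F \<pi> \<xi>. nrm ?F (v \<ominus>\<^bsub>?F\<^esub> w) < \<epsilon>" using span_eq[OF w(1)] by blast
  qed
  then have "Cyc TYPE('m) \<mu> q ?F \<pi>"
    unfolding Cyc_def Rep_def using Frep FQ \<xi>F by auto
  then show thesis using \<xi>F FE by (rule that)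
qed

lemma representation_normed: "representation E \<pi> \<Longrightarrow> complex_normed_space E"
  unfolding representation_def by (blast dest: complex_banach_space.axioms(1))

theorem corollary5p2:
  fixes \<mu> :: "'g::{topological_group_add, t2_space} measure"
    and p :: real
    and f g :: "'g \<Rightarrow> complex"
  assumes "locally_compact_space (euclidean :: 'g topology)"
    and "left_haar_measure \<mu>"
    and "1 < p"
    and "f \<in> Ap \<mu> p"
    and "g \<in> Bp TYPE('e) TYPE('m) p"
  shows "(\<lambda>x. f x * g x) \<in> Ap \<mu> p \<and>
         Ap_norm \<mu> p (\<lambda>x. f x * g x) \<le> Ap_norm \<mu> p f * Bp_norm TYPE('e) TYPE('m) \<mu> p g"
proof -
  note lc = assms(1) and h = assms(2) and p = assms(3)
  define SA where "SA = {(\<Sum>n. Lnorm (conj_exp p) \<mu> (\<xi> n) * Lnorm p \<mu> (\<phi> n)) |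
            \<xi> \<phi>. Ap_expansion \<mu> p f \<xi> \<phi>}"
  define SB where "SB = {(\<Sum>n. nrm (E n) (\<xi> n) * dual_norm (E n) (\<phi> n)) |
            (E :: nat \<Rightarrow> 'e cnspace) \<pi> \<xi> \<phi>.
            (\<forall>n. Cyc TYPE('m) \<mu> (conj_exp p) (E n) (\<pi> n) \<and> \<xi> n \<in> carrier (E n) \<and> \<phi> n \<in> dual (E n)) \<and>
            summable (\<lambda>n. nrm (E n) (\<xi> n) * dual_norm (E n) (\<phi> n)) \<and>
            (\<forall>x. (\<lambda>n. \<phi> n (\<pi> n x (\<xi> n))) sums g x)}"
  have A: "Ap_norm \<mu> p f = Inf SA" by (simp add: Ap_norm_def SA_def)
  have Bn: "Bp_norm TYPE('e) TYPE('m) \<mu> p g = Inf SB" by (simp add: Bp_norm_def SB_def)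
  have SA_ne: "SA \<noteq> {}" using assms(4) by (auto simp: SA_def Ap_def)
  \<comment> \<open>the coefficient of a cyclic subrepresentation, padded with zeros, is an admissible expansion\<close>
  have SB_ne: "SB \<noteq> {}"
  proof -
    obtain E :: "'e cnspace" and \<pi> \<xi> \<phi> where R: "Rep TYPE('m) (conj_exp p) E \<pi>"
      and \<xi>: "\<xi> \<in> carrier E" and \<phi>: "\<phi> \<in> dual E" and g: "\<And>x. g x = \<phi> (\<pi> x \<xi>)"
      using assms(5) by (auto simp: Bp_def)
    have q1: "1 \<le> conj_exp p" using conj_exp_gt_1[OF p] by simp
    obtain F where F: "Cyc TYPE('m) \<mu> (conj_exp p) (E\<lparr>carrier := F\<rparr>) \<pi>" "\<xi> \<in> F" "F \<subseteq> carrier E"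
      by (rule cyclic_subrepresentation[OF lc h q1 R \<xi>])
    let ?F = "E\<lparr>carrier := F\<rparr>"
    have r: "representation ?F \<pi>" using F(1) by (simp add: Cyc_def Rep_def)
    have fn: "complex_normed_space ?F" by (rule representation_normed[OF r])
    interpret FN: isometric_representation ?F \<pi>
      by (intro isometric_representation.intro isometric_representation_axioms.intro fn r)
    have \<phi>F: "\<phi> \<in> dual ?F"
    proof -
      obtain C where "\<forall>x\<in>carrier E. cmod (\<phi> x) \<le> C * nrm E x"
        using \<phi> unfolding dual_def by blast
      then show ?thesis
        using \<phi> F(3) by (intro FN.dualI[of _ C]) (auto simp: dual_def subset_iff)
    qed
    let ?\<xi> = "\<lambda>n::nat. if n = 0 then \<xi> else \<zero>\<^bsub>?F\<^esub>"
    have z: "\<phi> (\<pi> x \<zero>\<^bsub>?F\<^esub>) = 0" for x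
      using FN.dual_zero[OF FN.dual_pi(1)[OF \<phi>F]] by simp
    have "(\<lambda>n. nrm ?F (?\<xi> n) * dual_norm ?F \<phi>) sums (\<Sum>n\<in>{0}. nrm ?F (?\<xi> n) * dual_norm ?F \<phi>)"
      using FN.nrm_zero by (intro sums_finite) auto
    then have sm: "summable (\<lambda>n. nrm ?F (?\<xi> n) * dual_norm ?F \<phi>)" by (rule sums_summable)
    have "(\<lambda>n. \<phi> (\<pi> x (?\<xi> n))) sums (\<Sum>n\<in>{0}. \<phi> (\<pi> x (?\<xi> n)))" for x
      using z by (intro sums_finite) auto
    then have gs: "(\<lambda>n. \<phi> (\<pi> x (?\<xi> n))) sums g x" for x using g by simp
    have car: "?\<xi> n \<in> carrier ?F" for n using F(2) FN.M.zero_closed by auto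
    have "(\<Sum>n. nrm ?F (?\<xi> n) * dual_norm ?F \<phi>) \<in> SB"
      unfolding SB_def using F(1) car \<phi>F sm gs
      by (intro CollectI exI[of _ "\<lambda>_. ?F"] exI[of _ "\<lambda>_. \<pi>"] exI[of _ ?\<xi>] exI[of _ "\<lambda>_. \<phi>"]) blast
    then show ?thesis by blast
  qed
  have bound: "Ap_bounded \<mu> p (\<lambda>x. f x * g x) (a * b)" if "a \<in> SA" "b \<in> SB" for a b
  proof -
    obtain \<eta> \<psi> where a: "Ap_expansion \<mu> p f \<eta> \<psi>"
      "a = (\<Sum>n. Lnorm (conj_exp p) \<mu> (\<eta> n) * Lnorm p \<mu> (\<psi> n))"
      using \<open>a \<in> SA\<close> by (auto simp: SA_def)
    obtain E :: "nat \<Rightarrow> 'e cnspace" and \<pi> \<xi> \<phi> where b: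
      "\<forall>n. Cyc TYPE('m) \<mu> (conj_exp p) (E n) (\<pi> n) \<and> \<xi> n \<in> carrier (E n) \<and> \<phi> n \<in> dual (E n)"
      "summable (\<lambda>n. nrm (E n) (\<xi> n) * dual_norm (E n) (\<phi> n))"
      "\<forall>x. (\<lambda>n. \<phi> n (\<pi> n x (\<xi> n))) sums g x"
      "b = (\<Sum>n. nrm (E n) (\<xi> n) * dual_norm (E n) (\<phi> n))"
      using \<open>b \<in> SB\<close> unfolding SB_def by blast
    show ?thesis unfolding a(2) b(4)
      by (rule product_expansion_bounded[OF h p a(1), where 'm = 'm and \<pi> = \<pi>])
         (use b in \<open>auto simp: Cyc_def\<close>)
  qed
  have SA0: "0 \<le> a" if "a \<in> SA" for a
    using that Ap_expansion_sum_nonneg by (auto simp: SA_def)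
  have SB0: "0 \<le> b" if "b \<in> SB" for b
  proof -
    obtain E :: "nat \<Rightarrow> 'e cnspace" and \<pi> \<xi> \<phi> where b:
      "\<forall>n. Cyc TYPE('m) \<mu> (conj_exp p) (E n) (\<pi> n) \<and> \<xi> n \<in> carrier (E n) \<and> \<phi> n \<in> dual (E n)"
      "summable (\<lambda>n. nrm (E n) (\<xi> n) * dual_norm (E n) (\<phi> n))"
      "b = (\<Sum>n. nrm (E n) (\<xi> n) * dual_norm (E n) (\<phi> n))"
      using \<open>b \<in> SB\<close> unfolding SB_def by blast
    have "0 \<le> nrm (E n) (\<xi> n) * dual_norm (E n) (\<phi> n)" for n
    proof -
      have r: "representation (E n) (\<pi> n)" and m: "\<xi> n \<in> carrier (E n)" "\<phi> n \<in> dual (E n)"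
        using b(1) by (auto simp: Cyc_def Rep_def)
      interpret complex_normed_space "E n" by (rule representation_normed[OF r])
      show ?thesis by (intro mult_nonneg_nonneg nrm_nonneg dual_norm_nonneg m)
    qed
    then show ?thesis unfolding b(3) by (rule suminf_nonneg[OF b(2)])
  qed
  have A0: "0 \<le> Inf SA" and B0: "0 \<le> Inf SB"
    using SA_ne SA0 SB_ne SB0 by (auto intro: cInf_greatest)
  have "Ap_bounded \<mu> p (\<lambda>x. f x * g x) (Inf SA * Inf SB)"
  proof (rule Ap_bounded_limit)
    fix c assume c: "Inf SA * Inf SB < c"
    have "((\<lambda>t. (Inf SA + t) * (Inf SB + t)) \<longlongrightarrow> (Inf SA + 0) * (Inf SB + 0)) (at_right 0)"
      by (intro tendsto_intros)
    then have "\<forall>\<^sub>F t in at_right 0. (Inf SA + t) * (Inf SB + t) < c"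
      by (rule order_tendstoD(2)) (use c in simp)
    moreover have "\<forall>\<^sub>F t in at_right 0. (0::real) < t" by (rule eventually_at_right_less)
    ultimately have "\<forall>\<^sub>F t in at_right 0. 0 < t \<and> (Inf SA + t) * (Inf SB + t) < c"
      by eventually_elim simp
    then obtain t where t: "0 < t" "(Inf SA + t) * (Inf SB + t) < c"
      using eventually_happens'[of "at_right (0::real)"] by (auto simp: trivial_limit_at_right_real)
    obtain a where a: "a \<in> SA" "a < Inf SA + t" using cInf_lessD[OF SA_ne, of "Inf SA + t"] t(1) by auto
    obtain b where b: "b \<in> SB" "b < Inf SB + t" using cInf_lessD[OF SB_ne, of "Inf SB + t"] t(1) by auto
    have "a * b \<le> (Inf SA + t) * (Inf SB + t)"
      using a b SA0[OF a(1)] SB0[OF b(1)] A0 t(1) by (intro mult_mono) auto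
    with t(2) show "Ap_bounded \<mu> p (\<lambda>x. f x * g x) c"
      by (intro Ap_bounded_mono[OF bound[OF a(1) b(1)]]) simp
  qed
  from Ap_bounded_norm_le[OF this] show ?thesis unfolding A Bn .
qed
end
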